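(* There exists $\delta>0$ such that for any $\mu>0$ the following holds. Let $a_0\in C^3([-\pi,\pi])$ satisfy $\int_{-\pi}^\pi a_0(x)\,dx=0$ and $$\|a_0-\mu\cos(\cdot)\|_{C^3([-\pi,\pi])}=\sigma\le\delta\mu .$$ Then the Proudman–Johnson equation $$\partial_t a+\Big(\int_{-\pi}^x a(t,\bar x)\,d\bar x\Big)\partial_x a-a^2+\frac1\pi\int_{-\pi}^{\pi}a^2\,dx=0,\qquad x\in[-\pi,\pi],$$ with $\int_{-\pi}^\pi a(t,x)dx=0$, has a unique global-in-time $C^3$ solution $a$ with $a(0,\cdot)=a_0$. Moreover, for all $t\ge0$, $$\|a(t,\cdot)-\mu_*\cos(\cdot)\|_{C^1([-\pi,\pi])}\lesssim\sigma e^{-\mu t/2},$$ where $\mu_*=-\partial_x^2a_0(x_0^* )$, with $x_0^*$ the point at which $a_0$ attains its maximum, and $\mu_*=\mu+O(\sigma)$.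
   Context: $\lesssim$ and $O(\cdot)$ denote bounds up to constants not depending on $a_0,\sigma,t$. *)

theory Defs
  imports "HOL-Analysis.Analysis"
begin

definition Ipi :: "real set" where
  "Ipi = {-pi..pi}"

fun dI :: "nat \<Rightarrow> (real \<Rightarrow> real) \<Rightarrow> real \<Rightarrow> real" where
  "dI 0 f = f"
| "dI (Suc k) f = (\<lambda>x. vector_derivative (dI k f) (at x within Ipi))"

definition Ck_on :: "nat \<Rightarrow> (real \<Rightarrow> real) \<Rightarrow> bool" where
  "Ck_on k f \<longleftrightarrow>
     (\<forall>j<k. \<forall>x\<in>Ipi. (dI j f has_vector_derivative dI (Suc j) f x) (at x within Ipi))
     \<and> continuous_on Ipi (dI k f)"

definition Ck_norm :: "nat \<Rightarrow> (real \<Rightarrow> real) \<Rightarrow> real" where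
  "Ck_norm k f = (SUP j\<in>{..k}. SUP x\<in>Ipi. \<bar>dI j f x\<bar>)"

definition PJ_sol :: "(real \<Rightarrow> real) \<Rightarrow> (real \<Rightarrow> real \<Rightarrow> real) \<Rightarrow> bool" where
  "PJ_sol a0 a \<longleftrightarrow>
     (\<forall>x\<in>Ipi. a 0 x = a0 x)
     \<and> (\<forall>t\<ge>0. Ck_on 3 (a t))
     \<and> (\<forall>j\<le>3. continuous_on ({0..} \<times> Ipi) (\<lambda>(t, x). dI j (a t) x))
     \<and> (\<forall>t\<ge>0. integral Ipi (a t) = 0)
     \<and> (\<exists>adot. continuous_on ({0..} \<times> Ipi) (\<lambda>(t, x). adot t x)
          \<and> (\<forall>t\<ge>0. \<forall>x\<in>Ipi.
               ((\<lambda>s. a s x) has_real_derivative adot t x) (at t within {0..})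
               \<and> adot t x + integral {-pi..x} (a t) * dI 1 (a t) x - (a t x)\<^sup>2
                   + (1 / pi) * integral Ipi (\<lambda>y. (a t y)\<^sup>2) = 0))"

end

theory Submission
  imports Defs
begin

text \<open>
  Along the characteristics \<open>X\<close> of the equation the inverse Jacobian \<open>w = 1 / \<partial>\<^sub>x X\<close> solves the linear
  equation \<open>w'' = I(t) w\<close> with \<open>I\<close> independent of \<open>x\<close>. Hence \<open>w = P (1 - s a\<^sub>0)\<close> with two functions
  \<open>P\<close>, \<open>s\<close> of time alone; conservation of length forces
  \<open>2 \<pi> P(s) = \<integral> dx / (1 - s a\<^sub>0)\<close> and the Wronskian gives \<open>s' = P(s)\<^sup>-\<^sup>2\<close>. The quadratic
  maximum \<open>M\<close> of \<open>a\<^sub>0\<close> makes \<open>\<integral> P\<^sup>2 ds\<close> diverge at \<open>s = 1 / M\<close>, so this explicit solution is global.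
  In these variables \<open>\<partial>\<^sub>x a\<close> is simply \<open>a\<^sub>0' / w\<close>. With \<open>\<eta> = 1 - s M\<close>, replacing \<open>M - a\<^sub>0(x)\<close> by
  \<open>\<mu>\<^sub>* (1 - cos (x - x\<^sub>0))\<close> costs a factor \<open>1 + O(\<sigma> |x - x\<^sub>0|)\<close>, and for the latter profile
  everything is an explicit disc automorphism under which \<open>a\<^sub>0' / w\<close> becomes \<open>- \<mu>\<^sub>* sin\<close> exactly. The error
  is \<open>O(\<sigma> \<surd>\<eta> log (1 / \<eta>))\<close>, while \<open>\<eta>\<close> decays like \<open>exp (- 2 \<mu> t)\<close> up to a loss in the exponent
  proportional to the smallness of the perturbation. Uniqueness is an \<open>L\<^sup>2\<close> energy estimate.
\<close>

section \<open>Functions of class \<open>C\<^sup>k\<close> on the interval\<close>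

text \<open>As \<eta> tends to 0 the Jacobian concentrates at the maximum, with height of order
  \<eta>^(-1/2) and width of order \<eta>^(1/2) in the label. The flow has no regular limit, so
  every estimate compares it with the flow of the model profile at the same \<eta>. If the two
  profiles agreed only up to a relative error of order \<sigma>, the resulting bound on the slope
  would not decay. The extra factor |x - x0| comes from a difference that vanishes to third order at
  x0; this is what the C^3 distance and the choice of the limit amplitude as the curvature at the
  maximum provide. The slope is estimated before the solution itself because the nonlocal terms drop
  out of the quotient; the zero mean then recovers the solution. For the exact cosine, sqrt \<eta>
  is of order exp (-\<mu> t), twice the claimed exponent: this room pays for the logarithm and for
  the slower decay of \<eta> under perturbation. The scaling a(t, x) -> \<mu> a(\<mu> t, x) reduces
  everything to \<mu> = 1.\<close>

lemma Ipi_simps [simp]: "x \<in> Ipi \<longleftrightarrow> -pi \<le> x \<and> x \<le> pi"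
  by (simp add: Ipi_def)

lemma compact_Ipi: "compact Ipi"
  and convex_Ipi: "convex Ipi"
  and Ipi_nonempty: "Ipi \<noteq> {}"
  by (simp_all add: Ipi_def)

lemma vector_derivative_Ipi:
  fixes f :: "real \<Rightarrow> real"
  assumes "(f has_vector_derivative d) (at x within Ipi)" "x \<in> Ipi"
  shows "vector_derivative f (at x within Ipi) = d"
  using vector_derivative_within_cbox[of "-pi" pi x f d] assms pi_gt_zero
  by (simp add: Ipi_def)

text \<open>\<open>dI\<close> rests on the choice operator behind \<open>vector_derivative\<close>,
  so it is computed by exhibiting candidates for all orders. Equality of \<open>f\<close> and
  \<open>g 0\<close> on \<open>Ipi\<close> is enough because every derivative is taken within
  \<open>Ipi\<close>. Linear combinations, the cosine and the explicit solution are all treated this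
  way.\<close>

lemma dI_chain:
  assumes "\<And>j x. j < k \<Longrightarrow> x \<in> Ipi \<Longrightarrow> (g j has_vector_derivative g (Suc j) x) (at x within Ipi)"
    and "\<And>x. x \<in> Ipi \<Longrightarrow> f x = g 0 x" and "j \<le> k" "x \<in> Ipi"
  shows "dI j f x = g j x"
  using assms(3,4)
proof (induction j arbitrary: x)
  case 0
  then show ?case using assms(2) by simp
next
  case (Suc j)
  have "(g j has_vector_derivative g (Suc j) x) (at x within Ipi)"
    using Suc.prems by (intro assms(1)) auto
  moreover have "\<And>y. y \<in> Ipi \<Longrightarrow> g j y = dI j f y"
    using Suc by simp
  ultimately have "(dI j f has_vector_derivative g (Suc j) x) (at x within Ipi)"
    using Suc.prems(2) has_vector_derivative_transform by metis
  then show ?case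
    using Suc.prems(2) vector_derivative_Ipi by simp
qed

lemma Ck_on_chain:
  assumes g: "\<And>j x. j < k \<Longrightarrow> x \<in> Ipi \<Longrightarrow> (g j has_vector_derivative g (Suc j) x) (at x within Ipi)"
    and f: "\<And>x. x \<in> Ipi \<Longrightarrow> f x = g 0 x" and c: "continuous_on Ipi (g k)"
  shows "Ck_on k f"
proof -
  have eq: "dI j f x = g j x" if "j \<le> k" "x \<in> Ipi" for j x
    using dI_chain[where g = g, OF g f that] by simp
  have "(dI j f has_vector_derivative dI (Suc j) f x) (at x within Ipi)" if "j < k" "x \<in> Ipi" for j x
    using has_vector_derivative_transform[OF that(2) _ g[OF that]] eq that
    by (metis Suc_leI less_imp_le)
  moreover have "continuous_on Ipi (dI k f)"
    using c eq continuous_on_cong by (metis order_refl)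
  ultimately show ?thesis unfolding Ck_on_def by blast
qed

lemma Ck_on_deriv:
  assumes "Ck_on k f" "j < k" "x \<in> Ipi"
  shows "(dI j f has_vector_derivative dI (Suc j) f x) (at x within Ipi)"
  using assms unfolding Ck_on_def by blast

lemma Ck_on_continuous:
  assumes "Ck_on k f" "j \<le> k"
  shows "continuous_on Ipi (dI j f)"
proof (cases "j = k")
  case False
  then have "j < k" using assms(2) by simp
  then show ?thesis
    using Ck_on_deriv[OF assms(1)] has_vector_derivative_continuous continuous_on_eq_continuous_within
    by metis
qed (use assms in \<open>simp add: Ck_on_def\<close>)

lemma dI_lincomb:
  assumes "Ck_on k f" "Ck_on k g" "j \<le> k" "x \<in> Ipi"
  shows "dI j (\<lambda>x. a * f x + b * g x) x = a * dI j f x + b * dI j g x"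
proof (rule dI_chain[where g = "\<lambda>j x. a * dI j f x + b * dI j g x" and k = k])
  fix j x assume "j < k" "x \<in> Ipi"
  then show "((\<lambda>x. a * dI j f x + b * dI j g x) has_vector_derivative
        a * dI (Suc j) f x + b * dI (Suc j) g x) (at x within Ipi)"
    using Ck_on_deriv[OF assms(1)] Ck_on_deriv[OF assms(2)]
    unfolding has_real_derivative_iff_has_vector_derivative[symmetric]
    by (auto intro!: DERIV_add DERIV_cmult simp del: dI.simps)
qed (use assms in auto)

lemma Ck_on_lincomb:
  assumes "Ck_on k f" "Ck_on k g"
  shows "Ck_on k (\<lambda>x. a * f x + b * g x)"
proof (rule Ck_on_chain[where g = "\<lambda>j x. a * dI j f x + b * dI j g x"])
  fix j x assume "j < k" "x \<in> Ipi"
  then show "((\<lambda>x. a * dI j f x + b * dI j g x) has_vector_derivative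
        a * dI (Suc j) f x + b * dI (Suc j) g x) (at x within Ipi)"
    using Ck_on_deriv[OF assms(1)] Ck_on_deriv[OF assms(2)]
    unfolding has_real_derivative_iff_has_vector_derivative[symmetric]
    by (auto intro!: DERIV_add DERIV_cmult simp del: dI.simps)
qed (auto intro!: continuous_intros Ck_on_continuous[OF assms(1)] Ck_on_continuous[OF assms(2)])

text \<open>A shift of the argument by \<open>j * (pi/2)\<close> gives one formula for all orders,
  so the cosine becomes a chain in the sense of \<open>dI_chain\<close>.\<close>

lemma cos_chain:
  "((\<lambda>x::real. cos (x + real j * (pi/2))) has_vector_derivative cos (x + real (Suc j) * (pi/2))) (at x within S)"
proof -
  have e: "x + real (Suc j) * (pi/2) = (x + real j * (pi/2)) + pi/2"
    by (simp add: algebra_simps)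
  have "cos (x + real (Suc j) * (pi/2)) = - sin (x + real j * (pi/2))"
    unfolding e cos_add[of "x + real j * (pi/2)"] by simp
  then show ?thesis
    unfolding has_real_derivative_iff_has_vector_derivative[symmetric]
    by (auto intro!: derivative_eq_intros)
qed

lemma Ck_on_cos: "Ck_on k cos"
proof (rule Ck_on_chain[where g = "\<lambda>j x. cos (x + real j * (pi/2))"])
qed (rule cos_chain, simp, intro continuous_intros)

lemma dI_cos: "x \<in> Ipi \<Longrightarrow> dI j cos x = cos (x + real j * (pi/2))"
proof (rule dI_chain[where g = "\<lambda>j x. cos (x + real j * (pi/2))" and k = j])
qed (rule cos_chain, simp_all)

lemma Ck_norm_ge:
  assumes "Ck_on k f" "j \<le> k" "x \<in> Ipi"
  shows "\<bar>dI j f x\<bar> \<le> Ck_norm k f"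
proof -
  have "bdd_above ((\<lambda>x. \<bar>dI j f x\<bar>) ` Ipi)"
    using Ck_on_continuous[OF assms(1,2)] compact_Ipi
    by (intro bounded_imp_bdd_above compact_imp_bounded compact_continuous_image continuous_on_rabs)
  then have "\<bar>dI j f x\<bar> \<le> (SUP x\<in>Ipi. \<bar>dI j f x\<bar>)"
    using assms(3) by (intro cSUP_upper)
  also have "\<dots> \<le> Ck_norm k f"
    unfolding Ck_norm_def using assms(2) by (intro cSUP_upper) auto
  finally show ?thesis .
qed

lemma Ck_norm_le:
  assumes "\<And>j x. j \<le> k \<Longrightarrow> x \<in> Ipi \<Longrightarrow> \<bar>dI j f x\<bar> \<le> B"
  shows "Ck_norm k f \<le> B"
  unfolding Ck_norm_def using assms Ipi_nonempty by (auto intro!: cSUP_least)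

lemma continuous_on_slice:
  assumes "continuous_on (T \<times> S) (\<lambda>(t, x). F t x)" "t \<in> T"
  shows "continuous_on S (F t)"
proof -
  have "continuous_on S (\<lambda>x. case (t, x) of (t, x) \<Rightarrow> F t x)"
    by (rule continuous_on_compose2[OF assms(1)]) (use assms(2) in \<open>auto intro!: continuous_on_Pair\<close>)
  then show ?thesis by simp
qed

section \<open>Uniqueness\<close>

text \<open>Cauchy-Schwarz against the constant 1, read off from the nonnegative integral of
  \<open>(d y - l)^2\<close>; \<open>l = U / (2 * pi)\<close> is the optimal constant for an
  interval of length \<open>2 * pi\<close>.\<close>

lemma primitive_squared_le:
  fixes d :: "real \<Rightarrow> real"
  assumes d: "continuous_on Ipi d" and x: "x \<in> Ipi"
  shows "(integral {-pi..x} d)\<^sup>2 \<le> 2 * pi * integral Ipi (\<lambda>y. (d y)\<^sup>2)"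
proof -
  define U where "U = integral {-pi..x} d"
  define l where "l = U / (2 * pi)"
  have sub: "{-pi..x} \<subseteq> Ipi" using x by (auto simp: Ipi_def)
  have d': "continuous_on {-pi..x} d" using d sub continuous_on_subset by blast
  have "0 \<le> integral {-pi..x} (\<lambda>y. (d y - l)\<^sup>2)"
    by (intro integral_nonneg integrable_continuous_real continuous_intros d') auto
  also have "(\<lambda>y. (d y - l)\<^sup>2) = (\<lambda>y. (d y)\<^sup>2 - 2 * l * d y + l\<^sup>2)"
    by (auto simp: power2_eq_square algebra_simps)
  also have "integral {-pi..x} \<dots> = integral {-pi..x} (\<lambda>y. (d y)\<^sup>2) - 2 * l * U + l\<^sup>2 * (x + pi)"
    using x by (subst integral_add integral_diff; (intro integrable_continuous_real continuous_intros d')?)+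
       (simp add: U_def)
  also have "\<dots> \<le> integral Ipi (\<lambda>y. (d y)\<^sup>2) - 2 * l * U + l\<^sup>2 * (2 * pi)"
  proof -
    have "integral {-pi..x} (\<lambda>y. (d y)\<^sup>2) \<le> integral Ipi (\<lambda>y. (d y)\<^sup>2)"
      using sub d d' by (intro integral_subset_le) (auto simp: Ipi_def intro!: integrable_continuous_real continuous_intros)
    moreover have "l\<^sup>2 * (x + pi) \<le> l\<^sup>2 * (2 * pi)"
      using x by (intro mult_left_mono) auto
    ultimately show ?thesis by linarith
  qed
  finally have "0 \<le> integral Ipi (\<lambda>y. (d y)\<^sup>2) - U\<^sup>2 / (2 * pi)"
    using pi_gt_zero by (simp add: l_def power2_eq_square field_simps)
  then show ?thesis
    using pi_gt_zero by (simp add: U_def field_simps)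
qed

text \<open>Mean value theorem for \<open>E t * exp (- K * t)\<close>, whose derivative is
  nonpositive. Both \<open>K\<close> and \<open>E\<close> may have any sign: the energy estimate
  uses a nonnegative \<open>K\<close>, the decay of \<eta> uses \<open>K = - (3/2)\<close>.\<close>

lemma gronwall_zero:
  fixes E :: "real \<Rightarrow> real"
  assumes T: "0 \<le> T" and E: "\<And>t. t \<in> {0..T} \<Longrightarrow> (E has_real_derivative E' t) (at t within {0..T})"
    and le: "\<And>t. t \<in> {0..T} \<Longrightarrow> E' t \<le> K * E t" and E0: "E 0 \<le> 0"
  shows "E T \<le> 0"
proof -
  have der: "((\<lambda>t. E t * exp (- K * t)) has_real_derivative (E' t - K * E t) * exp (- K * t)) (at t within {0..T})"
    if "t \<in> {0..T}" for t
    using E[OF that] by (auto intro!: derivative_eq_intros simp: algebra_simps)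
  have neg: "(E' t - K * E t) * exp (- K * t) \<le> 0" if "t \<in> {0..T}" for t
    using le[OF that] by (simp add: mult_nonpos_nonneg)
  obtain s where "s \<in> {0..T}" "E T * exp (- K * T) - E 0 * exp (- K * 0) = (E' s - K * E s) * exp (- K * s) * (T - 0)"
    using mvt_very_simple[of 0 T "\<lambda>t. E t * exp (- K * t)" "\<lambda>s h. (E' s - K * E s) * exp (- K * s) * h"] T der
    unfolding has_field_derivative_def by auto
  then have "E T * exp (- K * T) \<le> E 0 * exp (- K * 0)"
    using mult_nonpos_nonneg[OF neg[of s] T] by simp
  then show ?thesis
    using E0 mult_le_0_iff[of "E T" "exp (- K * T)"] by force
qed

text \<open>The square of the L2 distance obeys a linear differential inequality without loss of
  derivatives: the transport of \<open>d = b - a\<close> by \<open>a\<close> integrates by parts,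
  the nonlocal constant is orthogonal to \<open>d\<close>, which has zero mean, and the primitive of
  \<open>d\<close> is controlled by \<open>primitive_squared_le\<close>.\<close>

lemma PJ_sol_unique:
  assumes A: "PJ_sol a0 a" and B: "PJ_sol a0 b" and T: "T \<ge> 0" and x: "x \<in> Ipi"
  shows "b T x = a T x"
proof -
  obtain adot where adot_c: "continuous_on ({0..} \<times> Ipi) (\<lambda>(t, x). adot t x)"
    and adot_d: "\<And>t x. t \<ge> 0 \<Longrightarrow> x \<in> Ipi \<Longrightarrow> ((\<lambda>s. a s x) has_real_derivative adot t x) (at t within {0..})"
    and adot_e: "\<And>t x. t \<ge> 0 \<Longrightarrow> x \<in> Ipi \<Longrightarrow> adot t x + integral {-pi..x} (a t) * dI 1 (a t) x - (a t x)\<^sup>2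
                   + (1 / pi) * integral Ipi (\<lambda>y. (a t y)\<^sup>2) = 0"
    using A unfolding PJ_sol_def by blast
  obtain bdot where bdot_c: "continuous_on ({0..} \<times> Ipi) (\<lambda>(t, x). bdot t x)"
    and bdot_d: "\<And>t x. t \<ge> 0 \<Longrightarrow> x \<in> Ipi \<Longrightarrow> ((\<lambda>s. b s x) has_real_derivative bdot t x) (at t within {0..})"
    and bdot_e: "\<And>t x. t \<ge> 0 \<Longrightarrow> x \<in> Ipi \<Longrightarrow> bdot t x + integral {-pi..x} (b t) * dI 1 (b t) x - (b t x)\<^sup>2
                   + (1 / pi) * integral Ipi (\<lambda>y. (b t y)\<^sup>2) = 0"
    using B unfolding PJ_sol_def by blast
  have Ck: "Ck_on 3 (a t)" "Ck_on 3 (b t)" if "t \<ge> 0" for t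
    using A B that unfolding PJ_sol_def by auto
  have cA: "continuous_on ({0..} \<times> Ipi) (\<lambda>(t, x). dI j (a t) x)"
    and cB: "continuous_on ({0..} \<times> Ipi) (\<lambda>(t, x). dI j (b t) x)" if "j \<le> 3" for j
    using A B that unfolding PJ_sol_def by auto
  have ca: "continuous_on ({0..} \<times> Ipi) (\<lambda>(t, x). a t x)" and cb: "continuous_on ({0..} \<times> Ipi) (\<lambda>(t, x). b t x)"
    using cA[of 0] cB[of 0] by simp_all
  define d where "d = (\<lambda>t x. b t x - a t x)"
  have cd: "continuous_on ({0..} \<times> Ipi) (\<lambda>(t, x). d t x)"
    using continuous_on_diff[OF cb ca] by (simp add: d_def case_prod_unfold)
  define KK where "KK = {0..T} \<times> Ipi"
  have KK: "compact KK" "KK \<subseteq> {0..} \<times> Ipi"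
    using T by (auto simp: KK_def intro!: compact_Times compact_Ipi)
  have bound: "\<exists>K. \<forall>t\<in>{0..T}. \<forall>x\<in>Ipi. \<bar>F t x\<bar> \<le> K"
    if "continuous_on ({0..} \<times> Ipi) (\<lambda>(t, x). F t x)" for F :: "real \<Rightarrow> real \<Rightarrow> real"
  proof -
    have "bounded ((\<lambda>(t, x). F t x) ` KK)"
      using KK that by (intro compact_imp_bounded compact_continuous_image continuous_on_subset[OF that])
    then obtain K where "\<forall>z \<in> (\<lambda>(t, x). F t x) ` KK. norm z \<le> K" by (auto simp: bounded_iff)
    then show ?thesis by (intro exI[of _ K]) (auto simp: KK_def)
  qed
  obtain Ka Kb Kc where K: "\<And>t x. t \<in> {0..T} \<Longrightarrow> x \<in> Ipi \<Longrightarrow> \<bar>a t x\<bar> \<le> Ka"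
    "\<And>t x. t \<in> {0..T} \<Longrightarrow> x \<in> Ipi \<Longrightarrow> \<bar>b t x\<bar> \<le> Kb"
    "\<And>t x. t \<in> {0..T} \<Longrightarrow> x \<in> Ipi \<Longrightarrow> \<bar>dI 1 (b t) x\<bar> \<le> Kc"
    using bound[OF ca] bound[OF cb] bound[OF cB[of 1]] by (metis one_le_numeral)
  have Kpos: "0 \<le> Ka" "0 \<le> Kb" "0 \<le> Kc"
    using K[of 0 0] T by force+
  define E where "E = (\<lambda>t. integral Ipi (\<lambda>x. (d t x)\<^sup>2))"
  define E' where "E' = (\<lambda>t. integral Ipi (\<lambda>x. 2 * d t x * (bdot t x - adot t x)))"
  have dE: "(E has_real_derivative E' t) (at t within {0..})" if "t \<ge> 0" for t
    unfolding E_def E'_def Ipi_def cbox_interval[symmetric]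
  proof (rule leibniz_rule_field_derivative)
    fix s x :: real assume s: "s \<in> {0..}" "x \<in> cbox (-pi) pi"
    then have "((\<lambda>s. d s x) has_real_derivative bdot s x - adot s x) (at s within {0..})"
      unfolding d_def by (auto intro!: derivative_intros adot_d bdot_d)
    then show "((\<lambda>s. (d s x)\<^sup>2) has_real_derivative 2 * d s x * (bdot s x - adot s x)) (at s within {0..})"
      by (auto intro!: derivative_eq_intros)
  next
    fix s :: real assume "s \<in> {0..}"
    then show "(\<lambda>x. (d s x)\<^sup>2) integrable_on cbox (- pi) pi"
      using continuous_on_slice[OF cd, of s]
      by (auto intro!: integrable_continuous_real continuous_intros simp: Ipi_def)
  next
    show "continuous_on ({0..} \<times> cbox (- pi) pi) (\<lambda>(s, x). 2 * d s x * (bdot s x - adot s x))"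
      using cd adot_c bdot_c unfolding Ipi_def cbox_interval case_prod_unfold
      by (intro continuous_intros)
  qed (use that in auto)
  have dE_le: "E' t \<le> (Kc * (1 + 4 * pi\<^sup>2) + 3 * Ka + 2 * Kb) * E t" if t: "t \<in> {0..T}" for t
  proof -
    have t0: "t \<ge> 0" using t by simp
    define U where "U = (\<lambda>f x. integral {-pi..x} (f :: real \<Rightarrow> real))"
    define d1 where "d1 = (\<lambda>x. dI 1 (b t) x - dI 1 (a t) x)"
    define c where "c = (1 / pi) * (integral Ipi (\<lambda>y. (b t y)\<^sup>2) - integral Ipi (\<lambda>y. (a t y)\<^sup>2))"
    have cat: "continuous_on Ipi (a t)" and cbt: "continuous_on Ipi (b t)" and cdt: "continuous_on Ipi (d t)"
      and cb1: "continuous_on Ipi (dI 1 (b t))" and cd1: "continuous_on Ipi d1"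
      using continuous_on_slice[OF ca, of t] continuous_on_slice[OF cb, of t] continuous_on_slice[OF cd, of t]
        continuous_on_slice[OF cB, of 1 t] continuous_on_slice[OF cA, of 1 t] t0
      by (auto simp: d1_def intro!: continuous_intros)
    have dd: "(d t has_real_derivative d1 x) (at x within Ipi)" if "x \<in> Ipi" for x
      using Ck_on_deriv[OF Ck(1)[OF t0], of 0 x] Ck_on_deriv[OF Ck(2)[OF t0], of 0 x] that
      unfolding d_def d1_def has_real_derivative_iff_has_vector_derivative[symmetric]
      by (auto intro!: DERIV_diff)
    have dU: "(U f has_real_derivative f x) (at x within Ipi)" if "x \<in> Ipi" "continuous_on Ipi f" for f x
      using that integral_has_real_derivative[of "-pi" pi f x] unfolding U_def Ipi_def by simp
    have cU: "continuous_on Ipi (U f)" if "continuous_on Ipi f" for f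
      using dU[OF _ that] DERIV_continuous continuous_on_eq_continuous_within by blast
    have Uend: "U (a t) (-pi) = 0" "U (a t) pi = 0"
      using A t0 by (auto simp: U_def PJ_sol_def Ipi_def)
    have int0: "integral Ipi (d t) = 0"
      using A B t0 cat cbt unfolding d_def PJ_sol_def Ipi_def
      by (subst integral_diff) (auto intro: integrable_continuous_real)
    have Ud: "U (d t) x = U (b t) x - U (a t) x" if "x \<in> Ipi" for x
      unfolding d_def U_def using that cat cbt
      by (intro integral_diff integrable_continuous_real)
        (auto elim!: continuous_on_subset simp: Ipi_def)
    \<comment> \<open>The integrand is the derivative of \<open>U (a t) x * (d t x)^2\<close>. Its
      boundary values vanish since \<open>U (a t)\<close> is 0 at \<open>-pi\<close> by definition
      and at \<open>pi\<close> by the zero mean.\<close>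
    have parts: "integral Ipi (\<lambda>x. a t x * (d t x)\<^sup>2 + U (a t) x * (2 * d t x * d1 x)) = 0"
    proof -
      have "((\<lambda>x. a t x * (d t x)\<^sup>2 + U (a t) x * (2 * d t x * d1 x)) has_integral
          U (a t) pi * (d t pi)\<^sup>2 - U (a t) (-pi) * (d t (-pi))\<^sup>2) {-pi..pi}"
      proof (rule fundamental_theorem_of_calculus)
        fix x :: real assume x: "x \<in> {-pi..pi}"
        then have x: "x \<in> Ipi" by (simp add: Ipi_def)
        show "((\<lambda>x. U (a t) x * (d t x)\<^sup>2) has_vector_derivative
            a t x * (d t x)\<^sup>2 + U (a t) x * (2 * d t x * d1 x)) (at x within {-pi..pi})"
          using dd[OF x] dU[OF x cat]
          unfolding has_real_derivative_iff_has_vector_derivative[symmetric] Ipi_def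
          by (auto intro!: derivative_eq_intros)
      qed simp
      then show ?thesis by (simp add: Uend Ipi_def integral_unique)
    qed
    \<comment> \<open>The difference of the transport terms is split as
      \<open>U (d t) * dI 1 (b t) + U (a t) * d1\<close>, so the slope of \<open>d\<close> occurs
      only next to \<open>U (a t)\<close>. The term \<open>a t x * (d t x)^2\<close> is added and
      subtracted to complete the exact derivative of \<open>parts\<close>.\<close>
    have "E' t = integral Ipi (\<lambda>x. (- 2 * d t x * U (d t) x * dI 1 (b t) x
        + (a t x + 2 * (a t x + b t x)) * (d t x)\<^sup>2)
        - (a t x * (d t x)\<^sup>2 + U (a t) x * (2 * d t x * d1 x)) - 2 * c * d t x)"
      unfolding E'_def
    proof (rule integral_cong)
      fix x assume x: "x \<in> Ipi"
      have e1: "adot t x = - U (a t) x * dI 1 (a t) x + (a t x)\<^sup>2 - (1 / pi) * integral Ipi (\<lambda>y. (a t y)\<^sup>2)"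
        using adot_e[OF t0 x] by (simp add: U_def)
      have e2: "bdot t x = - U (b t) x * dI 1 (b t) x + (b t x)\<^sup>2 - (1 / pi) * integral Ipi (\<lambda>y. (b t y)\<^sup>2)"
        using bdot_e[OF t0 x] by (simp add: U_def)
      show "2 * d t x * (bdot t x - adot t x) = (- 2 * d t x * U (d t) x * dI 1 (b t) x
        + (a t x + 2 * (a t x + b t x)) * (d t x)\<^sup>2)
        - (a t x * (d t x)\<^sup>2 + U (a t) x * (2 * d t x * d1 x)) - 2 * c * d t x"
        unfolding Ud[OF x] e1 e2 c_def d1_def unfolding d_def by algebra
    qed
    also have "\<dots> = integral Ipi (\<lambda>x. - 2 * d t x * U (d t) x * dI 1 (b t) x
        + (a t x + 2 * (a t x + b t x)) * (d t x)\<^sup>2)"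
      using parts int0 unfolding Ipi_def
      by (subst integral_diff; (intro integrable_continuous_real continuous_intros
          cat[unfolded Ipi_def] cbt[unfolded Ipi_def] cdt[unfolded Ipi_def] cb1[unfolded Ipi_def] cd1[unfolded Ipi_def]
          cU[unfolded Ipi_def])?)+ simp
    also have "\<dots> \<le> integral Ipi (\<lambda>x. (Kc + 3 * Ka + 2 * Kb) * (d t x)\<^sup>2 + Kc * (2 * pi * E t))"
      unfolding Ipi_def
    proof (rule integral_le)
      fix x :: real assume "x \<in> {-pi..pi}"
      then have x: "x \<in> Ipi" by (simp add: Ipi_def)
      have "- 2 * d t x * U (d t) x \<le> (d t x)\<^sup>2 + (U (d t) x)\<^sup>2"
        "2 * d t x * U (d t) x \<le> (d t x)\<^sup>2 + (U (d t) x)\<^sup>2"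
        using zero_le_power2[of "d t x + U (d t) x"] zero_le_power2[of "d t x - U (d t) x"]
        by (auto simp: power2_eq_square algebra_simps)
      then have "\<bar>- 2 * d t x * U (d t) x\<bar> \<le> (d t x)\<^sup>2 + (U (d t) x)\<^sup>2"
        by linarith
      also have "\<dots> \<le> (d t x)\<^sup>2 + 2 * pi * E t"
        using primitive_squared_le[OF cdt x] by (simp add: U_def E_def)
      finally have "\<bar>- 2 * d t x * U (d t) x\<bar> * \<bar>dI 1 (b t) x\<bar> \<le> ((d t x)\<^sup>2 + 2 * pi * E t) * Kc"
        using K(3)[OF t x] by (intro mult_mono) auto
      then have 1: "- 2 * d t x * U (d t) x * dI 1 (b t) x \<le> ((d t x)\<^sup>2 + 2 * pi * E t) * Kc"
        by (metis abs_le_D1 abs_mult)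
      have "(a t x + 2 * (a t x + b t x)) \<le> 3 * Ka + 2 * Kb"
        using abs_le_D1[OF K(1)[OF t x]] abs_le_D1[OF K(2)[OF t x]] by (simp add: algebra_simps)
      then have 2: "(a t x + 2 * (a t x + b t x)) * (d t x)\<^sup>2 \<le> (3 * Ka + 2 * Kb) * (d t x)\<^sup>2"
        by (rule mult_right_mono) simp
      show "- 2 * d t x * U (d t) x * dI 1 (b t) x + (a t x + 2 * (a t x + b t x)) * (d t x)\<^sup>2
        \<le> (Kc + 3 * Ka + 2 * Kb) * (d t x)\<^sup>2 + Kc * (2 * pi * E t)"
        using 1 2 by (simp add: algebra_simps)
    qed (intro integrable_continuous_real continuous_intros
          cat[unfolded Ipi_def] cbt[unfolded Ipi_def] cdt[unfolded Ipi_def] cb1[unfolded Ipi_def] 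
          cU[unfolded Ipi_def])+
    also have "\<dots> = (Kc + 3 * Ka + 2 * Kb) * E t + Kc * (2 * pi * E t) * (2 * pi)"
      unfolding Ipi_def
      by (subst integral_add; (intro integrable_continuous_real continuous_intros cdt[unfolded Ipi_def])?)
        (simp add: E_def Ipi_def)
    finally show ?thesis by (simp add: algebra_simps power2_eq_square)
  qed
  have "E T \<le> 0"
  proof (rule gronwall_zero[OF T])
    show "(E has_real_derivative E' t) (at t within {0..T})" if "t \<in> {0..T}" for t
      using dE[of t] that by (auto intro: has_field_derivative_subset)
    have "E 0 = integral Ipi (\<lambda>x. 0)"
      unfolding E_def by (rule integral_cong) (use A B in \<open>simp add: d_def PJ_sol_def\<close>)
    then show "E 0 \<le> 0" by simp
  qed (rule dE_le)
  moreover have cdT: "continuous_on {-pi..pi} (\<lambda>x. (d T x)\<^sup>2)"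
    using continuous_on_slice[OF cd, of T] T by (auto intro!: continuous_intros simp: Ipi_def)
  ultimately have "E T = 0"
    using integral_nonneg[OF integrable_continuous_real[OF cdT]] unfolding E_def Ipi_def by simp
  then have "(d T x)\<^sup>2 = 0"
    using integral_eq_0_iff[OF cdT] x unfolding E_def Ipi_def by simp
  then show ?thesis by (simp add: d_def)
qed

section \<open>Scaling\<close>

lemma dI_scale:
  assumes "Ck_on k f" "j \<le> k" "x \<in> Ipi"
  shows "dI j (\<lambda>x. c * f x) x = c * dI j f x"
  using dI_lincomb[OF assms(1,1,2,3), of c 0] by simp

text \<open>All terms besides the time derivative are quadratic in the unknown. The normalization to
  \<open>\<mu> = 1\<close> replaces \<sigma> by \<open>\<sigma> / \<mu>\<close>, and undoing it
  turns \<open>exp (- t / 2)\<close> into \<open>exp (- \<mu> * t / 2)\<close>.\<close>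

lemma PJ_sol_scale:
  assumes sol: "PJ_sol f a" and mu: "\<mu> > 0"
  shows "PJ_sol (\<lambda>x. \<mu> * f x) (\<lambda>t x. \<mu> * a (\<mu> * t) x)"
proof -
  obtain adot where adot_c: "continuous_on ({0..} \<times> Ipi) (\<lambda>(t, x). adot t x)"
    and adot_d: "\<And>t x. t \<ge> 0 \<Longrightarrow> x \<in> Ipi \<Longrightarrow> ((\<lambda>s. a s x) has_real_derivative adot t x) (at t within {0..})"
    and adot_e: "\<And>t x. t \<ge> 0 \<Longrightarrow> x \<in> Ipi \<Longrightarrow> adot t x + integral {-pi..x} (a t) * dI 1 (a t) x - (a t x)\<^sup>2
                   + (1 / pi) * integral Ipi (\<lambda>y. (a t y)\<^sup>2) = 0"
    using sol unfolding PJ_sol_def by blast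
  have Ck: "Ck_on 3 (a t)" if "t \<ge> 0" for t
    using sol that unfolding PJ_sol_def by auto
  have mt: "\<mu> * t \<ge> 0" if "t \<ge> 0" for t using mu that by simp
  have cont: "continuous_on ({0..} \<times> Ipi) (\<lambda>(t, x). F (\<mu> * t) x)"
    if "continuous_on ({0..} \<times> Ipi) (\<lambda>(t, x). F t x)" for F :: "real \<Rightarrow> real \<Rightarrow> real"
  proof -
    have "continuous_on ({0..} \<times> Ipi) (\<lambda>z. case (\<mu> * fst z, snd z) of (t, x) \<Rightarrow> F t x)"
    proof (rule continuous_on_compose2[OF that])
      show "continuous_on ({0..} \<times> Ipi) (\<lambda>z. (\<mu> * fst z, snd z))"
        by (intro continuous_intros)
    qed (use mu in \<open>auto simp del: Ipi_simps\<close>)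
    then show ?thesis by (simp add: case_prod_unfold)
  qed
  have dI: "dI j (\<lambda>x. \<mu> * a (\<mu> * t) x) x = \<mu> * dI j (a (\<mu> * t)) x"
    if "j \<le> 3" "t \<ge> 0" "x \<in> Ipi" for j t x
    using dI_scale[OF Ck[OF mt[OF that(2)]] that(1,3)] .
  show ?thesis
    unfolding PJ_sol_def
  proof (intro conjI allI ballI impI)
    fix x assume "x \<in> Ipi"
    then show "\<mu> * a (\<mu> * 0) x = \<mu> * f x" using sol by (simp add: PJ_sol_def)
  next
    fix t :: real assume "t \<ge> 0"
    then show "Ck_on 3 (\<lambda>x. \<mu> * a (\<mu> * t) x)"
      using Ck_on_lincomb[OF Ck Ck, of "\<mu> * t" "\<mu> * t" \<mu> 0] mt[of t] by simp
  next
    fix j :: nat assume j: "j \<le> 3"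
    then have c: "continuous_on ({0..} \<times> Ipi) (\<lambda>(t, x). dI j (a t) x)"
      using sol by (simp add: PJ_sol_def)
    have "continuous_on ({0..} \<times> Ipi) (\<lambda>(t, x). \<mu> * dI j (a (\<mu> * t)) x)"
      using cont[OF c] unfolding case_prod_unfold by (intro continuous_intros)
    then show "continuous_on ({0..} \<times> Ipi) (\<lambda>(t, x). dI j (\<lambda>x. \<mu> * a (\<mu> * t) x) x)"
      by (rule continuous_on_eq) (use dI[OF j] in auto)
  next
    fix t :: real assume "t \<ge> 0"
    then show "integral Ipi (\<lambda>x. \<mu> * a (\<mu> * t) x) = 0"
      using sol mt[of t] by (simp add: PJ_sol_def)
  next
    show "\<exists>adot. continuous_on ({0..} \<times> Ipi) (\<lambda>(t, x). adot t x)
          \<and> (\<forall>t\<ge>0. \<forall>x\<in>Ipi.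
               ((\<lambda>s. \<mu> * a (\<mu> * s) x) has_real_derivative adot t x) (at t within {0..})
               \<and> adot t x + integral {-pi..x} (\<lambda>x. \<mu> * a (\<mu> * t) x) * dI 1 (\<lambda>x. \<mu> * a (\<mu> * t) x) x - (\<mu> * a (\<mu> * t) x)\<^sup>2
                   + (1 / pi) * integral Ipi (\<lambda>y. (\<mu> * a (\<mu> * t) y)\<^sup>2) = 0)"
    proof (intro exI[of _ "\<lambda>t x. \<mu>\<^sup>2 * adot (\<mu> * t) x"] conjI allI ballI impI)
      show "continuous_on ({0..} \<times> Ipi) (\<lambda>(t, x). \<mu>\<^sup>2 * adot (\<mu> * t) x)"
        using cont[OF adot_c] unfolding case_prod_unfold by (intro continuous_intros)
    next
      fix t x :: real assume tx: "t \<ge> 0" "x \<in> Ipi"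
      have "((\<lambda>s. a s x) has_real_derivative adot (\<mu> * t) x) (at (\<mu> * t) within (\<lambda>s. \<mu> * s) ` {0..})"
        using adot_d[OF mt tx(2), of t] tx mu by (auto intro: has_field_derivative_subset)
      then have "((\<lambda>s. a (\<mu> * s) x) has_real_derivative adot (\<mu> * t) x * \<mu>) (at t within {0..})"
        using DERIV_image_chain[of "\<lambda>s. a s x" _ "\<lambda>s. \<mu> * s" t "{0..}" \<mu>]
        by (auto simp: o_def intro!: derivative_eq_intros)
      then show "((\<lambda>s. \<mu> * a (\<mu> * s) x) has_real_derivative \<mu>\<^sup>2 * adot (\<mu> * t) x) (at t within {0..})"
        by (auto intro!: derivative_eq_intros simp: power2_eq_square)
      have "\<mu>\<^sup>2 * (adot (\<mu> * t) x + integral {-pi..x} (a (\<mu> * t)) * dI 1 (a (\<mu> * t)) x - (a (\<mu> * t) x)\<^sup>2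
                   + (1 / pi) * integral Ipi (\<lambda>y. (a (\<mu> * t) y)\<^sup>2)) = 0"
        using adot_e[OF mt[OF tx(1)] tx(2)] by simp
      then show "\<mu>\<^sup>2 * adot (\<mu> * t) x + integral {-pi..x} (\<lambda>x. \<mu> * a (\<mu> * t) x) * dI 1 (\<lambda>x. \<mu> * a (\<mu> * t) x) x - (\<mu> * a (\<mu> * t) x)\<^sup>2
                   + (1 / pi) * integral Ipi (\<lambda>y. (\<mu> * a (\<mu> * t) y)\<^sup>2) = 0"
        using dI[OF _ tx, of 1] by (simp add: power_mult_distrib algebra_simps power2_eq_square)
    qed
  qed
qed

section \<open>The explicit solution\<close>

lemma DERIV_within_chain:
  assumes "(F has_field_derivative D) (at (g x) within T)" "(g has_field_derivative E) (at x within S)" "g ` S \<subseteq> T"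
  shows "((\<lambda>x. F (g x)) has_field_derivative D * E) (at x within S)"
  using DERIV_image_chain[OF has_field_derivative_subset[OF assms(1,3)] assms(2)] by (simp add: o_def)

text \<open>Differentiates inverse functions: the mean value theorem supplies the factor
  \<open>q\<close> in front of the increment of \<open>Z\<close>, and only its limit matters.
  Derivatives within \<open>D\<close> include the one-sided ones at end points. It serves the
  inverse flow in space, the inverse flow in the parameter, and the inverse of physical
  time.\<close>

lemma has_real_derivative_implicit:
  fixes Z H :: "real \<Rightarrow> real"
  assumes H: "(H has_real_derivative H') (at u within D)"
    and eq: "\<And>v. v \<in> D \<Longrightarrow> q v * (Z v - Z u) = H v - H u"
    and q: "(q \<longlongrightarrow> j) (at u within D)" and j: "j \<noteq> 0"
  shows "(Z has_real_derivative H' / j) (at u within D)"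
proof -
  have "((\<lambda>v. (H v - H u) / (v - u) / q v) \<longlongrightarrow> H' / j) (at u within D)"
    using H q j unfolding has_field_derivative_iff by (intro tendsto_divide)
  moreover have "\<forall>\<^sub>F v in at u within D. (H v - H u) / (v - u) / q v = (Z v - Z u) / (v - u)"
  proof -
    have "\<forall>\<^sub>F v in at u within D. v \<in> D" by (simp add: eventually_at_filter)
    with tendsto_imp_eventually_ne[OF q j] show ?thesis
      by eventually_elim (simp add: eq[symmetric])
  qed
  ultimately show ?thesis
    unfolding has_field_derivative_iff by (rule Lim_transform_eventually)
qed

lemma tendsto_closer:
  fixes g \<xi> :: "'a \<Rightarrow> real"
  assumes g: "(g \<longlongrightarrow> l) F" and le: "\<forall>\<^sub>F v in F. \<bar>\<xi> v - l\<bar> \<le> \<bar>g v - l\<bar>"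
  shows "(\<xi> \<longlongrightarrow> l) F"
proof (rule LIM_zero_cancel, rule Lim_null_comparison)
  show "\<forall>\<^sub>F v in F. norm (\<xi> v - l) \<le> \<bar>g v - l\<bar>" using le by simp
  show "((\<lambda>v. \<bar>g v - l\<bar>) \<longlongrightarrow> 0) F" using g by (simp add: LIM_zero tendsto_rabs_zero)
qed

text \<open>The bound \<open>\<bar>z - y\<bar> \<le> \<bar>x - y\<bar>\<close> is the purpose of
  this version: intermediate points are chosen without any regularity, and through
  \<open>tendsto_closer\<close> they still converge to \<open>y\<close> as \<open>x\<close>
  does.\<close>

lemma DERIV_mvt:
  fixes F :: "real \<Rightarrow> real"
  assumes F: "\<And>x. x \<in> S \<Longrightarrow> (F has_real_derivative F' x) (at x within S)"
    and S: "convex S" "x \<in> S" "y \<in> S"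
  obtains z where "z \<in> S" "\<bar>z - y\<bar> \<le> \<bar>x - y\<bar>" "F x - F y = F' z * (x - y)"
proof -
  have *: "\<exists>z\<in>{a..b}. F b - F a = F' z * (b - a)" if "a \<in> S" "b \<in> S" "a \<le> b" for a b
  proof (rule mvt_very_simple[OF that(3)])
    fix z assume "a \<le> z" "z \<le> b"
    moreover have "{a..b} \<subseteq> S"
      using that closed_segment_subset[OF that(1,2) S(1)] by (simp add: closed_segment_eq_real_ivl)
    ultimately show "(F has_derivative (*) (F' z)) (at z within {a..b})"
      using F[of z] has_field_derivative_subset[of F "F' z" z S "{a..b}"] unfolding has_field_derivative_def
      by auto
  qed
  have sub: "{min x y..max x y} \<subseteq> S"
    using closed_segment_subset[OF S(2,3,1)] by (simp add: closed_segment_eq_real_ivl min_def max_def split: if_splits)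
  show thesis
  proof (cases "x \<le> y")
    case True
    then obtain z where "z \<in> {x..y}" "F y - F x = F' z * (y - x)" using * S by blast
    with True sub show thesis by (intro that[of z]) (auto simp: algebra_simps)
  next
    case False
    then obtain z where "z \<in> {y..x}" "F x - F y = F' z * (x - y)" using *[of y x] S by auto
    with False sub show thesis by (intro that[of z]) auto
  qed
qed

text \<open>The substitution \<open>h y\<close>, which maps [0, 1] onto the interval from
  \<open>-pi\<close> to \<open>y\<close>, moves the variable end point into the integrand;
  continuity of integrals over a fixed interval then applies.\<close>

lemma continuous_on_primitive:
  fixes F :: "'a::topological_space \<Rightarrow> real \<Rightarrow> real"
  assumes F: "continuous_on (T \<times> Ipi) (\<lambda>(t, x). F t x)"
  shows "continuous_on (T \<times> Ipi) (\<lambda>(t, y). integral {-pi..y} (F t))"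
proof -
  define h where "h = (\<lambda>y u. -pi + u * (y + pi :: real))"
  have h: "h y u \<in> Ipi" if "y \<in> Ipi" "u \<in> {0..1}" for y u
  proof -
    have "0 \<le> u * (y + pi)" "u * (y + pi) \<le> 1 * (y + pi)"
      using that by (simp, intro mult_right_mono) auto
    then show ?thesis using that by (auto simp: h_def)
  qed
  have eq: "integral {-pi..y} (F t) = integral (cbox 0 1) (\<lambda>u. F t (h y u) * (y + pi))"
    if "t \<in> T" "y \<in> Ipi" for t y
  proof -
    have c: "continuous_on {-pi..pi} (F t)"
      using continuous_on_slice[OF F that(1)] by (simp add: Ipi_def)
    have "((\<lambda>u. F t (h y u) * (y + pi)) has_integral
        integral {-pi..h y 1} (F t) - integral {-pi..h y 0} (F t)) {0..1}"
    proof (rule fundamental_theorem_of_calculus)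
      fix u :: real assume u: "u \<in> {0..1}"
      have "((\<lambda>u. integral {-pi..h y u} (F t)) has_real_derivative F t (h y u) * (y + pi)) (at u within {0..1})"
      proof (rule DERIV_within_chain[where T = "{-pi..pi}" and g = "h y" and F = "\<lambda>x. integral {-pi..x} (F t)"])
        show "((\<lambda>x. integral {-pi..x} (F t)) has_real_derivative F t (h y u)) (at (h y u) within {-pi..pi})"
          using h[OF that(2) u] by (intro integral_has_real_derivative[OF c]) simp
        show "h y ` {0..1} \<subseteq> {-pi..pi}"
          using h[OF that(2)] by (auto simp del: atLeastAtMost_iff simp: Ipi_def[symmetric])
      qed (auto simp: h_def intro!: derivative_eq_intros)
      then show "((\<lambda>u. integral {-pi..h y u} (F t)) has_vector_derivative F t (h y u) * (y + pi)) (at u within {0..1})"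
        by (simp add: has_real_derivative_iff_has_vector_derivative)
    qed simp
    from integral_unique[OF this] show ?thesis by (simp add: h_def)
  qed
  have "continuous_on ((T \<times> Ipi) \<times> cbox 0 1) (\<lambda>w. case (fst (fst w), h (snd (fst w)) (snd w)) of (t, x) \<Rightarrow> F t x)"
  proof (rule continuous_on_compose2[OF F])
    show "continuous_on ((T \<times> Ipi) \<times> cbox 0 1) (\<lambda>w. (fst (fst w), h (snd (fst w)) (snd w)))"
      unfolding h_def by (intro continuous_intros)
  qed (use h in \<open>auto simp del: Ipi_simps\<close>)
  then have "continuous_on ((T \<times> Ipi) \<times> cbox 0 1) (\<lambda>(z, u). F (fst z) (h (snd z) u) * (snd z + pi))"
    unfolding case_prod_unfold by (auto intro!: continuous_intros)
  from integral_continuous_on_param[OF this] show ?thesis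
    by (rule continuous_on_eq) (auto simp: eq)
qed

text \<open>The factor P(s) of the overview. It precedes the locale because the assumption
  \<open>mass_ge\<close> there speaks of it.\<close>

definition mass :: "(real \<Rightarrow> real) \<Rightarrow> real \<Rightarrow> real" where
  "mass f s = integral Ipi (\<lambda>x. 1 / (1 - s * f x)) / (2 * pi)"

text \<open>The last assumption makes physical time run through all of \<open>[0, \<infinity>)\<close> as \<open>s\<close> runs
  through \<open>[0, 1 / M)\<close>.\<close>

locale profile =
  fixes f f1 f2 f3 :: "real \<Rightarrow> real" and M \<kappa> :: real
  assumes f_deriv: "\<And>x. x \<in> Ipi \<Longrightarrow> (f has_real_derivative f1 x) (at x within Ipi)"
    and f1_deriv: "\<And>x. x \<in> Ipi \<Longrightarrow> (f1 has_real_derivative f2 x) (at x within Ipi)"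
    and f2_deriv: "\<And>x. x \<in> Ipi \<Longrightarrow> (f2 has_real_derivative f3 x) (at x within Ipi)"
    and f3_cont: "continuous_on Ipi f3"
    and M_pos: "M > 0" and f_le: "\<And>x. x \<in> Ipi \<Longrightarrow> f x \<le> M"
    and f_mean: "integral Ipi f = 0"
    and \<kappa>_pos: "\<kappa> > 0" and mass_ge: "\<And>s. s \<in> {0..<1/M} \<Longrightarrow> (mass f s)\<^sup>2 \<ge> \<kappa> / (1 - s * M)"
begin

section \<open>The flow as a function of the parameter\<close>

definition "S = {0..<1/M}"
abbreviation "P \<equiv> mass f"
definition "P1 s = integral Ipi (\<lambda>x. f x / (1 - s * f x)\<^sup>2) / (2 * pi)"
definition "P2 s = integral Ipi (\<lambda>x. 2 * (f x)\<^sup>2 / (1 - s * f x) ^ 3) / (2 * pi)"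
text \<open>\<open>X s\<close> is the Lagrangian flow, \<open>J\<close> its Jacobian; \<open>B\<close> and \<open>V\<close> are the unknown and the transport velocity
  along the flow with respect to the parameter \<open>s\<close> in place of time.\<close>

definition "J s x = 1 / (P s * (1 - s * f x))"
definition "B s x = f x / (1 - s * f x) - P1 s / P s"
definition "X s x = -pi + integral {-pi..x} (J s)"
definition "V s x = integral {-pi..x} (\<lambda>x. J s x * B s x)"

lemma f_cont: "continuous_on Ipi f" and f1_cont: "continuous_on Ipi f1" and f2_cont: "continuous_on Ipi f2"
  using f_deriv f1_deriv f2_deriv DERIV_continuous continuous_on_eq_continuous_within by blast+

lemma convex_S: "convex S" and zero_in_S: "0 \<in> S"
  using M_pos by (simp_all add: S_def convex_real_interval)

lemma S_margin: "s \<in> S \<Longrightarrow> 0 < 1 - s * M \<and> 1 - s * M \<le> 1"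
  using M_pos by (auto simp: S_def field_simps)

lemma G_ge: "s \<in> S \<Longrightarrow> x \<in> Ipi \<Longrightarrow> 1 - s * f x \<ge> 1 - s * M"
  using f_le[of x] by (auto simp: S_def intro: mult_left_mono)

lemma G_pos: "s \<in> S \<Longrightarrow> x \<in> Ipi \<Longrightarrow> 1 - s * f x > 0"
  using G_ge S_margin by fastforce

lemma cont_snd:
  assumes "continuous_on Ipi h"
  shows "continuous_on (S \<times> Ipi) (\<lambda>z. h (snd z))"
  by (rule continuous_on_compose2[OF assms]) (auto intro!: continuous_intros)

lemma cont_fst:
  assumes "continuous_on S h"
  shows "continuous_on (S \<times> Ipi) (\<lambda>z. h (fst z))"
  by (rule continuous_on_compose2[OF assms]) (auto intro!: continuous_intros)

lemmas cont_f_snd = cont_snd[OF f_cont] cont_snd[OF f1_cont] cont_snd[OF f2_cont] cont_snd[OF f3_cont]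

lemma G_nonzero: "z \<in> S \<times> Ipi \<Longrightarrow> 1 - fst z * f (snd z) \<noteq> 0"
  using G_pos[of "fst z" "snd z"] by (auto simp del: Ipi_simps)

lemma P_deriv: "s \<in> S \<Longrightarrow> (P has_real_derivative P1 s) (at s within S)"
  unfolding mass_def[abs_def] P1_def Ipi_def cbox_interval[symmetric]
proof (intro DERIV_cdivide leibniz_rule_field_derivative)
  fix u t assume u: "u \<in> S" "t \<in> cbox (-pi) pi"
  then show "((\<lambda>s. 1 / (1 - s * f t)) has_real_derivative f t / (1 - u * f t)\<^sup>2) (at u within S)"
    using G_pos[of u t] by (auto intro!: derivative_eq_intros simp: power2_eq_square)
next
  fix u assume "u \<in> S"
  then show "(\<lambda>x. 1 / (1 - u * f x)) integrable_on cbox (-pi) pi"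
    using G_pos[of u] f_cont unfolding cbox_interval Ipi_def
    by (intro integrable_continuous_real continuous_intros) force+
next
  show "continuous_on (S \<times> cbox (-pi) pi) (\<lambda>(s, x). f x / (1 - s * f x)\<^sup>2)"
    unfolding cbox_interval Ipi_def[symmetric] case_prod_unfold
    by (intro continuous_intros cont_f_snd) (use G_nonzero in auto)
qed (use convex_S in auto)

lemma P1_deriv: "s \<in> S \<Longrightarrow> (P1 has_real_derivative P2 s) (at s within S)"
  unfolding P1_def[abs_def] P2_def Ipi_def cbox_interval[symmetric]
proof (intro DERIV_cdivide leibniz_rule_field_derivative)
  fix u t assume u: "u \<in> S" "t \<in> cbox (-pi) pi"
  then have "1 - u * f t \<noteq> 0" using G_pos[of u t] by auto
  then show "((\<lambda>s. f t / (1 - s * f t)\<^sup>2) has_real_derivative 2 * (f t)\<^sup>2 / (1 - u * f t) ^ 3) (at u within S)"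
    by (auto intro!: derivative_eq_intros simp: power2_eq_square power3_eq_cube divide_simps)
next
  fix u assume "u \<in> S"
  then show "(\<lambda>x. f x / (1 - u * f x)\<^sup>2) integrable_on cbox (-pi) pi"
    using G_pos[of u] f_cont unfolding cbox_interval Ipi_def
    by (intro integrable_continuous_real continuous_intros) force+
next
  show "continuous_on (S \<times> cbox (-pi) pi) (\<lambda>(s, x). 2 * (f x)\<^sup>2 / (1 - s * f x) ^ 3)"
    unfolding cbox_interval Ipi_def[symmetric] case_prod_unfold
    by (intro continuous_intros cont_f_snd) (use G_nonzero in auto)
qed (use convex_S in auto)

lemma P_cont: "continuous_on S P" and P1_cont: "continuous_on S P1"
  using P_deriv P1_deriv DERIV_continuous continuous_on_eq_continuous_within by blast+

lemma P2_cont: "continuous_on S P2"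
proof -
  have "continuous_on S (\<lambda>s. integral (cbox (-pi) pi) (\<lambda>x. 2 * (f x)\<^sup>2 / (1 - s * f x) ^ 3))"
    unfolding cbox_interval Ipi_def[symmetric] 
    by (rule integral_continuous_on_param[of S "-pi" pi, unfolded cbox_interval Ipi_def[symmetric]])
      (unfold case_prod_unfold, intro continuous_intros cont_f_snd, use G_nonzero in auto)
  then show ?thesis
    unfolding P2_def[abs_def] Ipi_def by (auto intro!: continuous_intros)
qed

lemma P_sq_ge: "s \<in> S \<Longrightarrow> (P s)\<^sup>2 \<ge> \<kappa>"
proof -
  assume s: "s \<in> S"
  have "\<kappa> \<le> \<kappa> / (1 - s * M)"
    using S_margin[OF s] \<kappa>_pos by (simp add: le_divide_eq mult_left_le)
  then show ?thesis using mass_ge[of s] s by (simp add: S_def)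
qed

lemma P_pos: "s \<in> S \<Longrightarrow> P s > 0"
proof -
  assume s: "s \<in> S"
  have "P s \<ge> 0"
    unfolding mass_def using G_pos[OF s] f_cont unfolding Ipi_def
    by (intro divide_nonneg_pos integral_nonneg integrable_continuous_real continuous_intros) force+
  moreover have "P s \<noteq> 0" using P_sq_ge[OF s] \<kappa>_pos by auto
  ultimately show ?thesis by simp
qed

lemmas cont_P_fst = cont_fst[OF P_cont] cont_fst[OF P1_cont] cont_fst[OF P2_cont]

lemma P_nonzero: "z \<in> S \<times> Ipi \<Longrightarrow> P (fst z) \<noteq> 0"
  using P_pos[of "fst z"] by auto

lemma J_cont: "continuous_on (S \<times> Ipi) (\<lambda>(s, x). J s x)"
  unfolding J_def case_prod_unfold
  by (intro continuous_intros cont_f_snd cont_P_fst) (use G_nonzero P_nonzero in auto)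

lemma B_cont: "continuous_on (S \<times> Ipi) (\<lambda>(s, x). B s x)"
  unfolding B_def case_prod_unfold
  by (intro continuous_intros cont_f_snd cont_P_fst) (use G_nonzero P_nonzero in auto)

lemma JB_cont: "continuous_on (S \<times> Ipi) (\<lambda>(s, x). J s x * B s x)"
  using continuous_on_mult[OF J_cont B_cont] by (simp add: case_prod_unfold)

lemma J_pos: "s \<in> S \<Longrightarrow> x \<in> Ipi \<Longrightarrow> J s x > 0"
  unfolding J_def using P_pos G_pos by simp

lemma X_deriv: "s \<in> S \<Longrightarrow> x \<in> Ipi \<Longrightarrow> (X s has_real_derivative J s x) (at x within Ipi)"
  using integral_has_real_derivative[of "-pi" pi "J s" x] continuous_on_slice[OF J_cont, of s]
  unfolding X_def[abs_def] Ipi_def by (auto intro!: derivative_eq_intros)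

lemma J_deriv:
  assumes "s \<in> S" "x \<in> Ipi"
  shows "((\<lambda>s. J s x) has_real_derivative J s x * B s x) (at s within S)"
proof -
  have nz: "P s \<noteq> 0" "1 - s * f x \<noteq> 0" using P_pos[OF assms(1)] G_pos[OF assms] by auto
  have "((\<lambda>s. J s x) has_real_derivative
      - (P1 s * (1 - s * f x) + P s * (- f x)) / (P s * (1 - s * f x))\<^sup>2) (at s within S)"
    unfolding J_def using nz
    by (auto intro!: derivative_eq_intros P_deriv[OF assms(1)] simp: power2_eq_square)
  moreover have "- (P1 s * (1 - s * f x) + P s * (- f x)) / (P s * (1 - s * f x))\<^sup>2 = J s x * B s x"
    unfolding J_def B_def using nz by (simp add: divide_simps power2_eq_square; simp add: algebra_simps)
  ultimately show ?thesis by simp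
qed

lemma X_deriv_s:
  assumes "s \<in> S" "x \<in> Ipi"
  shows "((\<lambda>s. X s x) has_real_derivative V s x) (at s within S)"
proof -
  have sub: "{-pi..x} \<subseteq> Ipi" using assms by (auto simp: Ipi_def)
  have "((\<lambda>s. integral (cbox (-pi) x) (J s)) has_real_derivative
      integral (cbox (-pi) x) (\<lambda>x. J s x * B s x)) (at s within S)"
  proof (rule leibniz_rule_field_derivative)
    fix u t assume "u \<in> S" "t \<in> cbox (-pi) x"
    with sub show "((\<lambda>s. J s t) has_real_derivative J u t * B u t) (at u within S)"
      by (intro J_deriv) auto
  next
    fix u assume "u \<in> S"
    with sub show "J u integrable_on cbox (-pi) x"
      using continuous_on_slice[OF J_cont, of u] continuous_on_subset by (auto intro!: integrable_continuous_real)
  next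
    show "continuous_on (S \<times> cbox (-pi) x) (\<lambda>(s, x). J s x * B s x)"
      using sub by (intro continuous_on_subset[OF JB_cont]) auto
  qed (use assms convex_S in auto)
  then show ?thesis
    unfolding X_def V_def by (auto intro!: derivative_eq_intros)
qed

lemma X_left: "X s (-pi) = -pi"
  by (simp add: X_def)

text \<open>\<open>P\<close> is normalized so that \<open>J s\<close> has integral
  \<open>2 * pi\<close>; the flow therefore fixes both ends of the interval.\<close>

lemma X_right: "s \<in> S \<Longrightarrow> X s pi = pi"
proof -
  assume s: "s \<in> S"
  have "integral Ipi (J s) = integral Ipi (\<lambda>x. (1 / P s) * (1 / (1 - s * f x)))"
    by (simp add: J_def[abs_def])
  also have "\<dots> = (1 / P s) * integral Ipi (\<lambda>x. 1 / (1 - s * f x))"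
    by (rule integral_mult_right)
  also have "\<dots> = 2 * pi" using P_pos[OF s] unfolding mass_def by (auto simp: field_simps)
  finally show ?thesis by (simp add: X_def Ipi_def)
qed

lemma X_mvt:
  assumes "s \<in> S" "x \<in> Ipi" "y \<in> Ipi"
  obtains z where "z \<in> Ipi" "\<bar>z - y\<bar> \<le> \<bar>x - y\<bar>" "X s x - X s y = J s z * (x - y)"
  using DERIV_mvt[OF X_deriv[OF assms(1)] convex_Ipi assms(2,3)] by blast

lemma X_less: 
  assumes "s \<in> S" "x \<in> Ipi" "y \<in> Ipi" "x < y"
  shows "X s x < X s y"
proof -
  obtain z where "z \<in> Ipi" "X s y - X s x = J s z * (y - x)" using X_mvt[OF assms(1,3,2)] by blast
  then show ?thesis using mult_pos_pos[OF J_pos[OF assms(1), of z], of "y - x"] assms(4) by simp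
qed

lemma X_cont: "s \<in> S \<Longrightarrow> continuous_on Ipi (X s)"
  using X_deriv DERIV_continuous continuous_on_eq_continuous_within by blast

lemma X_inj: "s \<in> S \<Longrightarrow> inj_on (X s) Ipi"
  using X_less[of s] by (metis inj_onI linorder_neqE_linordered_idom less_irrefl)

lemma X_image: "s \<in> S \<Longrightarrow> X s ` Ipi = Ipi"
proof
  assume s: "s \<in> S"
  have end': "-pi \<in> Ipi" "pi \<in> Ipi" by auto
  show "X s ` Ipi \<subseteq> Ipi"
  proof (rule image_subsetI)
    fix x assume x: "x \<in> Ipi"
    have "X s (-pi) \<le> X s x" "X s x \<le> X s pi"
      using X_less[OF s end'(1) x] X_less[OF s x end'(2)] x by force+
    then show "X s x \<in> Ipi" using X_left X_right[OF s] by simp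
  qed
  show "Ipi \<subseteq> X s ` Ipi"
  proof
    fix y assume "y \<in> Ipi"
    then have "\<exists>x. -pi \<le> x \<and> x \<le> pi \<and> X s x = y"
      using X_cont[OF s] X_left[of s] X_right[OF s] by (intro IVT') (auto simp: Ipi_def)
    then show "y \<in> X s ` Ipi" by auto
  qed
qed

section \<open>The inverse flow, from positions back to labels\<close>

definition "Y s = inv_into Ipi (X s)"

lemma Y_mem: "s \<in> S \<Longrightarrow> y \<in> Ipi \<Longrightarrow> Y s y \<in> Ipi"
  unfolding Y_def using X_image inv_into_into by metis

lemma X_Y: "s \<in> S \<Longrightarrow> y \<in> Ipi \<Longrightarrow> X s (Y s y) = y"
  unfolding Y_def using X_image f_inv_into_f by metis

lemma Y_X: "s \<in> S \<Longrightarrow> x \<in> Ipi \<Longrightarrow> Y s (X s x) = x"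
  unfolding Y_def using X_inj inv_into_f_f by metis

lemma Y_left: "s \<in> S \<Longrightarrow> Y s (-pi) = -pi" and Y_right: "s \<in> S \<Longrightarrow> Y s pi = pi"
  using Y_X[of s "-pi"] X_left[of s] Y_X[of s pi] X_right[of s] by simp_all

text \<open>The label \<open>x0\<close> of the base point is frozen. The mean value theorem bounds
  the distance from \<open>Y s y\<close> to \<open>x0\<close> by a bound for \<open>1 / J\<close>
  times the distance from \<open>y\<close> to \<open>X s x0\<close>. This product \<open>Q\<close>
  is jointly continuous and vanishes at the base point, so the motion of a single label is all that
  enters.\<close>

lemma Y_cont: "continuous_on (S \<times> Ipi) (\<lambda>(s, y). Y s y)"
  unfolding continuous_on_def
proof (rule ballI)
  fix z0 assume z0: "z0 \<in> S \<times> Ipi"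
  define s0 y0 where "s0 = fst z0" and "y0 = snd z0"
  have s0: "s0 \<in> S" and y0: "y0 \<in> Ipi" using z0 by (auto simp: s0_def y0_def)
  obtain K where K: "\<And>x. x \<in> Ipi \<Longrightarrow> \<bar>f x\<bar> \<le> K"
    using compact_imp_bounded[OF compact_continuous_image[OF f_cont compact_Ipi]]
    unfolding bounded_iff by (auto simp del: Ipi_simps)
  define x0 where "x0 = Y s0 y0"
  have x0: "x0 \<in> Ipi" unfolding x0_def by (rule Y_mem[OF s0 y0])
  define Q where "Q = (\<lambda>z. P (fst z) * (1 + fst z * K) * \<bar>snd z - X (fst z) x0\<bar>)"
  have le: "\<bar>Y s y - x0\<bar> \<le> Q (s, y)" if s: "s \<in> S" and y: "y \<in> Ipi" for s y
  proof -
    obtain z where z: "z \<in> Ipi" "X s (Y s y) - X s x0 = J s z * (Y s y - x0)"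
      using X_mvt[OF s Y_mem[OF s y] x0] by blast
    have "Y s y - x0 = P s * (1 - s * f z) * (y - X s x0)"
      using z(2) P_pos[OF s] G_pos[OF s z(1)] by (simp add: X_Y[OF s y] J_def)
    then have "\<bar>Y s y - x0\<bar> = P s * (1 - s * f z) * \<bar>y - X s x0\<bar>"
      using P_pos[OF s] G_pos[OF s z(1)] by (simp add: abs_mult)
    also have "\<dots> \<le> P s * (1 + s * K) * \<bar>y - X s x0\<bar>"
    proof -
      have "- (s * f z) \<le> s * K"
        using K[OF z(1)] s mult_left_mono[of "- f z" K s] by (auto simp: S_def)
      then show ?thesis using P_pos[OF s] by (intro mult_right_mono mult_left_mono) auto
    qed
    finally show ?thesis by (simp add: Q_def)
  qed
  have "continuous_on S (\<lambda>s. X s x0)"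
    using X_deriv_s[OF _ x0] DERIV_continuous continuous_on_eq_continuous_within by blast
  from cont_fst[OF this] have "continuous_on (S \<times> Ipi) Q"
    unfolding Q_def by (intro continuous_intros cont_P_fst)
  then have "(Q \<longlongrightarrow> Q z0) (at z0 within S \<times> Ipi)"
    using z0 unfolding continuous_on_def by blast
  moreover have "Q z0 = 0"
    using X_Y[OF s0 y0] by (simp add: Q_def x0_def s0_def y0_def)
  ultimately have Q0: "(Q \<longlongrightarrow> 0) (at z0 within S \<times> Ipi)" by simp
  have "\<forall>\<^sub>F z in at z0 within S \<times> Ipi. z \<in> S \<times> Ipi" by (simp add: eventually_at_filter)
  then have "\<forall>\<^sub>F z in at z0 within S \<times> Ipi. norm ((case z of (s, y) \<Rightarrow> Y s y) - x0) \<le> Q z"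
    by eventually_elim (use le in auto)
  from LIM_zero_cancel[OF Lim_null_comparison[OF this Q0]]
  have "((\<lambda>z. case z of (s, y) \<Rightarrow> Y s y) \<longlongrightarrow> x0) (at z0 within S \<times> Ipi)" .
  then show "((\<lambda>(s, y). Y s y) \<longlongrightarrow> (case z0 of (s, y) \<Rightarrow> Y s y)) (at z0 within S \<times> Ipi)"
    by (simp add: x0_def s0_def y0_def case_prod_unfold)
qed

definition "w s x = P s * (1 - s * f x)"

lemma w_pos: "s \<in> S \<Longrightarrow> x \<in> Ipi \<Longrightarrow> w s x > 0"
  unfolding w_def using P_pos G_pos by simp

lemma J_eq: "J s x = 1 / w s x"
  by (simp add: J_def w_def)

lemma Y_deriv:
  assumes s: "s \<in> S" and y: "y \<in> Ipi"
  shows "(Y s has_real_derivative w s (Y s y)) (at y within Ipi)"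
proof -
  have "\<exists>z. z \<in> Ipi \<and> \<bar>z - Y s y\<bar> \<le> \<bar>Y s v - Y s y\<bar> \<and> X s (Y s v) - X s (Y s y) = J s z * (Y s v - Y s y)"
    if "v \<in> Ipi" for v
    using X_mvt[OF s Y_mem[OF s that] Y_mem[OF s y]] by metis
  then obtain \<xi> where \<xi>: "\<And>v. v \<in> Ipi \<Longrightarrow> \<xi> v \<in> Ipi" "\<And>v. v \<in> Ipi \<Longrightarrow> \<bar>\<xi> v - Y s y\<bar> \<le> \<bar>Y s v - Y s y\<bar>"
    "\<And>v. v \<in> Ipi \<Longrightarrow> X s (Y s v) - X s (Y s y) = J s (\<xi> v) * (Y s v - Y s y)"
    by metis
  have ev: "\<forall>\<^sub>F v in at y within Ipi. v \<in> Ipi" by (simp add: eventually_at_filter)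
  have "(Y s \<longlongrightarrow> Y s y) (at y within Ipi)"
    using continuous_on_slice[OF Y_cont s] y by (simp add: continuous_on_def)
  moreover have "\<forall>\<^sub>F v in at y within Ipi. \<bar>\<xi> v - Y s y\<bar> \<le> \<bar>Y s v - Y s y\<bar>"
    using ev by eventually_elim (simp add: \<xi>(2))
  ultimately have "(\<xi> \<longlongrightarrow> Y s y) (at y within Ipi)"
    by (rule tendsto_closer)
  then have q: "((\<lambda>v. J s (\<xi> v)) \<longlongrightarrow> J s (Y s y)) (at y within Ipi)"
    by (rule continuous_on_tendsto_compose[OF continuous_on_slice[OF J_cont s]])
      (use Y_mem[OF s y] in blast, use ev in eventually_elim, erule \<xi>(1))
  have "(Y s has_real_derivative 1 / J s (Y s y)) (at y within Ipi)"
  proof (rule has_real_derivative_implicit[where q = "\<lambda>v. J s (\<xi> v)" and H = "\<lambda>v. v"])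
    show "J s (\<xi> v) * (Y s v - Y s y) = v - y" if "v \<in> Ipi" for v
      using \<xi>(3)[OF that] X_Y[OF s that] X_Y[OF s y] by simp
  qed (use q J_pos[OF s Y_mem[OF s y]] in auto)
  then show ?thesis by (simp add: J_eq)
qed

text \<open>\<open>X v (Y v y) = y\<close> does not depend on \<open>v\<close>. With the label
  \<open>x0 = Y s y\<close> frozen, \<open>J v (\<xi> v) * (Y v y - x0) = y - X v x0\<close>, and
  only \<open>X v x0\<close> has to be differentiated. Since \<open>J\<close> moves with
  \<open>v\<close> as well, its joint continuity is needed for the limit of the factor.\<close>

lemma Y_deriv_s:
  assumes s: "s \<in> S" and y: "y \<in> Ipi"
  shows "((\<lambda>s. Y s y) has_real_derivative - V s (Y s y) * w s (Y s y)) (at s within S)"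
proof -
  define x0 where "x0 = Y s y"
  have x0: "x0 \<in> Ipi" unfolding x0_def by (rule Y_mem[OF s y])
  have "\<exists>z. z \<in> Ipi \<and> \<bar>z - x0\<bar> \<le> \<bar>Y v y - x0\<bar> \<and> X v (Y v y) - X v x0 = J v z * (Y v y - x0)"
    if "v \<in> S" for v
    using X_mvt[OF that Y_mem[OF that y] x0] by metis
  then obtain \<xi> where \<xi>: "\<And>v. v \<in> S \<Longrightarrow> \<xi> v \<in> Ipi" "\<And>v. v \<in> S \<Longrightarrow> \<bar>\<xi> v - x0\<bar> \<le> \<bar>Y v y - x0\<bar>"
    "\<And>v. v \<in> S \<Longrightarrow> X v (Y v y) - X v x0 = J v (\<xi> v) * (Y v y - x0)"
    by metis
  have ev: "\<forall>\<^sub>F v in at s within S. v \<in> S" by (simp add: eventually_at_filter)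
  have "continuous_on S (\<lambda>s. case (s, y) of (s, y) \<Rightarrow> Y s y)"
    by (rule continuous_on_compose2[OF Y_cont]) (use y in \<open>auto intro!: continuous_on_Pair\<close>)
  then have "((\<lambda>v. Y v y) \<longlongrightarrow> x0) (at s within S)"
    using s by (simp add: continuous_on_def x0_def)
  moreover have "\<forall>\<^sub>F v in at s within S. \<bar>\<xi> v - x0\<bar> \<le> \<bar>Y v y - x0\<bar>"
    using ev by eventually_elim (simp add: \<xi>(2))
  ultimately have "(\<xi> \<longlongrightarrow> x0) (at s within S)"
    by (rule tendsto_closer)
  then have "((\<lambda>v. (v, \<xi> v)) \<longlongrightarrow> (s, x0)) (at s within S)"
    by (intro tendsto_Pair tendsto_ident_at)
  moreover have "\<forall>\<^sub>F v in at s within S. (v, \<xi> v) \<in> S \<times> Ipi"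
    using ev by eventually_elim (use \<xi>(1) in auto)
  ultimately have "((\<lambda>v. case (v, \<xi> v) of (s, x) \<Rightarrow> J s x) \<longlongrightarrow> (case (s, x0) of (s, x) \<Rightarrow> J s x)) (at s within S)"
    using s x0 by (intro continuous_on_tendsto_compose[OF J_cont]) blast+
  then have q: "((\<lambda>v. J v (\<xi> v)) \<longlongrightarrow> J s x0) (at s within S)"
    by simp
  have "((\<lambda>v. Y v y) has_real_derivative (- V s x0) / J s x0) (at s within S)"
  proof (rule has_real_derivative_implicit[where q = "\<lambda>v. J v (\<xi> v)" and H = "\<lambda>v. - X v x0"])
    show "J v (\<xi> v) * (Y v y - Y s y) = - X v x0 - - X s x0" if "v \<in> S" for v
      using \<xi>(3)[OF that] X_Y[OF that y] X_Y[OF s y] by (simp add: x0_def)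
    show "((\<lambda>v. - X v x0) has_real_derivative - V s x0) (at s within S)"
      by (intro DERIV_minus X_deriv_s s x0)
  qed (use q J_pos[OF s x0] in auto)
  then show ?thesis by (simp add: J_eq x0_def)
qed

lemma integral_Y:
  assumes s: "s \<in> S" and y: "y \<in> Ipi" and h: "continuous_on Ipi h"
  shows "integral {-pi..y} (\<lambda>y. h (Y s y)) = integral {-pi..Y s y} (\<lambda>x. J s x * h x)"
proof -
  define H where "H = (\<lambda>x. integral {-pi..x} (\<lambda>x. J s x * h x))"
  have H: "(H has_real_derivative J s x * h x) (at x within Ipi)" if "x \<in> Ipi" for x
    using integral_has_real_derivative[of "-pi" pi "\<lambda>x. J s x * h x" x] that
      continuous_on_mult[OF continuous_on_slice[OF J_cont s] h] unfolding H_def Ipi_def by auto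
  have "((\<lambda>y. h (Y s y)) has_integral H (Y s y) - H (Y s (-pi))) {-pi..y}"
  proof (rule fundamental_theorem_of_calculus)
    fix v :: real assume v: "v \<in> {-pi..y}"
    then have v': "v \<in> Ipi" using y by auto
    have "((\<lambda>v. H (Y s v)) has_real_derivative J s (Y s v) * h (Y s v) * w s (Y s v)) (at v within Ipi)"
      by (rule DERIV_within_chain[where g = "Y s", OF H[OF Y_mem[OF s v']] Y_deriv[OF s v']])
        (use Y_mem[OF s] in blast)
    moreover have "J s (Y s v) * h (Y s v) * w s (Y s v) = h (Y s v)"
      using w_pos[OF s Y_mem[OF s v']] by (simp add: J_eq)
    ultimately have "((\<lambda>v. H (Y s v)) has_real_derivative h (Y s v)) (at v within {-pi..y})"
      using y by (auto intro: has_field_derivative_subset simp: Ipi_def)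
    then show "((\<lambda>v. H (Y s v)) has_vector_derivative h (Y s v)) (at v within {-pi..y})"
      by (simp add: has_real_derivative_iff_has_vector_derivative)
  qed (use y in simp)
  then show ?thesis
    using Y_left[OF s] by (simp add: H_def integral_unique)
qed

section \<open>Conservation of length and the nonlocal term\<close>

lemma f_integrals:
  assumes s: "s \<in> S"
  shows "integral Ipi (\<lambda>x. 1 / (1 - s * f x)) = 2 * pi * P s"
    and "integral Ipi (\<lambda>x. f x / (1 - s * f x)\<^sup>2) = 2 * pi * P1 s"
    and "integral Ipi (\<lambda>x. 2 * (f x)\<^sup>2 / (1 - s * f x) ^ 3) = 2 * pi * P2 s"
  by (simp_all add: mass_def P1_def P2_def)

lemma f_integrable:
  assumes s: "s \<in> S"
  shows "(\<lambda>x. 1 / (1 - s * f x)) integrable_on Ipi"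
    and "(\<lambda>x. f x / (1 - s * f x)\<^sup>2) integrable_on Ipi"
    and "(\<lambda>x. 2 * (f x)\<^sup>2 / (1 - s * f x) ^ 3) integrable_on Ipi"
  using G_pos[OF s] f_cont unfolding Ipi_def
  by (intro integrable_continuous_real continuous_intros; force)+

text \<open>\<open>J s x * B s x\<close> is the derivative of \<open>J s x\<close> in
  \<open>s\<close>, and the integral of \<open>J s\<close> is constantly \<open>2 * pi\<close>. The
  identity is verified by expansion into the integrals behind \<open>P\<close> and
  \<open>P1\<close>; it yields the zero mean of the solution.\<close>

lemma V_right: 
  assumes s: "s \<in> S"
  shows "V s pi = 0"
proof -
  have "integral Ipi (\<lambda>x. J s x * B s x)
      = integral Ipi (\<lambda>x. (1 / P s) * (f x / (1 - s * f x)\<^sup>2) - (P1 s / (P s)\<^sup>2) * (1 / (1 - s * f x)))"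
  proof (rule integral_cong)
    fix x assume "x \<in> Ipi"
    from G_pos[OF s this] P_pos[OF s]
    show "J s x * B s x = (1 / P s) * (f x / (1 - s * f x)\<^sup>2) - (P1 s / (P s)\<^sup>2) * (1 / (1 - s * f x))"
      by (simp add: J_def B_def divide_simps power2_eq_square; simp add: algebra_simps)
  qed
  also have "\<dots> = (1 / P s) * (2 * pi * P1 s) - (P1 s / (P s)\<^sup>2) * (2 * pi * P s)"
    unfolding f_integrals[OF s, symmetric]
    by (subst integral_diff; (intro integrable_on_mult_right f_integrable s)?)
      (simp only: integral_mult_right)
  also have "\<dots> = 0" using P_pos[OF s] by (simp add: power2_eq_square)
  finally show ?thesis by (simp add: V_def Ipi_def)
qed

text \<open>Up to the factor \<open>(P s)^4\<close>, this is the integral of the squared solution in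
  label coordinates. The right-hand side equals \<open>- pi * P\<close> times the second derivative
  of \<open>1 / P\<close>, an expression in \<open>s\<close> alone that recurs in
  \<open>sol_deriv_t\<close>; their agreement is what closes the equation.\<close>

lemma integral_B_sq:
  assumes s: "s \<in> S"
  shows "integral Ipi (\<lambda>x. J s x * (B s x)\<^sup>2) = pi * (P2 s / P s - 2 * (P1 s)\<^sup>2 / (P s)\<^sup>2)"
proof -
  have "integral Ipi (\<lambda>x. J s x * (B s x)\<^sup>2)
      = integral Ipi (\<lambda>x. (1 / (2 * P s)) * (2 * (f x)\<^sup>2 / (1 - s * f x) ^ 3)
          - (2 * P1 s / (P s)\<^sup>2) * (f x / (1 - s * f x)\<^sup>2) + ((P1 s)\<^sup>2 / (P s) ^ 3) * (1 / (1 - s * f x)))"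
  proof (rule integral_cong)
    fix x assume x: "x \<in> Ipi"
    have alg: "1 / (p * g) * (u / g - q / p)\<^sup>2 = (1 / (2 * p)) * (2 * u\<^sup>2 / g ^ 3) - (2 * q / p\<^sup>2) * (u / g\<^sup>2) + (q\<^sup>2 / p ^ 3) * (1 / g)"
      if "p > 0" "g > 0" for p g u q :: real
      using that by (simp add: divide_simps power2_eq_square power3_eq_cube) (simp add: algebra_simps)
    show "J s x * (B s x)\<^sup>2 = (1 / (2 * P s)) * (2 * (f x)\<^sup>2 / (1 - s * f x) ^ 3)
          - (2 * P1 s / (P s)\<^sup>2) * (f x / (1 - s * f x)\<^sup>2) + ((P1 s)\<^sup>2 / (P s) ^ 3) * (1 / (1 - s * f x))"
      unfolding J_def B_def by (rule alg[OF P_pos[OF s] G_pos[OF s x]])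
  qed
  also have "\<dots> = (1 / (2 * P s)) * (2 * pi * P2 s) - (2 * P1 s / (P s)\<^sup>2) * (2 * pi * P1 s) + ((P1 s)\<^sup>2 / (P s) ^ 3) * (2 * pi * P s)"
    unfolding f_integrals[OF s, symmetric]
    by (subst integral_add integral_diff; (intro integrable_diff integrable_on_mult_right f_integrable s)?)+
      (simp only: integral_mult_right)
  also have "\<dots> = pi * (P2 s / P s - 2 * (P1 s)\<^sup>2 / (P s)\<^sup>2)"
    using P_pos[OF s] by (simp add: divide_simps power2_eq_square power3_eq_cube; simp add: algebra_simps)
  finally show ?thesis .
qed

text \<open>Physical time as a function of the parameter \<open>s\<close>; its inverse is \<open>R\<close>.\<close>

definition "T s = integral {0..s} (\<lambda>s. (P s)\<^sup>2)"

lemma T_deriv: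
  assumes s: "s \<in> S"
  shows "(T has_real_derivative (P s)\<^sup>2) (at s within S)"
proof -
  \<comment> \<open>\<open>S\<close> is open at \<open>1/M\<close>, so the fundamental theorem is
    applied on a compact interval that reaches beyond \<open>s\<close>; near \<open>s\<close> both
    domains coincide.\<close>
  define b where "b = (s + 1/M) / 2"
  have b: "s < b" "b < 1/M" "{0..b} \<subseteq> S" using s by (auto simp: b_def S_def)
  have "(T has_real_derivative (P s)\<^sup>2) (at s within {0..b})"
    unfolding T_def[abs_def] using b s
    by (intro integral_has_real_derivative continuous_intros continuous_on_subset[OF P_cont]) (auto simp: S_def)
  moreover have "at s within {0..b} = at s within S"
    by (rule at_within_nhd[of _ "{..<b}"]) (use b s in \<open>auto simp: S_def\<close>)
  ultimately show ?thesis by simp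
qed

lemma T_zero: "T 0 = 0"
  by (simp add: T_def)

lemma T_mvt:
  assumes "r \<in> S" "s \<in> S"
  obtains z where "z \<in> S" "\<bar>z - s\<bar> \<le> \<bar>r - s\<bar>" "T r - T s = (P z)\<^sup>2 * (r - s)"
  using DERIV_mvt[OF T_deriv convex_S assms] by blast

text \<open>The derivative of \<open>T\<close> is at least \<kappa>. Consequently \<open>T\<close>
  is injective, and the inverse \<open>R\<close> is Lipschitz.\<close>

lemma T_expand:
  assumes "r \<in> S" "s \<in> S"
  shows "\<bar>r - s\<bar> \<le> \<bar>T r - T s\<bar> / \<kappa>"
proof -
  obtain z where z: "z \<in> S" "T r - T s = (P z)\<^sup>2 * (r - s)"
    using T_mvt[OF assms] by blast
  then have "\<kappa> * \<bar>r - s\<bar> \<le> \<bar>T r - T s\<bar>"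
    using P_sq_ge[OF z(1)] by (auto simp: abs_mult intro: mult_right_mono)
  then show ?thesis using \<kappa>_pos by (simp add: field_simps)
qed

text \<open>Integrated form of \<open>mass_ge\<close>: the sum of \<open>T\<close> and
  \<open>(\<kappa> / M) * ln (1 - s * M)\<close> does not fall below its value 0 at the origin. The
  logarithm diverges at \<open>1/M\<close>, which makes the solution global.\<close>

lemma T_ge:
  assumes s: "s \<in> S"
  shows "T s \<ge> - (\<kappa> / M) * ln (1 - s * M)"
proof -
  define F where "F = (\<lambda>s. T s + (\<kappa> / M) * ln (1 - s * M))"
  have F: "(F has_real_derivative (P s)\<^sup>2 - \<kappa> / (1 - s * M)) (at s within S)" if "s \<in> S" for s
    unfolding F_def using S_margin[OF that] M_pos
    by (auto intro!: derivative_eq_intros T_deriv[OF that] simp: field_simps)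
  obtain z where z: "z \<in> S" "F s - F 0 = ((P z)\<^sup>2 - \<kappa> / (1 - z * M)) * (s - 0)"
    using DERIV_mvt[OF F convex_S s zero_in_S] by blast
  have "((P z)\<^sup>2 - \<kappa> / (1 - z * M)) * (s - 0) \<ge> 0"
    using mass_ge[of z] z(1) s by (intro mult_nonneg_nonneg) (auto simp: S_def)
  then show ?thesis using z(2) by (simp add: F_def T_zero)
qed

lemma T_surj:
  assumes t: "t \<ge> 0"
  shows "\<exists>s\<in>S. T s = t"
proof -
  \<comment> \<open>Here the lower bound of \<open>T_ge\<close> equals \<open>t\<close>, so
    \<open>T\<close> reaches the value \<open>t\<close> on the interval from 0 to
    \<open>s\<close>.\<close>
  define s where "s = (1 - exp (- t * M / \<kappa>)) / M"
  have "exp (- t * M / \<kappa>) \<le> 1" using t M_pos \<kappa>_pos by simp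
  then have s: "s \<in> S" using M_pos by (simp add: s_def S_def divide_strict_right_mono)
  have e: "1 - s * M = exp (- t * M / \<kappa>)" using M_pos by (simp add: s_def)
  have "T s \<ge> t" using T_ge[OF s] M_pos \<kappa>_pos unfolding e by simp
  moreover have "continuous_on S T"
    using T_deriv DERIV_continuous continuous_on_eq_continuous_within by blast
  moreover have sub: "{0..s} \<subseteq> S" using s by (auto simp: S_def)
  ultimately have "\<exists>x. 0 \<le> x \<and> x \<le> s \<and> T x = t"
    using t s T_zero by (intro IVT') (auto simp: S_def elim: continuous_on_subset)
  then show ?thesis using sub by auto
qed

definition "R t = (SOME s. s \<in> S \<and> T s = t)"

lemma R_mem: "t \<ge> 0 \<Longrightarrow> R t \<in> S" and T_R: "t \<ge> 0 \<Longrightarrow> T (R t) = t"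
proof -
  assume "t \<ge> 0"
  then have "\<exists>s. s \<in> S \<and> T s = t" using T_surj by blast
  from someI_ex[OF this] show "R t \<in> S" "T (R t) = t" by (simp_all add: R_def)
qed

lemma R_zero: "R 0 = 0"
  using T_expand[OF R_mem zero_in_S, of 0] T_R[of 0] by (simp add: T_zero)

lemma R_lipschitz: "t \<ge> 0 \<Longrightarrow> u \<ge> 0 \<Longrightarrow> \<bar>R t - R u\<bar> \<le> \<bar>t - u\<bar> / \<kappa>"
  using T_expand[OF R_mem R_mem, of t u] by (simp add: T_R)

lemma R_cont: "continuous_on {0..} R"
proof -
  have "(1 / \<kappa>)-lipschitz_on {0..} R"
    using R_lipschitz \<kappa>_pos by (intro lipschitz_onI) (auto simp: dist_real_def)
  then show ?thesis by (rule lipschitz_on_continuous_on)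
qed

lemma R_deriv:
  assumes t: "t \<ge> 0"
  shows "(R has_real_derivative 1 / (P (R t))\<^sup>2) (at t within {0..})"
proof -
  have "\<exists>z. z \<in> S \<and> \<bar>z - R t\<bar> \<le> \<bar>R v - R t\<bar> \<and> T (R v) - T (R t) = (P z)\<^sup>2 * (R v - R t)"
    if "v \<ge> 0" for v
    using T_mvt[OF R_mem[OF that] R_mem[OF t]] by metis
  then obtain \<xi> where \<xi>: "\<And>v. v \<ge> 0 \<Longrightarrow> \<xi> v \<in> S" "\<And>v. v \<ge> 0 \<Longrightarrow> \<bar>\<xi> v - R t\<bar> \<le> \<bar>R v - R t\<bar>"
    "\<And>v. v \<ge> 0 \<Longrightarrow> T (R v) - T (R t) = (P (\<xi> v))\<^sup>2 * (R v - R t)"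
    by metis
  have ev: "\<forall>\<^sub>F v in at t within {0..}. v \<ge> 0" by (simp add: eventually_at_filter)
  have "(R \<longlongrightarrow> R t) (at t within {0..})"
    using R_cont t by (simp add: continuous_on_def)
  moreover have "\<forall>\<^sub>F v in at t within {0..}. \<bar>\<xi> v - R t\<bar> \<le> \<bar>R v - R t\<bar>"
    using ev by eventually_elim (simp add: \<xi>(2))
  ultimately have "(\<xi> \<longlongrightarrow> R t) (at t within {0..})"
    by (rule tendsto_closer)
  then have "((\<lambda>v. P (\<xi> v)) \<longlongrightarrow> P (R t)) (at t within {0..})"
    by (rule continuous_on_tendsto_compose[OF P_cont])
      (use R_mem[OF t] in blast, use ev in eventually_elim, erule \<xi>(1))
  then have q: "((\<lambda>v. (P (\<xi> v))\<^sup>2) \<longlongrightarrow> (P (R t))\<^sup>2) (at t within {0..})"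
    by (rule tendsto_power)
  show ?thesis
  proof (rule has_real_derivative_implicit[where q = "\<lambda>v. (P (\<xi> v))\<^sup>2" and H = "\<lambda>v. v"])
    show "(P (\<xi> v))\<^sup>2 * (R v - R t) = v - t" if "v \<in> {0..}" for v
      using \<xi>(3)[of v] that t by (simp add: T_R)
  qed (use q P_pos[OF R_mem[OF t]] in auto)
qed

section \<open>The solution in space and physical time\<close>

lemma cont_RY:
  assumes F: "continuous_on (S \<times> Ipi) (\<lambda>(s, x). F s x)"
  shows "continuous_on ({0..} \<times> Ipi) (\<lambda>(t, y). F (R t) (Y (R t) y))"
proof -
  have R1: "continuous_on ({0..} \<times> Ipi) (\<lambda>z. R (fst z))"
    by (rule continuous_on_compose2[OF R_cont]) (auto intro!: continuous_intros)
  have R2: "continuous_on ({0..} \<times> Ipi) (\<lambda>z. (R (fst z), snd z))"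
    by (intro continuous_intros R1)
  have "continuous_on ({0..} \<times> Ipi) (\<lambda>z. case (R (fst z), snd z) of (s, y) \<Rightarrow> Y s y)"
    by (rule continuous_on_compose2[OF Y_cont R2]) (auto simp: R_mem)
  then have "continuous_on ({0..} \<times> Ipi) (\<lambda>z. (R (fst z), Y (R (fst z)) (snd z)))"
    by (intro continuous_intros R1) simp
  then have "continuous_on ({0..} \<times> Ipi) (\<lambda>z. case (R (fst z), Y (R (fst z)) (snd z)) of (s, x) \<Rightarrow> F s x)"
    by (rule continuous_on_compose2[OF F]) (use R_mem Y_mem in \<open>auto simp del: Ipi_simps\<close>)
  then show ?thesis by (simp add: case_prod_unfold)
qed

text \<open>The transport velocity has the unknown as its slope, so along the flow the unknown is
  the time derivative of \<open>ln J\<close>. \<open>B\<close> is the derivative of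
  \<open>ln J\<close> in \<open>s\<close>, and \<open>1 / P^2\<close> is ds/dt.\<close>

definition "sol t y = B (R t) (Y (R t) y) / (P (R t))\<^sup>2"

text \<open>\<open>D j\<close> is the \<open>j\<close>-th spatial derivative of \<^term>\<open>sol\<close> in Lagrangian coordinates, for \<open>j \<le> 3\<close> only:
  the last equation repeats the third derivative for all larger \<open>j\<close>.\<close>

fun D :: "nat \<Rightarrow> real \<Rightarrow> real \<Rightarrow> real" where
  "D 0 s x = B s x / (P s)\<^sup>2"
| "D (Suc 0) s x = f1 x / w s x"
| "D (Suc (Suc 0)) s x = f2 x + s * P s * (f1 x)\<^sup>2 / w s x"
| "D (Suc (Suc (Suc n))) s x = f3 x * w s x + 2 * s * P s * f1 x * f2 x + (s * P s)\<^sup>2 * (f1 x) ^ 3 / w s x"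

lemma D_cont: "continuous_on (S \<times> Ipi) (\<lambda>(s, x). D j s x)"
proof -
  have wnz: "w (fst z) (snd z) \<noteq> 0" if "z \<in> S \<times> Ipi" for z
    using w_pos[of "fst z" "snd z"] that by (auto simp del: Ipi_simps)
  have wc: "continuous_on (S \<times> Ipi) (\<lambda>z. w (fst z) (snd z))"
    unfolding w_def by (intro continuous_intros cont_f_snd cont_P_fst)
  have Bc: "continuous_on (S \<times> Ipi) (\<lambda>z. B (fst z) (snd z))"
    using B_cont by (simp add: case_prod_unfold)
  consider "j = 0" | "j = Suc 0" | "j = Suc (Suc 0)" | n where "j = Suc (Suc (Suc n))"
    by (metis not0_implies_Suc)
  then show ?thesis
    by cases (simp_all only: D.simps case_prod_unfold, 
      (intro continuous_intros cont_f_snd cont_P_fst wc Bc; use P_nonzero wnz in auto)+)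
qed

text \<open>\<open>Y s\<close> has slope \<open>w\<close>, so each derivative in \<open>y\<close> is
  a derivative in the label times \<open>w\<close>, while \<open>w\<close> has slope
  \<open>- s * P s * f1\<close>. In the first step this factor cancels one of the two powers of
  \<open>w\<close> in the denominator and leaves \<open>f1 / w\<close>.\<close>

lemma D_deriv:
  assumes j: "j < 3" and s: "s \<in> S" and y: "y \<in> Ipi"
  shows "((\<lambda>y. D j s (Y s y)) has_real_derivative D (Suc j) s (Y s y)) (at y within Ipi)"
proof -
  define x where "x = Y s y"
  have x: "x \<in> Ipi" unfolding x_def by (rule Y_mem[OF s y])
  have wx: "w s x > 0" by (rule w_pos[OF s x])
  have pos: "P s > 0" "1 - s * f x > 0" by (rule P_pos[OF s], rule G_pos[OF s x])
  have dw: "(w s has_real_derivative - s * P s * f1 x) (at x within Ipi)"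
    unfolding w_def[abs_def] by (auto intro!: derivative_eq_intros f_deriv[OF x])
  have "\<exists>E. (D j s has_real_derivative E) (at x within Ipi) \<and> E * w s x = D (Suc j) s x"
  proof -
    consider "j = 0" | "j = Suc 0" | "j = Suc (Suc 0)" using j by linarith
    then show ?thesis
    proof cases
      case 1
      have "((\<lambda>x. (f x / (1 - s * f x) - P1 s / P s) / (P s)\<^sup>2) has_real_derivative
          (f1 x * (1 - s * f x) - f x * (- s * f1 x)) / (1 - s * f x)\<^sup>2 / (P s)\<^sup>2) (at x within Ipi)"
        using pos by (auto intro!: derivative_eq_intros f_deriv[OF x] simp: power2_eq_square mult_ac)
      moreover have "(f1 x * (1 - s * f x) - f x * (- s * f1 x)) / (1 - s * f x)\<^sup>2 / (P s)\<^sup>2 * w s x = D (Suc j) s x"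
        using pos by (simp add: 1 w_def divide_simps power2_eq_square; simp add: algebra_simps)
      moreover have "D j s = (\<lambda>x. (f x / (1 - s * f x) - P1 s / P s) / (P s)\<^sup>2)"
        by (rule ext) (simp add: 1 B_def)
      ultimately show ?thesis by metis
    next
      case 2
      have "((\<lambda>x. f1 x / w s x) has_real_derivative
          (f2 x * w s x - f1 x * (- s * P s * f1 x)) / (w s x * w s x)) (at x within Ipi)"
        using wx by (intro DERIV_divide f1_deriv[OF x] dw) simp
      moreover have "(f2 x * w s x - f1 x * (- s * P s * f1 x)) / (w s x * w s x) * w s x = D (Suc j) s x"
        using wx by (simp add: 2 divide_simps power2_eq_square; simp add: algebra_simps)
      moreover have "D j s = (\<lambda>x. f1 x / w s x)"
        by (rule ext) (simp add: 2)
      ultimately show ?thesis by metis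
    next
      case 3
      have "((\<lambda>x. f2 x + s * P s * (f1 x)\<^sup>2 / w s x) has_real_derivative
          f3 x + ((s * P s * (2 * f1 x * f2 x)) * w s x - (s * P s * (f1 x)\<^sup>2) * (- s * P s * f1 x)) / (w s x * w s x)) (at x within Ipi)"
        using wx by (intro DERIV_add f2_deriv[OF x] DERIV_divide dw)
          (auto intro!: derivative_eq_intros f1_deriv[OF x])
      moreover have "(f3 x + ((s * P s * (2 * f1 x * f2 x)) * w s x - (s * P s * (f1 x)\<^sup>2) * (- s * P s * f1 x)) / (w s x * w s x)) * w s x = D (Suc j) s x"
        using wx by (simp add: 3 divide_simps power2_eq_square power3_eq_cube; simp add: algebra_simps)
      moreover have "D j s = (\<lambda>x. f2 x + s * P s * (f1 x)\<^sup>2 / w s x)"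
        by (rule ext) (simp add: 3)
      ultimately show ?thesis by metis
    qed
  qed
  then obtain E where E: "(D j s has_real_derivative E) (at x within Ipi)" "E * w s x = D (Suc j) s x" by blast
  have "((\<lambda>y. D j s (Y s y)) has_real_derivative E * w s x) (at y within Ipi)"
    unfolding x_def by (rule DERIV_within_chain[where g = "Y s", OF E(1)[unfolded x_def] Y_deriv[OF s y]])
      (use Y_mem[OF s] in blast)
  with E(2) show ?thesis by (simp add: x_def)
qed

lemma sol_chain:
  assumes "t \<ge> 0" "j < 3" "y \<in> Ipi"
  shows "((\<lambda>y. D j (R t) (Y (R t) y)) has_vector_derivative D (Suc j) (R t) (Y (R t) y)) (at y within Ipi)"
  using D_deriv[OF assms(2) R_mem[OF assms(1)] assms(3)]
  by (simp add: has_real_derivative_iff_has_vector_derivative)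

lemma dI_sol:
  assumes "t \<ge> 0" "j \<le> 3" "y \<in> Ipi"
  shows "dI j (sol t) y = D j (R t) (Y (R t) y)"
  by (rule dI_chain[where k = 3 and g = "\<lambda>j y. D j (R t) (Y (R t) y)"])
    (use assms sol_chain in \<open>auto simp: sol_def\<close>)

text \<open>The equation solved for the time derivative: \<open>V s x / (P s)^2\<close> is the
  transport velocity at \<open>y\<close>, and the expression in \<open>P\<close>, \<open>P1\<close>,
  \<open>P2\<close> is the mean square term evaluated by \<open>integral_B_sq\<close>.\<close>

lemma sol_deriv_t:
  assumes t: "t \<ge> 0" and y: "y \<in> Ipi"
  defines "s \<equiv> R t"
  defines "x \<equiv> Y s y"
  shows "((\<lambda>t. sol t y) has_real_derivative
    (sol t y)\<^sup>2 - (P2 s / P s - 2 * (P1 s)\<^sup>2 / (P s)\<^sup>2) / (P s) ^ 4 - V s x / (P s)\<^sup>2 * D 1 s x) (at t within {0..})"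
proof -
  have s: "s \<in> S" unfolding s_def by (rule R_mem[OF t])
  have x: "x \<in> Ipi" unfolding x_def by (rule Y_mem[OF s y])
  have pos: "P s > 0" "1 - s * f x > 0" by (rule P_pos[OF s], rule G_pos[OF s x])
  define E where "E = - f1 x * V s x * w s x"
  have dphi: "((\<lambda>s. f (Y s y)) has_real_derivative E) (at s within S)"
    using DERIV_within_chain[where g = "\<lambda>s. Y s y", OF f_deriv[OF x, unfolded x_def] Y_deriv_s[OF s y]]
      Y_mem[OF _ y] unfolding E_def x_def by (simp add: image_subset_iff mult.assoc)
  have "((\<lambda>s. (f (Y s y) / (1 - s * f (Y s y)) - P1 s / P s) / (P s)\<^sup>2) has_real_derivative
     (((E * (1 - s * f x) - f x * (- (f x + s * E))) / ((1 - s * f x) * (1 - s * f x)) - (P2 s * P s - P1 s * P1 s) / (P s * P s)) * (P s)\<^sup>2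
       - B s x * (2 * P s * P1 s)) / ((P s)\<^sup>2 * (P s)\<^sup>2)) (at s within S)"
    unfolding B_def x_def
    by (rule derivative_eq_intros refl dphi[unfolded x_def] P_deriv[OF s] P1_deriv[OF s] | use pos in \<open>simp add: x_def algebra_simps; fail\<close>)+
  then have "((\<lambda>s. B s (Y s y) / (P s)\<^sup>2) has_real_derivative
     (((E * (1 - s * f x) - f x * (- (f x + s * E))) / ((1 - s * f x) * (1 - s * f x)) - (P2 s * P s - P1 s * P1 s) / (P s * P s)) * (P s)\<^sup>2
       - B s x * (2 * P s * P1 s)) / ((P s)\<^sup>2 * (P s)\<^sup>2)) (at s within S)" (is "(_ has_real_derivative ?E') _")
    by (simp add: B_def)
  then have "((\<lambda>t. sol t y) has_real_derivative ?E' * (1 / (P s)\<^sup>2)) (at t within {0..})"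
    using DERIV_within_chain[where g = R and F = "\<lambda>s. B s (Y s y) / (P s)\<^sup>2" and T = S, OF _ R_deriv[OF t]] R_mem
    unfolding sol_def s_def by blast
  moreover have "?E' * (1 / (P s)\<^sup>2) = (sol t y)\<^sup>2 - (P2 s / P s - 2 * (P1 s)\<^sup>2 / (P s)\<^sup>2) / (P s) ^ 4 - V s x / (P s)\<^sup>2 * D 1 s x"
  proof -
    \<comment> \<open>Here \<open>g\<close>, \<open>u\<close>, \<open>r\<close> stand for
      \<open>1 - s * f x\<close>, \<open>f x\<close>, \<open>s\<close>; the relation
      \<open>r * u = 1 - g\<close> is the only link between them.\<close>
    have alg: "(((- c * v * (p * g) * g - u * (- (u + r * (- c * v * (p * g))))) / (g * g) - (p2 * p - p1 * p1) / (p * p)) * p\<^sup>2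
       - (u / g - p1 / p) * (2 * p * p1)) / (p\<^sup>2 * p\<^sup>2) * (1 / p\<^sup>2)
      = ((u / g - p1 / p) / p\<^sup>2)\<^sup>2 - (p2 / p - 2 * p1\<^sup>2 / p\<^sup>2) / p ^ 4 - v / p\<^sup>2 * (c / (p * g))"
      if "p > 0" "g > 0" "r * u = 1 - g" for p g u r c v p1 p2 :: real
    proof -
      have e: "- c * v * (p * g) * g - u * (- (u + r * (- c * v * (p * g)))) = u\<^sup>2 - c * v * p * g"
        using that(3) by algebra
      show ?thesis
        unfolding e using that(1,2)
        by (simp add: divide_simps power2_eq_square power4_eq_xxxx; simp add: algebra_simps)
    qed
    have D1: "D 1 s x = f1 x / (P s * (1 - s * f x))" by (simp add: w_def)
    show ?thesis
      unfolding D1 E_def w_def B_def sol_def s_def[symmetric] x_def[symmetric] by (rule alg[OF pos]) simp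
  qed
  ultimately show ?thesis by simp
qed

theorem PJ_sol: "PJ_sol f sol"
  unfolding PJ_sol_def
proof (intro conjI allI ballI impI)
  fix x assume x: "x \<in> Ipi"
  \<comment> \<open>The zero mean of \<open>f\<close> gives \<open>P1 0 = 0\<close>; otherwise the
    solution would start at \<open>f\<close> minus its mean.\<close>
  have P0: "P 0 = 1" "P1 0 = 0" using f_mean by (simp_all add: mass_def P1_def Ipi_def)
  have "X 0 y = y" if "y \<in> Ipi" for y using that by (simp add: X_def J_def[abs_def] P0)
  then have "Y 0 x = x" using Y_X[OF zero_in_S x] x by simp
  then show "sol 0 x = f x" by (simp add: sol_def R_zero B_def P0)
next
  fix t :: real assume t: "t \<ge> 0"
  show "Ck_on 3 (sol t)"
  proof (rule Ck_on_chain[where g = "\<lambda>j y. D j (R t) (Y (R t) y)"])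
    have "continuous_on Ipi (\<lambda>y. case (t, y) of (t, y) \<Rightarrow> D 3 (R t) (Y (R t) y))"
      by (rule continuous_on_compose2[OF cont_RY[OF D_cont]])
        (use t in \<open>auto intro!: continuous_on_Pair\<close>)
    then show "continuous_on Ipi (\<lambda>y. D 3 (R t) (Y (R t) y))" by simp
  qed (use t sol_chain in \<open>auto simp: sol_def\<close>)
next
  fix j :: nat assume "j \<le> 3"
  then show "continuous_on ({0..} \<times> Ipi) (\<lambda>(t, x). dI j (sol t) x)"
    by (intro continuous_on_eq[OF cont_RY[OF D_cont[of j]]]) (auto simp: dI_sol)
next
  fix t :: real assume t: "t \<ge> 0"
  have "integral {-pi..pi} (sol t) = V (R t) (Y (R t) pi) / (P (R t))\<^sup>2"
    using integral_Y[OF R_mem[OF t] _ continuous_on_slice[OF B_cont R_mem[OF t]], of pi]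
    by (simp add: sol_def[abs_def] V_def)
  then show "integral Ipi (sol t) = 0"
    using Y_right[OF R_mem[OF t]] V_right[OF R_mem[OF t]] by (simp add: Ipi_def)
next
  define Q where "Q = (\<lambda>s. (P2 s / P s - 2 * (P1 s)\<^sup>2 / (P s)\<^sup>2) / (P s) ^ 4)"
  let ?adot = "\<lambda>t y. (D 0 (R t) (Y (R t) y))\<^sup>2 - Q (R t)
     - V (R t) (Y (R t) y) / (P (R t))\<^sup>2 * D 1 (R t) (Y (R t) y)"
  show "\<exists>adot. continuous_on ({0..} \<times> Ipi) (\<lambda>(t, x). adot t x)
          \<and> (\<forall>t\<ge>0. \<forall>x\<in>Ipi.
               ((\<lambda>s. sol s x) has_real_derivative adot t x) (at t within {0..})
               \<and> adot t x + integral {-pi..x} (sol t) * dI 1 (sol t) x - (sol t x)\<^sup>2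
                   + (1 / pi) * integral Ipi (\<lambda>y. (sol t y)\<^sup>2) = 0)"
  proof (intro exI[of _ ?adot] conjI allI ballI impI)
    have Vc: "continuous_on (S \<times> Ipi) (\<lambda>z. V (fst z) (snd z))"
      using continuous_on_primitive[OF JB_cont] by (simp add: V_def case_prod_unfold)
    have Dc: "continuous_on (S \<times> Ipi) (\<lambda>z. D j (fst z) (snd z))" for j
      using D_cont[of j] by (simp add: case_prod_unfold)
    have "continuous_on (S \<times> Ipi) (\<lambda>(s, x). (D 0 s x)\<^sup>2 - Q s - V s x / (P s)\<^sup>2 * D 1 s x)"
      unfolding case_prod_unfold Q_def
      by (intro continuous_intros cont_P_fst Vc Dc) (use P_nonzero in auto)
    from cont_RY[OF this] show "continuous_on ({0..} \<times> Ipi) (\<lambda>(t, x). ?adot t x)" .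
  next
    fix t y :: real assume t: "t \<ge> 0" and y: "y \<in> Ipi"
    define s where "s = R t"
    have s: "s \<in> S" unfolding s_def by (rule R_mem[OF t])
    show "((\<lambda>t. sol t y) has_real_derivative ?adot t y) (at t within {0..})"
      using sol_deriv_t[OF t y] by (simp add: Q_def sol_def)
    have 1: "integral {-pi..y} (sol t) = V s (Y s y) / (P s)\<^sup>2"
      using integral_Y[OF s y continuous_on_slice[OF B_cont s]]
      by (simp add: sol_def[abs_def] V_def s_def)
    have "integral {-pi..pi} (\<lambda>y. (B s (Y s y))\<^sup>2) = integral {-pi..Y s pi} (\<lambda>x. J s x * (B s x)\<^sup>2)"
      by (rule integral_Y[OF s]) (auto intro!: continuous_intros continuous_on_slice[OF B_cont s])
    then have "integral Ipi (\<lambda>y. (B s (Y s y))\<^sup>2) = pi * (P2 s / P s - 2 * (P1 s)\<^sup>2 / (P s)\<^sup>2)"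
      using integral_B_sq[OF s] Y_right[OF s] by (simp add: Ipi_def)
    then have 2: "integral Ipi (\<lambda>y. (sol t y)\<^sup>2) = pi * Q s"
      by (simp add: sol_def Q_def s_def[symmetric] power_divide)
    show "?adot t y + integral {-pi..y} (sol t) * dI 1 (sol t) y - (sol t y)\<^sup>2
                   + (1 / pi) * integral Ipi (\<lambda>y. (sol t y)\<^sup>2) = 0"
      using dI_sol[OF t _ y, of 1] unfolding 1 2 s_def
      by (simp add: sol_def del: dI.simps)
  qed
qed

end

section \<open>The Poisson kernel\<close>

lemma abs_sin_diff_le: "\<bar>sin u - sin v\<bar> \<le> \<bar>u - v\<bar>" for u v :: real
proof -
  have "\<bar>sin u - sin v\<bar> = 2 * \<bar>sin ((u - v) / 2)\<bar> * \<bar>cos ((u + v) / 2)\<bar>"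
    unfolding sin_diff_sin by (simp add: abs_mult)
  also have "\<dots> \<le> 2 * \<bar>(u - v) / 2\<bar> * 1"
    by (intro mult_mono abs_sin_x_le_abs_x) auto
  finally show ?thesis by simp
qed

lemma sin_ge_cubic:
  fixes t :: real
  assumes "t \<ge> 0"
  shows "sin t \<ge> t - t ^ 3 / 6"
proof -
  have "(\<lambda>t. sin t - t + t ^ 3 / 6) 0 \<le> (\<lambda>t. sin t - t + t ^ 3 / 6) t"
  proof (rule DERIV_nonneg_imp_nondecreasing[OF assms])
    fix x :: real
    have "(sin (x / 2))\<^sup>2 \<le> (x / 2)\<^sup>2"
      using abs_sin_x_le_abs_x[of "x / 2"] by (rule abs_le_square_iff[THEN iffD1])
    then have "cos x - 1 + x\<^sup>2 / 2 \<ge> 0"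
      using cos_double_sin[of "x / 2"] by (simp add: power_divide)
    moreover have "((\<lambda>t. sin t - t + t ^ 3 / 6) has_real_derivative cos x - 1 + x\<^sup>2 / 2) (at x)"
      by (auto intro!: derivative_eq_intros)
    ultimately show "\<exists>y. ((\<lambda>t. sin t - t + t ^ 3 / 6) has_real_derivative y) (at x) \<and> 0 \<le> y"
      by blast
  qed
  then show ?thesis by simp
qed

lemma cos_le_quartic:
  fixes t :: real
  assumes "t \<ge> 0"
  shows "cos t \<le> 1 - t\<^sup>2 / 2 + t ^ 4 / 24"
proof -
  have "(\<lambda>t. 1 - t\<^sup>2 / 2 + t ^ 4 / 24 - cos t) 0 \<le> (\<lambda>t. 1 - t\<^sup>2 / 2 + t ^ 4 / 24 - cos t) t"
  proof (rule DERIV_nonneg_imp_nondecreasing[OF assms])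
    fix x :: real assume "0 \<le> x"
    then have "- x + x ^ 3 / 6 + sin x \<ge> 0"
      using sin_ge_cubic[of x] by simp
    moreover have "((\<lambda>t. 1 - t\<^sup>2 / 2 + t ^ 4 / 24 - cos t) has_real_derivative - x + x ^ 3 / 6 + sin x) (at x)"
      by (auto intro!: derivative_eq_intros)
    ultimately show "\<exists>y. ((\<lambda>t. 1 - t\<^sup>2 / 2 + t ^ 4 / 24 - cos t) has_real_derivative y) (at x) \<and> 0 \<le> y"
      by blast
  qed
  then show ?thesis by simp
qed

text \<open>The quartic Taylor bound for the cosine is already negative at 8/5, by about
  0.007.\<close>

lemma pi_less: "pi < 16/5"
proof (rule ccontr)
  assume "\<not> pi < 16/5"
  then have "cos (8/5 :: real) \<ge> 0" by (intro cos_ge_zero) auto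
  then show False using cos_le_quartic[of "8/5"] by (simp add: power2_eq_square power4_eq_xxxx)
qed

text \<open>Half-angle formula together with \<open>sin u \<ge> (47/96) * u\<close> for
  \<open>u \<le> 7/4\<close>, where \<open>47/96 = 1 - (7/4)^2 / 6\<close>. The range extends beyond
  pi because \<open>z\<close> will be the distance from a maximum that is not exactly at 0.\<close>

lemma one_minus_cos_ge:
  fixes z :: real
  assumes "\<bar>z\<bar> \<le> 7/2"
  shows "z\<^sup>2 / 10 \<le> 1 - cos z"
proof -
  define u where "u = \<bar>z\<bar> / 2"
  have u: "0 \<le> u" "u \<le> 7/4" using assms by (auto simp: u_def)
  have "u\<^sup>2 \<le> (7/4)\<^sup>2" using u by (intro power_mono) auto
  then have "u * (1 - u\<^sup>2 / 6) \<ge> u * (47/96)"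
    using u by (intro mult_left_mono) (auto simp: power2_eq_square)
  then have "sin u \<ge> u * (47/96)"
    using sin_ge_cubic[OF u(1)] by (simp add: algebra_simps power2_eq_square power3_eq_cube)
  then have "(sin u)\<^sup>2 \<ge> (u * (47/96))\<^sup>2"
    using u by (intro power_mono) auto
  moreover have "1 - cos \<bar>z\<bar> = 2 * (sin u)\<^sup>2"
    using cos_double_sin[of u] by (simp add: u_def)
  moreover have "cos \<bar>z\<bar> = cos z" by (simp add: abs_if)
  moreover have "u\<^sup>2 = z\<^sup>2 / 4" by (simp add: u_def power_divide)
  moreover have "(u * (47/96))\<^sup>2 = u\<^sup>2 * (2209/9216)" by (simp add: power2_eq_square)
  moreover have "u\<^sup>2 * (2209/9216) \<ge> u\<^sup>2 * (2000/10000)" by (intro mult_left_mono) auto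
  ultimately show ?thesis by linarith
qed

text \<open>The Poisson kernel with integral \<open>2 * pi\<close>, in parameters suited to the
  flow. For the profile with \<open>M - f = m * (1 - cos (x - x0))\<close> and
  \<open>c = s * m\<close>, the denominator is \<open>1 - s * f\<close>, the square root is
  \<open>1 / P\<close>, and the quotient is the Jacobian.\<close>

definition kern :: "real \<Rightarrow> real \<Rightarrow> real \<Rightarrow> real" where
  "kern \<eta> c z = sqrt (\<eta> * (\<eta> + 2 * c)) / (\<eta> + c * (1 - cos z))"

lemma kern_denom_pos: "\<eta> > 0 \<Longrightarrow> c \<ge> 0 \<Longrightarrow> \<eta> + c * (1 - cos z) > (0::real)"
  by (intro add_pos_nonneg mult_nonneg_nonneg) auto

text \<open>The primitive of the Poisson kernel is the boundary map of a disc automorphism; this is the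
  Lagrangian flow of the stationary solution.\<close>

lemma kern_primitive:
  assumes \<eta>: "\<eta> > 0" and c: "c \<ge> 0"
  obtains \<Xi> where "\<And>z. (\<Xi> has_real_derivative kern \<eta> c z) (at z)" "\<And>z. sin (\<Xi> z) = sin z * kern \<eta> c z"
    "\<And>z. \<Xi> (z + 2 * pi) = \<Xi> z + 2 * pi" "\<Xi> (-pi) = -pi"
proof -
  define s u where "s = sqrt \<eta>" and "u = sqrt (\<eta> + 2 * c)"
  have s: "s > 0" "s\<^sup>2 = \<eta>" using \<eta> by (simp_all add: s_def)
  have u: "u \<ge> s" "u\<^sup>2 = \<eta> + 2 * c" using \<eta> c by (simp_all add: u_def s_def)
  have us: "sqrt (\<eta> * (\<eta> + 2 * c)) = u * s" by (simp add: u_def s_def real_sqrt_mult)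
  \<comment> \<open>The radius of the kernel: multiplying numerator and denominator of (1 -
    \<beta>^2) / (1 - 2 \<beta> cos z + \<beta>^2) by \<open>(u + s)^2 / 4\<close> gives
    \<open>kern\<close>.\<close>
  define \<beta> where "\<beta> = (u - s) / (u + s)"
  have \<beta>: "0 \<le> \<beta>" "\<beta> < 1" using s u by (auto simp: \<beta>_def)
  define N where "N = (\<lambda>z. 1 - \<beta> * cos z)"
  define Q where "Q = (\<lambda>z. (N z)\<^sup>2 + (\<beta> * sin z)\<^sup>2)"
  \<comment> \<open>A continuous argument of (w - \<beta>) / (1 - \<beta> w) at w = exp (i z):
    numerator and denominator contribute one arctangent each, and \<open>N z > 0\<close> keeps this
    branch smooth.\<close>
  define \<Xi> where "\<Xi> = (\<lambda>z. z + 2 * arctan (\<beta> * sin z / N z))"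
  have N: "N z > 0" for z
  proof -
    have "\<beta> * cos z \<le> \<beta> * 1" using \<beta> by (intro mult_left_mono) auto
    then show ?thesis using \<beta> by (simp add: N_def)
  qed
  have Q: "Q z > 0" for z using N[of z] by (simp add: Q_def add_pos_nonneg)
  have sc: "(sin z)\<^sup>2 = 1 - (cos z)\<^sup>2" for z :: real by (simp add: sin_squared_eq)
  have kern: "kern \<eta> c z = (1 - \<beta>\<^sup>2) / Q z" for z
  proof -
    have K: "(u + s)\<^sup>2 / 4 > 0" using s u by simp
    have bs: "\<beta> * (u + s) = u - s" using s u by (simp add: \<beta>_def)
    have "4 * u * s = (u + s)\<^sup>2 * (1 - \<beta>\<^sup>2)" using bs by algebra
    then have 1: "u * s = (u + s)\<^sup>2 / 4 * (1 - \<beta>\<^sup>2)" by simp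
    have "Q z = 1 - 2 * \<beta> * cos z + \<beta>\<^sup>2"
      using sc[of z] unfolding Q_def N_def by algebra
    then have "4 * (\<eta> + c * (1 - cos z)) = (u + s)\<^sup>2 * Q z" using bs s(2) u(2) by algebra
    then have 2: "\<eta> + c * (1 - cos z) = (u + s)\<^sup>2 / 4 * Q z" by simp
    show ?thesis unfolding kern_def us 1 2 using K by simp
  qed
  have one: "1 + (\<beta> * sin z / N z)\<^sup>2 = Q z / (N z)\<^sup>2" for z
    using N[of z] by (simp add: Q_def power_divide add_divide_distrib)
  have "(\<Xi> has_real_derivative kern \<eta> c z) (at z)" for z
  proof -
    have dN: "(N has_real_derivative \<beta> * sin z) (at z)"
      unfolding N_def by (auto intro!: derivative_eq_intros)
    have "((\<lambda>z. \<beta> * sin z / N z) has_real_derivative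
        (\<beta> * cos z * N z - \<beta> * sin z * (\<beta> * sin z)) / (N z * N z)) (at z)"
      using N[of z] by (intro DERIV_divide dN) (auto intro!: derivative_eq_intros)
    then have "(\<Xi> has_real_derivative 1 + 2 * (inverse (1 + (\<beta> * sin z / N z)\<^sup>2) *
        ((\<beta> * cos z * N z - \<beta> * sin z * (\<beta> * sin z)) / (N z * N z)))) (at z)"
      unfolding \<Xi>_def by (intro DERIV_add DERIV_ident DERIV_cmult DERIV_chain2[OF DERIV_arctan])
    also have "1 + 2 * (inverse (1 + (\<beta> * sin z / N z)\<^sup>2) *
        ((\<beta> * cos z * N z - \<beta> * sin z * (\<beta> * sin z)) / (N z * N z)))
      = (Q z + 2 * (\<beta> * cos z * N z - \<beta> * sin z * (\<beta> * sin z))) / Q z"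
      unfolding one using N[of z] Q[of z] by (simp add: divide_simps power2_eq_square)
    also have "Q z + 2 * (\<beta> * cos z * N z - \<beta> * sin z * (\<beta> * sin z)) = 1 - \<beta>\<^sup>2"
      using sc[of z] unfolding Q_def N_def by algebra
    finally show ?thesis by (simp add: kern)
  qed
  moreover have "sin (\<Xi> z) = sin z * kern \<eta> c z" for z
  proof -
    define T where "T = \<beta> * sin z / N z"
    have T: "1 + T\<^sup>2 > 0" by (simp add: add_pos_nonneg)
    have "sin (2 * arctan T) = 2 * T / (1 + T\<^sup>2)"
    proof -
      have "sqrt (1 + T\<^sup>2) * sqrt (1 + T\<^sup>2) = 1 + T\<^sup>2" using T by (intro real_sqrt_mult_self[THEN trans]) simp
      then show ?thesis by (simp add: sin_double sin_arctan cos_arctan)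
    qed
    also have "\<dots> = 2 * \<beta> * sin z * N z / Q z"
      using one[of z] N[of z] Q[of z] unfolding T_def by (simp add: divide_simps power2_eq_square)
    finally have 1: "sin (2 * arctan T) = 2 * \<beta> * sin z * N z / Q z" .
    have "cos (2 * arctan T) = 2 * (1 / (1 + T\<^sup>2)) - 1"
      using T by (simp add: cos_double_cos cos_arctan power_divide)
    also have "\<dots> = (2 * (N z)\<^sup>2 - Q z) / Q z"
      using one[of z] N[of z] Q[of z] unfolding T_def by (simp add: divide_simps)
    finally have 2: "cos (2 * arctan T) = (2 * (N z)\<^sup>2 - Q z) / Q z" .
    have "sin (\<Xi> z) = sin z * ((2 * (N z)\<^sup>2 - Q z) / Q z) + cos z * (2 * \<beta> * sin z * N z / Q z)"
      unfolding \<Xi>_def T_def[symmetric] sin_add 1 2 ..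
    also have "\<dots> = (sin z * (2 * (N z)\<^sup>2 - Q z) + cos z * (2 * \<beta> * sin z * N z)) / Q z"
      by (simp add: add_divide_distrib)
    also have "sin z * (2 * (N z)\<^sup>2 - Q z) + cos z * (2 * \<beta> * sin z * N z) = sin z * (1 - \<beta>\<^sup>2)"
      using sc[of z] unfolding Q_def N_def by algebra
    finally show ?thesis by (simp add: kern)
  qed
  moreover have "\<Xi> (z + 2 * pi) = \<Xi> z + 2 * pi" for z
    by (simp add: \<Xi>_def N_def)
  moreover have "\<Xi> (-pi) = -pi" by (simp add: \<Xi>_def)
  ultimately show thesis using that by blast
qed

lemma kern_integral:
  assumes \<eta>: "\<eta> > 0" and c: "c \<ge> 0"
  shows "((\<lambda>x. kern \<eta> c (x - x0)) has_integral 2 * pi) Ipi"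
proof -
  obtain \<Xi> where \<Xi>: "\<And>z. (\<Xi> has_real_derivative kern \<eta> c z) (at z)"
    "\<And>z. \<Xi> (z + 2 * pi) = \<Xi> z + 2 * pi"
    using kern_primitive[OF assms] by metis
  have "((\<lambda>x. kern \<eta> c (x - x0)) has_integral \<Xi> (pi - x0) - \<Xi> (-pi - x0)) {-pi..pi}"
  proof (rule fundamental_theorem_of_calculus)
    fix x :: real
    have "((\<lambda>x. \<Xi> (x - x0)) has_real_derivative kern \<eta> c (x - x0) * 1) (at x)"
      by (rule DERIV_chain2[OF \<Xi>(1)]) (auto intro!: derivative_eq_intros)
    then show "((\<lambda>x. \<Xi> (x - x0)) has_vector_derivative kern \<eta> c (x - x0)) (at x within {-pi..pi})"
      by (simp add: has_real_derivative_iff_has_vector_derivative has_vector_derivative_at_within)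
  qed simp
  moreover have "\<Xi> (pi - x0) - \<Xi> (-pi - x0) = 2 * pi"
    using \<Xi>(2)[of "-pi - x0"] by simp
  ultimately show ?thesis by (simp add: Ipi_def)
qed

lemma kern_cont:
  assumes "\<eta> > 0" "c \<ge> 0"
  shows "continuous_on S (\<lambda>x. kern \<eta> c (x - x0))"
  unfolding kern_def using kern_denom_pos[OF assms]
  by (intro continuous_intros) (metis less_irrefl)

lemma integral_inverse_one_minus_cos:
  assumes \<eta>: "\<eta> > 0" and c: "c \<ge> 0"
  shows "integral Ipi (\<lambda>x. 1 / (\<eta> + c * (1 - cos (x - x0)))) = 2 * pi / sqrt (\<eta> * (\<eta> + 2 * c))"
proof -
  have "\<eta> \<noteq> 0" "\<eta> + 2 * c \<noteq> 0" using assms by auto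
  then have "sqrt (\<eta> * (\<eta> + 2 * c)) \<noteq> 0" by simp
  then have "integral Ipi (\<lambda>x. 1 / (\<eta> + c * (1 - cos (x - x0))))
      = integral Ipi (\<lambda>x. (1 / sqrt (\<eta> * (\<eta> + 2 * c))) * kern \<eta> c (x - x0))"
    unfolding kern_def by (intro integral_cong) (simp del: real_sqrt_eq_zero_cancel_iff)
  also have "\<dots> = (1 / sqrt (\<eta> * (\<eta> + 2 * c))) * (2 * pi)"
    using kern_integral[OF assms, of x0] by (simp only: integral_mult_right integral_unique)
  finally show ?thesis by simp
qed

text \<open>Half the logarithm of the denominator is a primitive up to a change of sign at
  \<open>x0\<close>. Its value there produces \<open>- ln \<eta>\<close>, the source of the
  logarithm in the error; each end contributes at most 7, by \<open>ln r \<le> r\<close> and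
  \<open>1 + (7/2)^2 \<le> 14\<close>.\<close>

lemma integral_abs_over_quadratic:
  assumes \<eta>: "\<eta> > 0" "\<eta> \<le> 1" and x0: "x0 \<in> Ipi" and bd: "\<And>x. x \<in> Ipi \<Longrightarrow> \<bar>x - x0\<bar> \<le> 7/2"
  shows "(\<lambda>x. \<bar>x - x0\<bar> / (\<eta> + (x - x0)\<^sup>2)) integrable_on Ipi"
    and "integral Ipi (\<lambda>x. \<bar>x - x0\<bar> / (\<eta> + (x - x0)\<^sup>2)) \<le> 14 - ln \<eta>"
proof -
  define F where "F = (\<lambda>x. ln (\<eta> + (x - x0)\<^sup>2) / 2)"
  have pos: "\<eta> + (x - x0)\<^sup>2 > 0" for x using \<eta> by (simp add: add_pos_nonneg)
  have F: "(F has_vector_derivative (x - x0) / (\<eta> + (x - x0)\<^sup>2)) (at x within A)" for x A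
  proof -
    have "((\<lambda>x. ln (\<eta> + (x - x0)\<^sup>2) / 2) has_real_derivative (1 / (\<eta> + (x - x0)\<^sup>2) * (2 * (x - x0))) / 2) (at x within A)"
      by (rule DERIV_cdivide, rule DERIV_chain2[where g = "\<lambda>x. \<eta> + (x - x0)\<^sup>2" and x = x, OF DERIV_ln_divide[OF pos]]) (auto intro!: derivative_eq_intros)
    moreover have "1 / q * (2 * d) / 2 = d / q" for q d :: real by simp
    ultimately show ?thesis
      unfolding F_def has_real_derivative_iff_has_vector_derivative[symmetric] by metis
  qed
  have "((\<lambda>x. (x - x0) / (\<eta> + (x - x0)\<^sup>2)) has_integral F pi - F x0) {x0..pi}"
    using x0 F by (intro fundamental_theorem_of_calculus) auto
  then have 1: "((\<lambda>x. \<bar>x - x0\<bar> / (\<eta> + (x - x0)\<^sup>2)) has_integral F pi - F x0) {x0..pi}"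
    by (rule has_integral_eq[rotated]) auto
  have "((\<lambda>x. (x - x0) / (\<eta> + (x - x0)\<^sup>2)) has_integral F x0 - F (-pi)) {-pi..x0}"
    using x0 F by (intro fundamental_theorem_of_calculus) auto
  then have "((\<lambda>x. - ((x - x0) / (\<eta> + (x - x0)\<^sup>2))) has_integral - (F x0 - F (-pi))) {-pi..x0}"
    by (rule has_integral_neg)
  then have 2: "((\<lambda>x. \<bar>x - x0\<bar> / (\<eta> + (x - x0)\<^sup>2)) has_integral - (F x0 - F (-pi))) {-pi..x0}"
    by (rule has_integral_eq[rotated]) (auto simp: divide_simps)
  have I: "((\<lambda>x. \<bar>x - x0\<bar> / (\<eta> + (x - x0)\<^sup>2)) has_integral - (F x0 - F (-pi)) + (F pi - F x0)) Ipi"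
    unfolding Ipi_def using x0 by (intro has_integral_combine[OF _ _ 2 1]) auto
  then show "(\<lambda>x. \<bar>x - x0\<bar> / (\<eta> + (x - x0)\<^sup>2)) integrable_on Ipi" by blast
  have "F x \<le> 7" if "x \<in> Ipi" for x
  proof -
    have "(x - x0)\<^sup>2 \<le> (7/2)\<^sup>2" using bd[OF that] abs_le_square_iff[of "x - x0" "7/2"] by simp
    then have "\<eta> + (x - x0)\<^sup>2 \<le> 14" using \<eta> by (simp add: power2_eq_square)
    then have "ln (\<eta> + (x - x0)\<^sup>2) \<le> 14" using ln_bound[OF pos[of x]] by simp
    then show ?thesis by (simp add: F_def)
  qed
  from this[of pi] this[of "-pi"] have "- (F x0 - F (-pi)) + (F pi - F x0) \<le> 14 - 2 * F x0"
    by simp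
  then show "integral Ipi (\<lambda>x. \<bar>x - x0\<bar> / (\<eta> + (x - x0)\<^sup>2)) \<le> 14 - ln \<eta>"
    using integral_unique[OF I] by (simp add: F_def)
qed

section \<open>Data close to the cosine\<close>

text \<open>The case \<open>\<mu> = 1\<close>, with \<open>\<epsilon> = \<sigma> / \<mu>\<close> and
  \<open>x0\<close> any point of maximum. The threshold 1/10000 is the \<delta> of the theorem; it
  makes the relative error in \<open>sandwich\<close> at most 1/20.\<close>

locale near_cos =
  fixes f f1 f2 f3 :: "real \<Rightarrow> real" and \<epsilon> x0 :: real
  assumes f_deriv: "\<And>x. x \<in> Ipi \<Longrightarrow> (f has_real_derivative f1 x) (at x within Ipi)"
    and f1_deriv: "\<And>x. x \<in> Ipi \<Longrightarrow> (f1 has_real_derivative f2 x) (at x within Ipi)"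
    and f2_deriv: "\<And>x. x \<in> Ipi \<Longrightarrow> (f2 has_real_derivative f3 x) (at x within Ipi)"
    and f3_cont: "continuous_on Ipi f3"
    and close: "\<And>x. x \<in> Ipi \<Longrightarrow> \<bar>f x - cos x\<bar> \<le> \<epsilon>" "\<And>x. x \<in> Ipi \<Longrightarrow> \<bar>f1 x + sin x\<bar> \<le> \<epsilon>"
      "\<And>x. x \<in> Ipi \<Longrightarrow> \<bar>f2 x + cos x\<bar> \<le> \<epsilon>" "\<And>x. x \<in> Ipi \<Longrightarrow> \<bar>f3 x - sin x\<bar> \<le> \<epsilon>"
    and \<epsilon>_small: "\<epsilon> \<le> 1 / 10000"
    and x0: "x0 \<in> Ipi" and max: "\<And>x. x \<in> Ipi \<Longrightarrow> f x \<le> f x0"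
    and f_mean: "integral Ipi f = 0"
begin

definition "M = f x0"
definition "m = - f2 x0"

lemma \<epsilon>_nonneg: "\<epsilon> \<ge> 0"
  using close(1)[OF x0] by linarith

section \<open>Position and curvature of the maximum\<close>

lemma M_bounds: "\<bar>M - 1\<bar> \<le> \<epsilon>"
proof -
  have "\<bar>f 0 - cos 0\<bar> \<le> \<epsilon>" by (rule close(1)) simp
  moreover have "f 0 \<le> M" unfolding M_def by (rule max) simp
  ultimately show ?thesis
    using close(1)[OF x0] cos_le_one[of x0] unfolding M_def abs_le_iff cos_zero by linarith
qed

lemma cos_x0: "cos x0 \<ge> 1 - 2 * \<epsilon>"
  using M_bounds close(1)[OF x0] unfolding M_def by (simp add: abs_le_iff)

text \<open>A maximum at an end of the interval need not be a critical point. This places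
  \<open>x0\<close> in the interior, as \<open>f1_x0\<close> requires.\<close>

lemma x0_lt: "\<bar>x0\<bar> < pi / 2"
proof (rule ccontr)
  assume "\<not> ?thesis"
  then have "cos \<bar>x0\<bar> \<le> cos (pi / 2)" using x0 by (intro cos_monotone_0_pi_le) auto
  moreover have "cos \<bar>x0\<bar> = cos x0" by (simp add: abs_if)
  ultimately show False using cos_x0 \<epsilon>_small by simp
qed

lemma f1_x0: "f1 x0 = 0"
proof -
  have int: "-pi < x0" "x0 < pi" using x0_lt by auto
  have "at x0 within Ipi = at x0"
    using int by (intro at_within_interior) (simp add: Ipi_def)
  then have "(f has_real_derivative f1 x0) (at x0)"
    using f_deriv[OF x0] by simp
  moreover have "min (pi - x0) (x0 + pi) > 0" using int by simp
  moreover have "\<forall>y. \<bar>x0 - y\<bar> < min (pi - x0) (x0 + pi) \<longrightarrow> f y \<le> f x0"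
    by (intro allI impI max) (auto simp: abs_less_iff)
  ultimately show ?thesis by (rule DERIV_local_max)
qed

text \<open>Criticality bounds \<open>\<bar>sin x0\<bar>\<close> by \<epsilon>, and
  \<open>x0_lt\<close> keeps \<open>x0\<close> away from the zeros of the sine at the ends.\<close>

lemma x0_small: "\<bar>x0\<bar> \<le> 2 * \<epsilon>"
proof -
  have s: "\<bar>sin x0\<bar> \<le> \<epsilon>" using close(2)[OF x0] by (simp add: f1_x0)
  define t where "t = \<bar>x0\<bar>"
  have t: "0 \<le> t" "t \<le> 8/5" using x0_lt pi_less by (auto simp: t_def)
  have "t\<^sup>2 \<le> (8/5)\<^sup>2" using t by (intro power_mono) auto
  then have "t * (t\<^sup>2 / 6) \<le> t * (1 / 2)" using t by (intro mult_left_mono) (auto simp: power2_eq_square)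
  then have "sin t \<ge> t / 2"
    using sin_ge_cubic[OF t(1)] by (simp add: power2_eq_square power3_eq_cube)
  moreover have "sin t \<le> \<bar>sin x0\<bar>" by (simp add: t_def abs_if)
  ultimately show ?thesis using s by (simp add: t_def)
qed

lemma m_bounds: "\<bar>m - 1\<bar> \<le> 3 * \<epsilon>"
  using close(3)[OF x0] cos_x0 cos_le_one[of x0] \<epsilon>_nonneg unfolding m_def abs_le_iff by linarith

lemma m_numeric: "99/100 \<le> m" "m \<le> 101/100" and M_numeric: "99/100 \<le> M" "M \<le> 101/100"
  using m_bounds M_bounds \<epsilon>_small by (auto simp: abs_le_iff)

lemma z_le: "x \<in> Ipi \<Longrightarrow> \<bar>x - x0\<bar> \<le> 7/2"
  using x0_small \<epsilon>_small pi_less unfolding abs_le_iff Ipi_simps by linarith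

text \<open>The difference between \<open>M - f\<close> and its model profile, which vanishes to third order at \<open>x0\<close>.\<close>

definition "D0 x = (M - f x) - m * (1 - cos (x - x0))"
definition "D1 x = - f1 x - m * sin (x - x0)"

text \<open>One step up the chain of derivatives: by the mean value theorem a zero at
  \<open>x0\<close> raises the order of vanishing by one with the same constant
  \<open>K\<close>.\<close>

lemma vanish_bound:
  assumes h: "\<And>x. x \<in> Ipi \<Longrightarrow> (h has_real_derivative h' x) (at x within Ipi)" and h0: "h x0 = 0"
    and le: "\<And>x. x \<in> Ipi \<Longrightarrow> \<bar>h' x\<bar> \<le> K * \<bar>x - x0\<bar> ^ n" and K: "K \<ge> 0" and x: "x \<in> Ipi"
  shows "\<bar>h x\<bar> \<le> K * \<bar>x - x0\<bar> ^ Suc n"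
proof -
  obtain z where z: "z \<in> Ipi" "\<bar>z - x0\<bar> \<le> \<bar>x - x0\<bar>" "h x - h x0 = h' z * (x - x0)"
    using DERIV_mvt[OF h convex_Ipi x x0] by blast
  have "\<bar>h x\<bar> = \<bar>h' z\<bar> * \<bar>x - x0\<bar>" using z(3) h0 by (simp add: abs_mult)
  also have "\<bar>h' z\<bar> \<le> K * \<bar>x - x0\<bar> ^ n"
    using le[OF z(1)] mult_left_mono[OF power_mono[OF z(2), of n] K] by simp
  finally show ?thesis by (simp add: mult_right_mono mult_ac)
qed

text \<open>The choice of \<open>M\<close>, the criticality of \<open>x0\<close> and the choice of
  \<open>m\<close> make \<open>D0\<close> vanish at \<open>x0\<close> with its first two
  derivatives. The third derivative is at most \<open>6 * \<epsilon>\<close>: one \<epsilon> from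
  \<open>f3\<close>, two from the shift by \<open>x0\<close>, three from
  \<open>m - 1\<close>.\<close>

lemma D_bounds:
  assumes x: "x \<in> Ipi"
  shows "\<bar>D1 x\<bar> \<le> 6 * \<epsilon> * (x - x0)\<^sup>2" and "\<bar>D0 x\<bar> \<le> 6 * \<epsilon> * \<bar>x - x0\<bar> ^ 3"
proof -
  define D2 where "D2 = (\<lambda>x. - f2 x - m * cos (x - x0))"
  define D3 where "D3 = (\<lambda>x. - f3 x + m * sin (x - x0))"
  have d2: "(D2 has_real_derivative D3 x) (at x within Ipi)"
    and d1: "(D1 has_real_derivative D2 x) (at x within Ipi)"
    and d0: "(D0 has_real_derivative D1 x) (at x within Ipi)" if "x \<in> Ipi" for x
    unfolding D3_def D2_def D1_def[abs_def] D0_def[abs_def]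
    by (auto intro!: derivative_eq_intros f_deriv[OF that] f1_deriv[OF that] f2_deriv[OF that])
  have f1x0: "D1 x0 = 0" by (simp add: D1_def f1_x0)
  have K: "6 * \<epsilon> \<ge> 0" using \<epsilon>_nonneg by simp
  have 3: "\<bar>D3 x\<bar> \<le> 6 * \<epsilon> * \<bar>x - x0\<bar> ^ 0" if "x \<in> Ipi" for x
  proof -
    have 1: "\<bar>sin (x - x0) - sin x\<bar> \<le> 2 * \<epsilon>" using abs_sin_diff_le[of "x - x0" x] x0_small by simp
    have "\<bar>(m - 1) * sin (x - x0)\<bar> \<le> 3 * \<epsilon> * 1"
      unfolding abs_mult using m_bounds by (intro mult_mono) auto
    moreover have "D3 x = - (f3 x - sin x) + (sin (x - x0) - sin x) + (m - 1) * sin (x - x0)"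
      by (simp add: D3_def algebra_simps)
    ultimately show ?thesis
      using 1 close(4)[OF that] by simp
  qed
  have 2: "\<bar>D2 x\<bar> \<le> 6 * \<epsilon> * \<bar>x - x0\<bar> ^ Suc 0" if "x \<in> Ipi" for x
    by (rule vanish_bound[OF d2 _ 3 K that]) (simp_all add: D2_def m_def)
  have 1: "\<bar>D1 x\<bar> \<le> 6 * \<epsilon> * \<bar>x - x0\<bar> ^ Suc (Suc 0)" if "x \<in> Ipi" for x
    by (rule vanish_bound[OF d1 f1x0 2 K that])
  then show "\<bar>D1 x\<bar> \<le> 6 * \<epsilon> * (x - x0)\<^sup>2" using x by (simp add: power2_eq_square numeral_2_eq_2 abs_mult_self_eq)
  have "\<bar>D0 x\<bar> \<le> 6 * \<epsilon> * \<bar>x - x0\<bar> ^ Suc (Suc (Suc 0))"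
    by (rule vanish_bound[OF d0 _ 1 K x]) (simp_all add: D0_def M_def)
  then show "\<bar>D0 x\<bar> \<le> 6 * \<epsilon> * \<bar>x - x0\<bar> ^ 3" by (simp add: numeral_3_eq_3)
qed

text \<open>A cubic error against quadratic growth on a bounded interval. This coarse comparison is
  enough for the size of \<open>P\<close> and the speed of \<eta>; the closeness of the flows uses
  the cubic bound itself.\<close>

lemma sandwich:
  assumes x: "x \<in> Ipi"
  shows "19/20 * (m * (1 - cos (x - x0))) \<le> M - f x" "M - f x \<le> 21/20 * (m * (1 - cos (x - x0)))"
proof -
  have "\<bar>D0 x\<bar> \<le> 6 * \<epsilon> * (\<bar>x - x0\<bar> * (x - x0)\<^sup>2)"
    using D_bounds(2)[OF x] by (simp add: power3_eq_cube power2_eq_square)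
  also have "\<dots> \<le> 6 * (1/10000) * (7/2 * (10 * (1 - cos (x - x0))))"
    using \<epsilon>_small \<epsilon>_nonneg z_le[OF x] one_minus_cos_ge[OF z_le[OF x]]
    by (intro mult_mono) auto
  also have "\<dots> \<le> 1/20 * (99/100 * (1 - cos (x - x0)))" by simp
  also have "\<dots> \<le> 1/20 * (m * (1 - cos (x - x0)))"
    using m_numeric by (intro mult_left_mono mult_right_mono) auto
  finally have "\<bar>D0 x\<bar> \<le> 1/20 * (m * (1 - cos (x - x0)))" .
  then show "19/20 * (m * (1 - cos (x - x0))) \<le> M - f x" "M - f x \<le> 21/20 * (m * (1 - cos (x - x0)))"
    unfolding D0_def abs_le_iff by linarith+
qed

text \<open>For \<open>\<eta> \<ge> 1/2\<close> the term \<eta> alone dominates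
  \<open>(\<eta> + z^2) / 30\<close>; otherwise \<open>s\<close> is at least 50/101 and the
  quadratic growth of \<open>M - f\<close> takes over. One constant then covers all
  \<open>s\<close>, including \<open>s\<close> near 0 where the quadratic term disappears.\<close>

lemma denominators:
  assumes s: "s \<in> {0..<1/M}" and x: "x \<in> Ipi"
  defines "\<eta> \<equiv> 1 - s * M" and "z \<equiv> x - x0"
  shows "0 < \<eta>" "\<eta> \<le> 1"
    and "1 - s * f x = \<eta> + s * (M - f x)"
    and "(\<eta> + z\<^sup>2) / 30 \<le> 1 - s * f x"
    and "(\<eta> + z\<^sup>2) / 30 \<le> \<eta> + s * m * (1 - cos z)"
proof -
  have M: "M > 0" using M_numeric by simp
  show \<eta>: "0 < \<eta>" "\<eta> \<le> 1" using s M by (auto simp: \<eta>_def field_simps)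
  show eq: "1 - s * f x = \<eta> + s * (M - f x)" by (simp add: \<eta>_def algebra_simps)
  have s0: "s \<ge> 0" using s by simp
  have z: "z\<^sup>2 \<le> 49/4" using z_le[OF x] abs_le_square_iff[of z "7/2"] by (simp add: z_def power2_eq_square)
  have C: "z\<^sup>2 / 10 \<le> 1 - cos z" unfolding z_def by (rule one_minus_cos_ge[OF z_le[OF x]])
  have key: "(\<eta> + z\<^sup>2) / 30 \<le> \<eta> + s * (9/100 * z\<^sup>2)"
  proof (cases "\<eta> \<ge> 1/2")
    case True
    have "s * (9/100 * z\<^sup>2) \<ge> 0" using s0 by simp
    moreover have "(\<eta> + z\<^sup>2) / 30 \<le> 1/2" using \<eta>(2) z by simp
    ultimately show ?thesis using True by linarith
  next
    case False
    have "s * M \<ge> 1/2" using False by (simp add: \<eta>_def)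
    moreover have "s * M \<le> s * (101/100)" using M_numeric s0 by (intro mult_left_mono)
    ultimately have "s \<ge> 50/101" by simp
    then have "50/101 * (9/100 * z\<^sup>2) \<le> s * (9/100 * z\<^sup>2)" by (intro mult_right_mono) auto
    moreover have "z\<^sup>2 / 30 \<le> 50/101 * (9/100 * z\<^sup>2)" by simp
    moreover have "(\<eta> + z\<^sup>2) / 30 \<le> \<eta> + z\<^sup>2 / 30" using \<eta> by simp
    ultimately show ?thesis by (meson add_left_mono order_trans)
  qed
  have mc: "99/100 * (z\<^sup>2 / 10) \<le> m * (1 - cos z)" using m_numeric C by (intro mult_mono) auto
  then have "9/100 * z\<^sup>2 \<le> M - f x" using sandwich(1)[OF x] zero_le_power2[of z] unfolding z_def by linarith
  from mult_left_mono[OF this s0] show "(\<eta> + z\<^sup>2) / 30 \<le> 1 - s * f x"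
    using key unfolding eq by linarith
  have "9/100 * z\<^sup>2 \<le> m * (1 - cos z)" using mc zero_le_power2[of z] by linarith
  from mult_left_mono[OF this s0] show "(\<eta> + z\<^sup>2) / 30 \<le> \<eta> + s * m * (1 - cos z)"
    unfolding mult.assoc by (intro order_trans[OF key] add_left_mono)
qed

lemma f_cont: "continuous_on Ipi f"
  using f_deriv DERIV_continuous continuous_on_eq_continuous_within by blast

lemma G_pos: "s \<in> {0..<1/M} \<Longrightarrow> x \<in> Ipi \<Longrightarrow> 1 - s * f x > 0"
  using denominators(1,4)[of s x] by (smt (verit) divide_pos_pos zero_le_power2)

text \<open>By \<open>sandwich\<close>, \<open>1 - s * f\<close> lies between two model denominators
  whose integrals are explicit. The factors 19/10 and 21/10 are twice 19/20 and 21/20, from the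
  \<open>2 * c\<close> in \<open>integral_inverse_one_minus_cos\<close>.\<close>

lemma mass_bounds:
  assumes s: "s \<in> {0..<1/M}"
  defines "\<eta> \<equiv> 1 - s * M"
  shows "(mass f s)\<^sup>2 \<le> 1 / (\<eta> * (\<eta> + 19/10 * (s * m)))"
    and "1 / (\<eta> * (\<eta> + 21/10 * (s * m))) \<le> (mass f s)\<^sup>2" and "0 < mass f s"
proof -
  have \<eta>: "0 < \<eta>" "\<eta> \<le> 1" using denominators(1,2)[OF s x0] by (auto simp: \<eta>_def)
  have s0: "0 \<le> s" using s by simp
  have c: "s * m \<ge> 0" using s0 m_numeric by simp
  have int: "(\<lambda>x. 1 / (1 - s * f x)) integrable_on Ipi"
    using G_pos[OF s] f_cont unfolding Ipi_def
    by (intro integrable_continuous_real continuous_intros) force+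
  have intc: "(\<lambda>x. 1 / (\<eta> + c * (1 - cos (x - x0)))) integrable_on Ipi" if "c \<ge> 0" for c
    unfolding Ipi_def
    by (intro integrable_continuous_real continuous_intros) (use kern_denom_pos[OF \<eta>(1) that] in \<open>metis less_irrefl\<close>)
  have eqc: "\<eta> + k * (s * m) * (1 - cos (x - x0)) = \<eta> + s * (k * (m * (1 - cos (x - x0))))" for k x
    by simp
  have "integral Ipi (\<lambda>x. 1 / (1 - s * f x)) \<le> integral Ipi (\<lambda>x. 1 / (\<eta> + 19/20 * (s * m) * (1 - cos (x - x0))))"
  proof (rule integral_le[OF int intc])
    fix x assume x: "x \<in> Ipi"
    have "\<eta> + 19/20 * (s * m) * (1 - cos (x - x0)) \<le> 1 - s * f x"
      using mult_left_mono[OF sandwich(1)[OF x] s0] denominators(3)[OF s x]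
      unfolding eqc \<eta>_def by linarith
    then show "1 / (1 - s * f x) \<le> 1 / (\<eta> + 19/20 * (s * m) * (1 - cos (x - x0)))"
      using kern_denom_pos[OF \<eta>(1), of "19/20 * (s * m)" "x - x0"] c by (intro divide_left_mono) auto
  qed (use c in simp)
  then have up: "mass f s \<le> 1 / sqrt (\<eta> * (\<eta> + 19/10 * (s * m)))"
    using integral_inverse_one_minus_cos[OF \<eta>(1), of "19/20 * (s * m)" x0] c
    unfolding mass_def by (simp add: field_simps)
  have "integral Ipi (\<lambda>x. 1 / (\<eta> + 21/20 * (s * m) * (1 - cos (x - x0)))) \<le> integral Ipi (\<lambda>x. 1 / (1 - s * f x))"
  proof (rule integral_le[OF intc int])
    fix x assume x: "x \<in> Ipi"
    have "1 - s * f x \<le> \<eta> + 21/20 * (s * m) * (1 - cos (x - x0))"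
      using mult_left_mono[OF sandwich(2)[OF x] s0] denominators(3)[OF s x]
      unfolding eqc \<eta>_def by linarith
    then show "1 / (\<eta> + 21/20 * (s * m) * (1 - cos (x - x0))) \<le> 1 / (1 - s * f x)"
      using G_pos[OF s x] by (intro divide_left_mono mult_pos_pos) auto
  qed (use c in simp)
  then have lo: "1 / sqrt (\<eta> * (\<eta> + 21/10 * (s * m))) \<le> mass f s"
    using integral_inverse_one_minus_cos[OF \<eta>(1), of "21/20 * (s * m)" x0] c
    unfolding mass_def by (simp add: field_simps)
  have q: "\<eta> * (\<eta> + k * (s * m)) > 0" if "k \<ge> 0" for k
    using \<eta> c that by (intro mult_pos_pos add_pos_nonneg) auto
  have "0 < 1 / sqrt (\<eta> * (\<eta> + 21/10 * (s * m)))" using q[of "21/10"] by simp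
  then show pos: "0 < mass f s" using lo by linarith
  have "(mass f s)\<^sup>2 \<le> (1 / sqrt (\<eta> * (\<eta> + 19/10 * (s * m))))\<^sup>2" using up pos by (intro power_mono) auto
  also have "\<dots> = 1 / (\<eta> * (\<eta> + 19/10 * (s * m)))" using q[of "19/10"] by (simp only: power_divide real_sqrt_pow2 less_imp_le power_one)
  finally show "(mass f s)\<^sup>2 \<le> 1 / (\<eta> * (\<eta> + 19/10 * (s * m)))" .
  have "(1 / sqrt (\<eta> * (\<eta> + 21/10 * (s * m))))\<^sup>2 \<le> (mass f s)\<^sup>2" using lo q[of "21/10"] by (intro power_mono) auto
  moreover have "(1 / sqrt (\<eta> * (\<eta> + 21/10 * (s * m))))\<^sup>2 = 1 / (\<eta> * (\<eta> + 21/10 * (s * m)))"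
    using q[of "21/10"] by (simp only: power_divide real_sqrt_pow2 less_imp_le power_one)
  ultimately show "1 / (\<eta> * (\<eta> + 21/10 * (s * m))) \<le> (mass f s)\<^sup>2" by simp
qed

lemma sm_le: "s \<in> {0..<1/M} \<Longrightarrow> 0 \<le> s * m \<and> s * m \<le> 11/10 \<and> s \<le> 11/10"
proof -
  assume s: "s \<in> {0..<1/M}"
  have "1 / M \<le> 1 / (99/100)" using M_numeric by (intro divide_left_mono) auto
  then have "s \<le> 100/99" using s by simp
  moreover from this have "s * m \<le> 100/99 * (101/100)" using m_numeric s by (intro mult_mono) auto
  ultimately show ?thesis using s m_numeric by simp
qed

lemma mass_ge:
  assumes s: "s \<in> {0..<1/M}"
  shows "(1/4) / (1 - s * M) \<le> (mass f s)\<^sup>2"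
proof -
  define \<eta> where "\<eta> = 1 - s * M"
  have \<eta>: "0 < \<eta>" "\<eta> \<le> 1" using denominators(1,2)[OF s x0] by (auto simp: \<eta>_def)
  have "\<eta> + 21/10 * (s * m) \<le> 4" "0 < \<eta> + 21/10 * (s * m)" using sm_le[OF s] \<eta> by auto
  then have "1 / (\<eta> * 4) \<le> 1 / (\<eta> * (\<eta> + 21/10 * (s * m)))"
    using \<eta> by (intro divide_left_mono mult_left_mono mult_pos_pos) auto
  also have "\<dots> \<le> (mass f s)\<^sup>2" using mass_bounds(2)[OF s] by (simp only: \<eta>_def)
  finally show ?thesis by (simp add: \<eta>_def[symmetric] mult.commute)
qed

sublocale profile f f1 f2 f3 M "1/4"
  by unfold_locales (use f_deriv f1_deriv f2_deriv f3_cont M_numeric max f_mean mass_ge in \<open>auto simp: M_def\<close>)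

text \<open>For the exact cosine \<open>1 / P^2 = \<eta> * (2 - \<eta>)\<close>, so \<eta> has
  derivative \<open>- \<eta> * (2 - \<eta>)\<close> and \<open>\<eta> / (2 - \<eta>)\<close>, which
  starts at 1, equals \<open>exp (- 2 * t)\<close>. The perturbed \<eta> keeps at least 3/4 of this
  speed, hence the exponent 3/2; \<theta> compares the same quotient with that exponential.\<close>

lemma decay:
  assumes t: "t \<ge> 0"
  shows "1 - R t * M \<le> 2 * exp (- (3/2) * t)"
proof -
  define \<eta> where "\<eta> = (\<lambda>t. 1 - R t * M)"
  define \<theta> where "\<theta> = (\<lambda>t. \<eta> t / (2 - \<eta> t) - exp (- (3/2) * t))"
  have \<eta>: "0 < \<eta> t" "\<eta> t \<le> 1" if "t \<ge> 0" for t
    using S_margin[OF R_mem[OF that]] by (auto simp: \<eta>_def)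
  have d\<eta>: "(\<eta> has_real_derivative - (1 / (P (R t))\<^sup>2 * M)) (at t within {0..})" if "t \<ge> 0" for t
    unfolding \<eta>_def by (auto intro!: derivative_eq_intros R_deriv[OF that])
  define \<theta>' where "\<theta>' = (\<lambda>t. (- (1 / (P (R t))\<^sup>2 * M) * (2 - \<eta> t) - \<eta> t * (1 / (P (R t))\<^sup>2 * M)) / ((2 - \<eta> t) * (2 - \<eta> t)) + 3/2 * exp (- (3/2) * t))"
  have d\<theta>: "(\<theta> has_real_derivative \<theta>' t) (at t within {0..})" if "t \<ge> 0" for t
    unfolding \<theta>_def \<theta>'_def using \<eta>[OF that]
    by (auto intro!: derivative_eq_intros d\<eta>[OF that])
  have "\<theta> t \<le> 0"
  proof (rule gronwall_zero[OF t])
    show "(\<theta> has_real_derivative \<theta>' u) (at u within {0..t})" if "u \<in> {0..t}" for u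
      using d\<theta>[of u] that by (auto intro: has_field_derivative_subset)
    show "\<theta> 0 \<le> 0" by (simp add: \<theta>_def \<eta>_def R_zero)
    fix u assume "u \<in> {0..t}"
    then have u: "u \<ge> 0" by simp
    define e where "e = \<eta> u"
    have e: "0 < e" "e \<le> 1" using \<eta>[OF u] by (auto simp: e_def)
    define s where "s = R u"
    have s: "s \<in> S" unfolding s_def by (rule R_mem[OF u])
    have "(P s)\<^sup>2 \<le> 1 / (e * (e + 19/10 * (s * m)))"
      using mass_bounds(1)[of s] s by (simp add: S_def e_def \<eta>_def s_def)
    moreover have q: "0 < e * (e + 19/10 * (s * m))" 
      using e sm_le[of s] s by (intro mult_pos_pos add_pos_nonneg) (auto simp: S_def)
    moreover have "(P s)\<^sup>2 > 0" using P_pos[OF s] by simp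
    ultimately have 1: "e * (e + 19/10 * (s * m)) \<le> 1 / (P s)\<^sup>2"
      by (simp add: field_simps)
    have sM: "s * M = 1 - e" by (simp add: e_def \<eta>_def s_def)
    have "(e + 19/10 * (s * m)) * M = e * M + 19/10 * (m * (s * M))" by (simp add: algebra_simps)
    also have "\<dots> \<ge> e * (99/100) + 19/10 * (99/100 * (1 - e))"
      unfolding sM using m_numeric M_numeric e by (intro add_mono mult_left_mono mult_right_mono) auto
    finally have "(e + 19/10 * (s * m)) * M \<ge> e * (99/100) + 19/10 * (99/100 * (1 - e))" .
    moreover have "9/10 * (2 - e) \<le> e * (99/100) + 19/10 * (99/100 * (1 - e))" using e by (simp add: field_simps)
    ultimately have 2: "(e + 19/10 * (s * m)) * M \<ge> 9/10 * (2 - e)" by (rule order_trans[rotated])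
    have "3/4 * (e * (2 - e)) \<le> e * (9/10 * (2 - e))" using e by simp
    also have "\<dots> \<le> e * ((e + 19/10 * (s * m)) * M)" using 2 e by (intro mult_left_mono) auto
    also have "\<dots> \<le> 1 / (P s)\<^sup>2 * M" using mult_right_mono[OF 1, of M] M_pos by (simp add: mult.assoc)
    finally have 3: "3/4 * (e * (2 - e)) \<le> 1 / (P s)\<^sup>2 * M" .
    have "(- (1 / (P s)\<^sup>2 * M) * (2 - e) - e * (1 / (P s)\<^sup>2 * M)) / ((2 - e) * (2 - e))
      = - 2 * (1 / (P s)\<^sup>2 * M) / ((2 - e) * (2 - e))"
      by (rule arg_cong[where f = "\<lambda>r. r / ((2 - e) * (2 - e))"]) algebra
    also have "\<dots> \<le> - 2 * (3/4 * (e * (2 - e))) / ((2 - e) * (2 - e))"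
      using e by (intro divide_right_mono mult_left_mono_neg 3) auto
    also have "\<dots> = - (3/2) * (e / (2 - e))" using e by (simp add: divide_simps)
    finally have 4: "(- (1 / (P s)\<^sup>2 * M) * (2 - e) - e * (1 / (P s)\<^sup>2 * M)) / ((2 - e) * (2 - e)) \<le> - (3/2) * (e / (2 - e))" .
    have dist: "- (3/2) * (p - q) = - (3/2) * p + 3/2 * q" for p q :: real by algebra
    show "\<theta>' u \<le> - (3/2) * \<theta> u"
      unfolding \<theta>'_def \<theta>_def e_def[symmetric] s_def[symmetric] dist by (rule add_right_mono[OF 4])
  qed
  then have "\<eta> t \<le> exp (- (3/2) * t) * (2 - \<eta> t)"
    using \<eta>[OF t] by (simp add: \<theta>_def field_simps)
  also have "\<dots> \<le> exp (- (3/2) * t) * 2" using \<eta>[OF t] by (intro mult_left_mono) auto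
  finally show ?thesis by (simp add: \<eta>_def)
qed

end

section \<open>Convergence to the stationary solution\<close>

context near_cos begin

text \<open>\<open>Gh\<close> and \<open>k\<close> are the model counterparts of
  \<open>1 - s * f\<close> and \<open>J\<close>. \<open>N\<close>, up to the factor 30, bounds both
  denominators from below, and \<open>L\<close> bounds the integral of
  \<open>\<bar>x - x0\<bar> / N\<close>.\<close>

definition "eta s = 1 - s * M"
definition "N s x = eta s + (x - x0)\<^sup>2"
definition "Gh s x = eta s + s * m * (1 - cos (x - x0))"
definition "L s = 14 - ln (eta s)"
definition "k s x = kern (eta s) (s * m) (x - x0)"

lemma eta: "s \<in> S \<Longrightarrow> 0 < eta s" "s \<in> S \<Longrightarrow> eta s \<le> 1"
  using S_margin[of s] by (simp_all add: eta_def)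

lemma sm_nonneg: "s \<in> S \<Longrightarrow> 0 \<le> s * m"
  using sm_le[of s] by (simp add: S_def)

lemma L_ge: "s \<in> S \<Longrightarrow> 14 \<le> L s"
  using eta[of s] by (simp add: L_def)

lemma N_pos: "s \<in> S \<Longrightarrow> 0 < N s x" and N_ge: "s \<in> S \<Longrightarrow> (x - x0)\<^sup>2 \<le> N s x"
  using eta(1)[of s] by (simp_all add: N_def add_pos_nonneg)

lemma denom_ge:
  assumes "s \<in> S" "x \<in> Ipi"
  shows "N s x / 30 \<le> 1 - s * f x" "N s x / 30 \<le> Gh s x" "0 < Gh s x"
proof -
  have s: "s \<in> {0..<1/M}" using assms(1) by (simp only: S_def)
  show "N s x / 30 \<le> 1 - s * f x" "N s x / 30 \<le> Gh s x"
    using denominators(4,5)[OF s assms(2)] by (simp_all only: N_def Gh_def eta_def)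
  moreover have "0 < N s x / 30" using N_pos[OF assms(1)] by simp
  ultimately show "0 < Gh s x" by linarith
qed

lemma sqrt_kern_le:
  assumes s: "s \<in> S"
  shows "sqrt (eta s * (eta s + 2 * (s * m))) \<le> 2 * sqrt (eta s)"
    and "0 < sqrt (eta s * (eta s + 2 * (s * m)))"
proof -
  have "eta s * (eta s + 2 * (s * m)) \<le> eta s * 4"
    using eta[OF s] sm_le[of s] s by (intro mult_left_mono) (auto simp: S_def)
  then have "sqrt (eta s * (eta s + 2 * (s * m))) \<le> sqrt (eta s * 4)" by simp
  then show "sqrt (eta s * (eta s + 2 * (s * m))) \<le> 2 * sqrt (eta s)"
    by (simp add: real_sqrt_mult)
  have "0 < eta s * (eta s + 2 * (s * m))"
    using eta[OF s] sm_nonneg[OF s] by (intro mult_pos_pos add_pos_nonneg) auto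
  then show "0 < sqrt (eta s * (eta s + 2 * (s * m)))" by simp
qed

text \<open>\<open>mass_ge\<close> inverted; this supplies the decaying factor
  \<open>sqrt (eta s)\<close> in the errors of the Jacobian.\<close>

lemma inverse_P_le:
  assumes s: "s \<in> S"
  shows "1 / P s \<le> 2 * sqrt (eta s)"
proof -
  have q: "sqrt (eta s) > 0" using eta[OF s] by simp
  have "(1 / (2 * sqrt (eta s)))\<^sup>2 = 1 / 4 / eta s"
    using eta[OF s] by (simp add: power_divide power_mult_distrib)
  also have "\<dots> \<le> (P s)\<^sup>2" using mass_ge[of s] s by (simp add: S_def eta_def)
  finally have "1 / (2 * sqrt (eta s)) \<le> P s"
    by (rule power2_le_imp_le) (rule less_imp_le[OF P_pos[OF s]])
  from le_imp_inverse_le[OF this] q show ?thesis by (simp add: inverse_eq_divide)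
qed

text \<open>The difference of the denominators is \<open>s * D0 x\<close>, cubic in the distance
  from \<open>x0\<close>. Over the product of the denominators, of order \<open>N^2\<close>, one
  quadratic factor cancels against \<open>N\<close>; the remaining
  \<open>\<bar>x - x0\<bar> / N\<close> costs only a logarithm on integration. The constant is
  \<open>7 * 30^2\<close>.\<close>

lemma inverse_diff:
  assumes s: "s \<in> S" and x: "x \<in> Ipi"
  shows "\<bar>1 / (1 - s * f x) - 1 / Gh s x\<bar> \<le> 6300 * \<epsilon> * (\<bar>x - x0\<bar> / N s x)"
proof -
  define a b n z where "a = 1 - s * f x" and "b = Gh s x" and "n = N s x" and "z = \<bar>x - x0\<bar>"
  have n: "n > 0" "z * z \<le> n" "z \<ge> 0"
    using N_pos[OF s] N_ge[OF s, of x] by (auto simp: n_def z_def power2_eq_square)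
  have ab: "n / 30 \<le> a" "n / 30 \<le> b" using denom_ge[OF s x] by (auto simp: a_def b_def n_def)
  have pos: "a > 0" "b > 0" using ab n by (auto intro: less_le_trans[of 0 "n / 30"])
  have s': "s \<in> {0..<1/M}" using s by (simp add: S_def)
  have "a - b = s * D0 x"
    using denominators(3)[OF s' x] by (simp add: a_def b_def Gh_def eta_def D0_def algebra_simps)
  then have "\<bar>a - b\<bar> = s * \<bar>D0 x\<bar>" using s' by (simp add: abs_mult)
  also have "\<dots> \<le> 11/10 * (6 * \<epsilon> * z ^ 3)"
    using sm_le[OF s'] D_bounds(2)[OF x] s' unfolding z_def by (intro mult_mono) auto
  also have "\<dots> \<le> 7 * \<epsilon> * z ^ 3" using \<epsilon>_nonneg n by (simp add: mult_right_mono)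
  finally have 1: "\<bar>a - b\<bar> \<le> 7 * \<epsilon> * z ^ 3" .
  have "\<bar>1 / a - 1 / b\<bar> = \<bar>a - b\<bar> / (a * b)"
  proof -
    have "1 / a - 1 / b = (b - a) / (a * b)" using pos by (simp add: field_simps)
    then show ?thesis using pos by (simp add: abs_mult abs_minus_commute)
  qed
  also have "\<dots> \<le> (7 * \<epsilon> * z ^ 3) / ((n / 30) * (n / 30))"
    using 1 ab n pos by (intro frac_le mult_mono) auto
  also have "\<dots> = 6300 * \<epsilon> * (z / n) * ((z * z) / n)"
    using n by (simp add: power3_eq_cube)
  also have "\<dots> \<le> 6300 * \<epsilon> * (z / n) * 1"
    using n \<epsilon>_nonneg by (intro mult_left_mono) auto
  finally show ?thesis by (simp add: a_def b_def n_def z_def)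
qed

lemma integral_quadratic:
  assumes s: "s \<in> S"
  shows "(\<lambda>x. \<bar>x - x0\<bar> / N s x) integrable_on Ipi" "integral Ipi (\<lambda>x. \<bar>x - x0\<bar> / N s x) \<le> L s"
  using integral_abs_over_quadratic[OF eta[OF s] x0 z_le] by (simp_all add: N_def L_def)

lemma inverse_Gh_eq:
  assumes s: "s \<in> S" and x: "x \<in> Ipi"
  shows "1 / Gh s x = k s x / sqrt (eta s * (eta s + 2 * (s * m)))"
proof -
  have alg: "1 / g = (p / g) / p" if "p > 0" for p g :: real using that by simp
  have "k s x = sqrt (eta s * (eta s + 2 * (s * m))) / Gh s x"
    by (simp add: k_def kern_def Gh_def)
  then show ?thesis using alg[OF sqrt_kern_le(2)[OF s], of "Gh s x"] by simp
qed

lemma k_pos: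
  assumes s: "s \<in> S"
  shows "k s x \<ge> 0"
  unfolding k_def kern_def using kern_denom_pos[OF eta(1)[OF s] sm_nonneg[OF s]] sqrt_kern_le(2)[OF s]
  by (intro divide_nonneg_pos less_imp_le)

lemma k_integral: "s \<in> S \<Longrightarrow> (k s has_integral 2 * pi) Ipi"
  using kern_integral[OF eta(1) sm_nonneg] by (simp add: k_def[abs_def])

lemma P_diff:
  assumes s: "s \<in> S"
  shows "\<bar>P s - 1 / sqrt (eta s * (eta s + 2 * (s * m)))\<bar> \<le> 1600 * \<epsilon> * L s"
proof -
  define p where "p = sqrt (eta s * (eta s + 2 * (s * m)))"
  have i1: "(\<lambda>x. 1 / (1 - s * f x)) integrable_on Ipi" by (rule f_integrable(1)[OF s])
  have i2: "((\<lambda>x. 1 / Gh s x) has_integral (2 * pi) / p) Ipi"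
    using has_integral_eq[OF _ has_integral_divide[OF k_integral[OF s], of p]] inverse_Gh_eq[OF s]
    unfolding p_def by simp
  have "P s - 1 / p = (integral Ipi (\<lambda>x. 1 / (1 - s * f x)) - integral Ipi (\<lambda>x. 1 / Gh s x)) / (2 * pi)"
    using integral_unique[OF i2] by (simp add: mass_def diff_divide_distrib)
  also have "\<dots> = integral Ipi (\<lambda>x. 1 / (1 - s * f x) - 1 / Gh s x) / (2 * pi)"
    using i1 i2 by (subst integral_diff) auto
  finally have eq: "\<bar>P s - 1 / p\<bar> = \<bar>integral Ipi (\<lambda>x. 1 / (1 - s * f x) - 1 / Gh s x)\<bar> / (2 * pi)"
    by (simp add: abs_divide)
  have "\<bar>integral Ipi (\<lambda>x. 1 / (1 - s * f x) - 1 / Gh s x)\<bar> \<le> integral Ipi (\<lambda>x. 6300 * \<epsilon> * (\<bar>x - x0\<bar> / N s x))"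
    unfolding real_norm_def[symmetric]
  proof (rule integral_norm_bound_integral)
    show "(\<lambda>x. 1 / (1 - s * f x) - 1 / Gh s x) integrable_on Ipi"
      using i1 i2 by (intro integrable_diff) blast+
    show "(\<lambda>x. 6300 * \<epsilon> * (norm (x - x0) / N s x)) integrable_on Ipi"
      unfolding real_norm_def by (intro integrable_on_mult_right integral_quadratic(1)[OF s])
    show "norm (1 / (1 - s * f x) - 1 / Gh s x) \<le> 6300 * \<epsilon> * (norm (x - x0) / N s x)" if "x \<in> Ipi" for x
      unfolding real_norm_def by (rule inverse_diff[OF s that])
  qed
  also have "\<dots> \<le> 6300 * \<epsilon> * L s"
    unfolding integral_mult_right using integral_quadratic(2)[OF s] \<epsilon>_nonneg by (intro mult_left_mono) auto
  \<comment> \<open>Uses \<open>2 * pi \<ge> 4\<close> and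
    \<open>6300 \<le> 1600 * 4\<close>.\<close>
  also have "\<dots> \<le> 1600 * \<epsilon> * L s * (2 * pi)"
  proof -
    have "1600 * (\<epsilon> * L s) * 4 \<le> 1600 * (\<epsilon> * L s) * (2 * pi)"
      using pi_ge_two \<epsilon>_nonneg L_ge[OF s] by (intro mult_left_mono) auto
    moreover have "0 \<le> \<epsilon> * L s" using \<epsilon>_nonneg L_ge[OF s] by simp
    ultimately show ?thesis by (simp add: mult.assoc)
  qed
  finally show ?thesis
    unfolding p_def[symmetric] eq by (simp add: divide_le_eq)
qed

text \<open>Each Jacobian is a normalization times a reciprocal denominator. The error of the
  denominator contributes directly, that of the normalization is weighted by
  \<open>k\<close>.\<close>

lemma J_diff:
  assumes s: "s \<in> S" and x: "x \<in> Ipi"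
  shows "\<bar>J s x - k s x\<bar> \<le> 1 / P s * (6300 * \<epsilon> * (\<bar>x - x0\<bar> / N s x) + 1600 * \<epsilon> * L s * k s x)"
proof -
  define p where "p = sqrt (eta s * (eta s + 2 * (s * m)))"
  have p: "p > 0" unfolding p_def by (rule sqrt_kern_le(2)[OF s])
  have kp: "1 / Gh s x = k s x / p" unfolding p_def by (rule inverse_Gh_eq[OF s x])
  have J: "J s x = 1 / P s * (1 / (1 - s * f x))" by (simp add: J_def)
  have "J s x - k s x = 1 / P s * ((1 / (1 - s * f x) - 1 / Gh s x) - (P s - 1 / p) * k s x)"
  proof -
    have alg: "1 / q * h - l = 1 / q * ((h - l / p) - (q - 1 / p) * l)" if "q > 0" for q h l :: real
      using that p by (simp add: field_simps)
    show ?thesis unfolding J kp by (rule alg[OF P_pos[OF s]])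
  qed
  then have "\<bar>J s x - k s x\<bar> = 1 / P s * \<bar>(1 / (1 - s * f x) - 1 / Gh s x) - (P s - 1 / p) * k s x\<bar>"
    using P_pos[OF s] by (simp add: abs_mult)
  also have "\<dots> \<le> 1 / P s * (\<bar>1 / (1 - s * f x) - 1 / Gh s x\<bar> + \<bar>P s - 1 / p\<bar> * k s x)"
    using P_pos[OF s] k_pos[OF s, of x] abs_triangle_ineq4[of "1 / (1 - s * f x) - 1 / Gh s x" "(P s - 1 / p) * k s x"]
    by (intro mult_left_mono) (auto simp: abs_mult)
  also have "\<dots> \<le> 1 / P s * (6300 * \<epsilon> * (\<bar>x - x0\<bar> / N s x) + 1600 * \<epsilon> * L s * k s x)"
    using P_pos[OF s] k_pos[OF s, of x] inverse_diff[OF s x] P_diff[OF s]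
    by (intro mult_left_mono add_mono mult_right_mono) (auto simp: p_def)
  finally show ?thesis .
qed

lemma k_le:
  assumes s: "s \<in> S" and x: "N s x / 30 \<le> Gh s x"
  shows "k s x \<le> 60 * (sqrt (eta s) / N s x)"
proof -
  have "k s x = sqrt (eta s * (eta s + 2 * (s * m))) / Gh s x"
    by (simp add: k_def kern_def Gh_def)
  also have "\<dots> \<le> (2 * sqrt (eta s)) / (N s x / 30)"
    using x N_pos[OF s, of x] sqrt_kern_le[OF s] eta(1)[OF s] by (intro frac_le) auto
  finally show ?thesis by simp
qed

lemma sqrt_eta_z:
  assumes s: "s \<in> S"
  shows "\<bar>x - x0\<bar> * sqrt (eta s) / N s x \<le> 1 / 2"
proof -
  have "0 \<le> (\<bar>x - x0\<bar> - sqrt (eta s))\<^sup>2" by simp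
  then have "2 * (\<bar>x - x0\<bar> * sqrt (eta s)) \<le> N s x"
    using eta(1)[OF s] by (simp add: power2_diff N_def)
  then show ?thesis using N_pos[OF s, of x] by (simp add: divide_le_eq)
qed

text \<open>At \<open>x0\<close> the kernel is of order \<open>1 / sqrt (eta s)\<close>, and
  \<open>J_diff\<close> gives only a bound of order \<open>\<epsilon> * L s\<close>, which does not
  decay. The weight \<open>\<bar>x - x0\<bar>\<close>, later supplied by a sine, keeps
  \<open>\<bar>x - x0\<bar> * k\<close> bounded and so preserves the factor
  \<open>1 / P\<close>.\<close>

lemma z_J_diff:
  assumes s: "s \<in> S" and x: "x \<in> Ipi"
  shows "\<bar>x - x0\<bar> * \<bar>J s x - k s x\<bar> \<le> 98000 * (\<epsilon> * (sqrt (eta s) * L s))"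
proof -
  define z n l where "z = \<bar>x - x0\<bar>" and "n = N s x" and "l = L s"
  have l: "l \<ge> 14" unfolding l_def by (rule L_ge[OF s])
  have n: "n > 0" "z\<^sup>2 \<le> n" using N_pos[OF s] N_ge[OF s, of x] by (auto simp: n_def z_def)
  have "z * k s x \<le> z * (60 * (sqrt (eta s) / n))"
    unfolding n_def z_def by (intro mult_left_mono k_le[OF s] denom_ge[OF s x]) auto
  also have "\<dots> = 60 * (z * sqrt (eta s) / n)" by simp
  also have "\<dots> \<le> 30" using sqrt_eta_z[OF s, of x] by (simp add: z_def n_def)
  finally have zk: "z * k s x \<le> 30" .
  have zn: "z * (z / n) \<le> 1" using n by (simp add: power2_eq_square)
  have "z * \<bar>J s x - k s x\<bar> \<le> z * (1 / P s * (6300 * \<epsilon> * (z / n) + 1600 * \<epsilon> * l * k s x))"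
    using J_diff[OF s x] unfolding z_def n_def l_def by (intro mult_left_mono) auto
  also have "\<dots> = 1 / P s * (6300 * \<epsilon> * (z * (z / n)) + 1600 * \<epsilon> * l * (z * k s x))"
    by (simp add: algebra_simps)
  also have "\<dots> \<le> 1 / P s * (6300 * \<epsilon> * 1 + 1600 * \<epsilon> * l * 30)"
    using zk zn P_pos[OF s] \<epsilon>_nonneg l by (intro mult_left_mono add_mono) auto
  also have "\<dots> \<le> 1 / P s * (49000 * (\<epsilon> * l))"
  proof (rule mult_left_mono)
    have "\<epsilon> * 14 \<le> \<epsilon> * l" using l \<epsilon>_nonneg by (intro mult_left_mono)
    then show "6300 * \<epsilon> * 1 + 1600 * \<epsilon> * l * 30 \<le> 49000 * (\<epsilon> * l)" using \<epsilon>_nonneg by simp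
  qed (use P_pos[OF s] in simp)
  also have "\<dots> \<le> 2 * sqrt (eta s) * (49000 * (\<epsilon> * l))"
    using inverse_P_le[OF s] \<epsilon>_nonneg l by (intro mult_right_mono) auto
  finally show ?thesis by (simp add: z_def l_def mult_ac)
qed

lemma k_cont: "s \<in> S \<Longrightarrow> continuous_on A (k s)"
  using kern_cont[OF eta(1) sm_nonneg] by (simp add: k_def[abs_def])

text \<open>Displacement between the two flows. Unlike the pointwise bound it needs no weight, since
  \<open>k\<close> has integral \<open>2 * pi\<close> however concentrated it is.\<close>

lemma integral_J_diff:
  assumes s: "s \<in> S" and x: "x \<in> Ipi"
  shows "\<bar>integral {-pi..x} (J s) - integral {-pi..x} (k s)\<bar> \<le> 34000 * (\<epsilon> * (sqrt (eta s) * L s))"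
proof -
  define b where "b = (\<lambda>x. 1 / P s * (6300 * \<epsilon> * (\<bar>x - x0\<bar> / N s x) + 1600 * \<epsilon> * L s * k s x))"
  have sub: "{-pi..x} \<subseteq> Ipi" using x by (auto simp: Ipi_def)
  have l: "L s \<ge> 14" by (rule L_ge[OF s])
  have Jc: "continuous_on {-pi..x} (J s)"
    using continuous_on_slice[OF J_cont s] sub continuous_on_subset by blast
  have ib: "b integrable_on Ipi"
    unfolding b_def using k_integral[OF s]
    by (intro integrable_on_mult_right integrable_add integral_quadratic(1)[OF s]) blast
  have ib': "b integrable_on {-pi..x}"
    using integrable_on_subinterval[OF ib[unfolded Ipi_def]] sub by (simp add: Ipi_def)
  have "integral {-pi..x} (J s) - integral {-pi..x} (k s) = integral {-pi..x} (\<lambda>x. J s x - k s x)"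
    by (intro integral_diff[symmetric] integrable_continuous_real Jc k_cont[OF s])
  also have "\<bar>\<dots>\<bar> \<le> integral {-pi..x} b"
    unfolding real_norm_def[symmetric]
  proof (rule integral_norm_bound_integral[OF _ ib'])
    show "(\<lambda>x. J s x - k s x) integrable_on {-pi..x}"
      by (intro integrable_continuous_real continuous_intros Jc k_cont[OF s])
    show "norm (J s v - k s v) \<le> b v" if "v \<in> {-pi..x}" for v
      unfolding real_norm_def b_def using sub that by (intro J_diff[OF s]) blast
  qed
  also have "\<dots> \<le> integral Ipi b"
    using P_pos[OF s] \<epsilon>_nonneg l k_pos[OF s] N_pos[OF s] 
    by (intro integral_subset_le sub ib ib') (auto simp: b_def less_imp_le intro!: add_nonneg_nonneg mult_nonneg_nonneg divide_nonneg_nonneg)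
  also have "\<dots> = 1 / P s * (6300 * \<epsilon> * integral Ipi (\<lambda>x. \<bar>x - x0\<bar> / N s x) + 1600 * \<epsilon> * L s * (2 * pi))"
  proof -
    have "((\<lambda>x. 6300 * \<epsilon> * (\<bar>x - x0\<bar> / N s x)) has_integral 6300 * \<epsilon> * integral Ipi (\<lambda>x. \<bar>x - x0\<bar> / N s x)) Ipi"
      by (intro has_integral_mult_right integrable_integral integral_quadratic(1)[OF s])
    from has_integral_mult_right[OF has_integral_add[OF this has_integral_mult_right[OF k_integral[OF s]]]]
    show ?thesis unfolding b_def by (rule integral_unique)
  qed
  also have "\<dots> \<le> 1 / P s * (6300 * \<epsilon> * L s + 1600 * \<epsilon> * L s * (32/5))"
    using P_pos[OF s] \<epsilon>_nonneg l integral_quadratic(2)[OF s] pi_less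
    by (intro mult_left_mono add_mono) auto
  also have "\<dots> \<le> 1 / P s * (17000 * (\<epsilon> * L s))"
    using P_pos[OF s] \<epsilon>_nonneg l by (intro mult_left_mono) (auto simp: mult.assoc)
  also have "\<dots> \<le> 2 * sqrt (eta s) * (17000 * (\<epsilon> * L s))"
    using inverse_P_le[OF s] \<epsilon>_nonneg l by (intro mult_right_mono) auto
  finally show ?thesis by (simp add: mult_ac)
qed

text \<open>For the model, \<open>f1\<close> is \<open>- m * sin (x - x0)\<close>, and the identity
  for \<open>sin (\<Xi> z)\<close> makes the sum vanish. Three errors remain: \<open>D1\<close> in
  place of 0, \<open>J\<close> in place of \<open>k\<close>, and \<open>X s x\<close> in place of
  \<open>\<Xi> (x - x0)\<close>.\<close>

lemma slope_bound:
  assumes s: "s \<in> S" and x: "x \<in> Ipi"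
  shows "\<bar>f1 x * J s x + m * sin (X s x)\<bar> \<le> 150000 * (\<epsilon> * (sqrt (eta s) * L s))"
proof -
  define e where "e = \<epsilon> * (sqrt (eta s) * L s)"
  have l: "L s \<ge> 14" by (rule L_ge[OF s])
  have q: "sqrt (eta s) \<ge> 0" using eta(1)[OF s] by simp
  have small: "\<epsilon> * sqrt (eta s) \<le> e / 14"
    using mult_left_mono[OF l, of "\<epsilon> * sqrt (eta s)"] \<epsilon>_nonneg q by (simp add: e_def mult_ac)
  have e0: "e \<ge> 0" using \<epsilon>_nonneg q l by (simp add: e_def)
  obtain \<Xi> where \<Xi>: "\<And>z. (\<Xi> has_real_derivative kern (eta s) (s * m) z) (at z)"
    "\<And>z. sin (\<Xi> z) = sin z * kern (eta s) (s * m) z" "\<Xi> (-pi) = -pi"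
    using kern_primitive[OF eta(1)[OF s] sm_nonneg[OF s]] by metis
  have d\<Xi>: "((\<lambda>x. \<Xi> (x - x0)) has_real_derivative k s x) (at x within A)" for x A
  proof -
    have "((\<lambda>x. \<Xi> (x - x0)) has_real_derivative k s x * 1) (at x within A)"
      unfolding k_def by (rule DERIV_chain2[OF \<Xi>(1)]) (auto intro!: derivative_eq_intros)
    then show ?thesis by simp
  qed
  have "(k s has_integral \<Xi> (x - x0) - \<Xi> (-pi - x0)) {-pi..x}"
    using x d\<Xi> by (intro fundamental_theorem_of_calculus)
      (auto simp: has_real_derivative_iff_has_vector_derivative)
  then have Xk: "X s x - \<Xi> (x - x0) = (integral {-pi..x} (J s) - integral {-pi..x} (k s)) - (\<Xi> (-pi - x0) - \<Xi> (-pi))"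
    by (simp add: X_def integral_unique \<Xi>(3))
  \<comment> \<open>\<open>X s\<close> fixes \<open>-pi\<close>, whereas the model flow centred at
    \<open>x0\<close> does so only up to this term. The relevant arguments stay away from 0, where
    the kernel concentrates, so there it is of order \<open>sqrt (eta s)\<close>; the shift
    contributes the factor \<epsilon>.\<close>
  have end': "\<bar>\<Xi> (-pi - x0) - \<Xi> (-pi)\<bar> \<le> 3 * e"
  proof -
    let ?A = "{- pi - \<bar>x0\<bar> .. - pi + \<bar>x0\<bar>}"
    have d: "(\<Xi> has_real_derivative kern (eta s) (s * m) z) (at z within ?A)" for z
      using \<Xi>(1) by (rule has_field_derivative_at_within)
    have mem: "-pi - x0 \<in> ?A" "-pi \<in> ?A" and cA: "convex ?A"
      using abs_ge_self[of x0] abs_ge_minus_self[of x0] by (auto simp: convex_real_interval)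
    obtain z where z: "z \<in> ?A" "\<Xi> (-pi - x0) - \<Xi> (-pi) = kern (eta s) (s * m) z * ((-pi - x0) - (-pi))"
      by (rule DERIV_mvt[OF d cA mem])
    have "\<bar>x0\<bar> \<le> 1/5000" using x0_small \<epsilon>_small by linarith
    then have "-7/2 \<le> z" "z \<le> -19/10" using z(1) pi_less pi_ge_two by auto
    then have zb: "\<bar>z\<bar> \<le> 7/2" "\<bar>z\<bar> \<ge> 19/10" by auto
    have z2: "z\<^sup>2 \<ge> 3"
      using power_mono[OF zb(2), of 2] by (simp add: power2_eq_square)
    have "1/10 \<le> eta s + s * m * (1 - cos z)"
    proof (cases "eta s \<ge> 1/10")
      case True
      then show ?thesis using mult_nonneg_nonneg[OF sm_nonneg[OF s], of "1 - cos z"] by simp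
    next
      case False
      have "s * M \<le> s * (101/100)" using M_numeric s by (intro mult_left_mono) (auto simp: S_def)
      then have "s \<ge> 8/10" using False by (simp add: eta_def)
      then have sm: "8/10 * (99/100) \<le> s * m" using m_numeric by (intro mult_mono) auto
      have cz: "3/10 \<le> 1 - cos z" using one_minus_cos_ge[OF zb(1)] z2 by simp
      have "(8/10 * (99/100)) * (3/10) \<le> s * m * (1 - cos z)"
        by (rule mult_mono[OF sm cz]) (use sm_nonneg[OF s] in auto)
      then show ?thesis using eta(1)[OF s] by simp
    qed
    then have "kern (eta s) (s * m) z \<le> (2 * sqrt (eta s)) / (1/10)"
      unfolding kern_def using sqrt_kern_le[OF s] eta(1)[OF s] by (intro frac_le) auto
    moreover have "kern (eta s) (s * m) z \<ge> 0"
      unfolding kern_def using kern_denom_pos[OF eta(1)[OF s] sm_nonneg[OF s], of z] sqrt_kern_le(2)[OF s] by simp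
    ultimately have "\<bar>\<Xi> (-pi - x0) - \<Xi> (-pi)\<bar> \<le> 20 * sqrt (eta s) * (2 * \<epsilon>)"
      unfolding z(2) abs_mult using x0_small eta(1)[OF s] by (intro mult_mono) auto
    then show ?thesis using small e0 by (simp add: mult.commute[of _ \<epsilon>])
  qed
  have X\<Xi>: "\<bar>X s x - \<Xi> (x - x0)\<bar> \<le> 34003 * e"
    using integral_J_diff[OF s x] end' unfolding Xk e_def by linarith
  have t1: "\<bar>D1 x * J s x\<bar> \<le> 26 * e"
  proof -
    have "N s x / 30 \<le> 1 - s * f x" by (rule denom_ge(1)[OF s x])
    then have "1 / (1 - s * f x) \<le> 1 / (N s x / 30)" using N_pos[OF s, of x] by (intro divide_left_mono mult_pos_pos) auto
    then have "(1 / P s) * (1 / (1 - s * f x)) \<le> 2 * sqrt (eta s) * (30 / N s x)"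
      using inverse_P_le[OF s] P_pos[OF s] G_pos[of s x] s x q N_pos[OF s, of x]
      by (intro mult_mono) (auto simp: S_def)
    then have J: "\<bar>J s x\<bar> \<le> 60 * (sqrt (eta s) / N s x)"
      using J_pos[OF s x] by (simp add: J_def)
    have "\<bar>D1 x * J s x\<bar> \<le> (6 * \<epsilon> * (x - x0)\<^sup>2) * (60 * (sqrt (eta s) / N s x))"
      unfolding abs_mult using D_bounds(1)[OF x] J \<epsilon>_nonneg by (intro mult_mono) auto
    also have "\<dots> = 360 * (\<epsilon> * sqrt (eta s)) * ((x - x0)\<^sup>2 / N s x)" by simp
    also have "\<dots> \<le> 360 * (\<epsilon> * sqrt (eta s)) * 1"
      using N_pos[OF s, of x] N_ge[OF s, of x] \<epsilon>_nonneg q by (intro mult_left_mono) auto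
    finally show ?thesis using small by simp
  qed
  have t2: "\<bar>m * (sin (x - x0) * (J s x - k s x))\<bar> \<le> 101/100 * (98000 * e)"
  proof -
    have "\<bar>sin (x - x0)\<bar> * \<bar>J s x - k s x\<bar> \<le> \<bar>x - x0\<bar> * \<bar>J s x - k s x\<bar>"
      by (intro mult_right_mono abs_sin_x_le_abs_x) auto
    also have "\<dots> \<le> 98000 * e" using z_J_diff[OF s x] by (simp add: e_def)
    finally have "\<bar>sin (x - x0) * (J s x - k s x)\<bar> \<le> 98000 * e" by (simp only: abs_mult)
    then show ?thesis unfolding abs_mult[of m] using m_numeric by (intro mult_mono) auto
  qed
  have t3: "\<bar>m * (sin (X s x) - sin (\<Xi> (x - x0)))\<bar> \<le> 101/100 * (34003 * e)"
    unfolding abs_mult using m_numeric order_trans[OF abs_sin_diff_le X\<Xi>] by (intro mult_mono) auto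
  have "f1 x * J s x + m * sin (X s x)
    = - (D1 x * J s x) - m * (sin (x - x0) * (J s x - k s x)) + m * (sin (X s x) - sin (\<Xi> (x - x0)))"
    unfolding \<Xi>(2) k_def D1_def by (simp add: algebra_simps)
  then have "\<bar>f1 x * J s x + m * sin (X s x)\<bar> \<le> 26 * e + 101/100 * (98000 * e) + 101/100 * (34003 * e)"
    using t1 t2 t3 by linarith
  then show ?thesis using e0 unfolding e_def[symmetric] by linarith
qed

text \<open>Since \<open>\<eta> \<le> 2 exp (- 3 t / 2)\<close>, a bound of order \<open>\<eta> powr (1/3)\<close> suffices, which leaves
  \<open>\<eta> powr (1/6)\<close> to absorb the logarithm.\<close>

lemma slope_decay:
  assumes t: "t \<ge> 0" and y: "y \<in> Ipi"
  shows "\<bar>dI 1 (sol t) y + m * sin y\<bar> \<le> 6000000 * (\<epsilon> * exp (- t / 2))"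
proof -
  define s where "s = R t"
  have s: "s \<in> S" unfolding s_def by (rule R_mem[OF t])
  define h where "h = eta s"
  have h: "0 < h" "h \<le> 1" using eta[OF s] by (auto simp: h_def)
  have hd: "h \<le> 2 * exp (- (3/2) * t)" using decay[OF t] by (simp add: h_def eta_def s_def)
  have "ln (1 / h) \<le> (1 / h) powr (1/6) / (1/6)" using h by (intro ln_powr_bound) auto
  then have "L s \<le> 14 + 6 * h powr (- 1/6)"
    using h by (simp add: L_def h_def[symmetric] ln_div powr_minus powr_divide field_simps)
  also have "\<dots> \<le> 20 * h powr (- 1/6)"
    using h powr_mono'[of "- 1/6" 0 h] by simp
  finally have "sqrt h * L s \<le> h powr (1/2) * (20 * h powr (- 1/6))"
    using h by (simp add: powr_half_sqrt mult_left_mono)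
  also have "\<dots> = 20 * h powr (1/3)"
    using h by (simp add: powr_add[symmetric])
  also have "\<dots> \<le> 20 * (2 * exp (- (3/2) * t)) powr (1/3)"
    using hd h by (intro mult_left_mono powr_mono2) auto
  also have "\<dots> = 20 * (2 powr (1/3) * exp (- t / 2))"
    by (simp add: powr_mult exp_powr_real)
  also have "\<dots> \<le> 20 * (2 * exp (- t / 2))"
    using powr_mono[of "1/3" 1 "2::real"] by (intro mult_left_mono mult_right_mono) auto
  finally have bnd: "sqrt (eta s) * L s \<le> 40 * exp (- t / 2)" by (simp add: h_def)
  define x where "x = Y s y"
  have x: "x \<in> Ipi" unfolding x_def by (rule Y_mem[OF s y])
  have "dI 1 (sol t) y = f1 x * J s x"
    using dI_sol[OF t _ y, of 1] by (simp add: x_def s_def J_eq del: dI.simps)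
  moreover have "X s x = y" unfolding x_def by (rule X_Y[OF s y])
  ultimately have "\<bar>dI 1 (sol t) y + m * sin y\<bar> \<le> 150000 * (\<epsilon> * (sqrt (eta s) * L s))"
    using slope_bound[OF s x] by (simp del: dI.simps)
  also have "\<dots> \<le> 150000 * (\<epsilon> * (40 * exp (- t / 2)))"
    using bnd \<epsilon>_nonneg by (intro mult_left_mono) auto
  finally show ?thesis by simp
qed

text \<open>\<open>sol t - m cos\<close> has mean zero, hence a zero, so the bound on its derivative bounds it as well.\<close>

lemma sol_decay:
  assumes t: "t \<ge> 0" and y: "y \<in> Ipi"
  shows "\<bar>sol t y - m * cos y\<bar> \<le> 40000000 * (\<epsilon> * exp (- t / 2))"
proof -
  define d where "d = (\<lambda>y. sol t y - m * cos y)"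
  have Ck: "Ck_on 3 (sol t)" and mean: "integral Ipi (sol t) = 0"
    using PJ_sol t by (auto simp: PJ_sol_def)
  have dd: "(d has_real_derivative dI 1 (sol t) y + m * sin y) (at y within Ipi)" if "y \<in> Ipi" for y
    using Ck_on_deriv[OF Ck, of 0 y] that unfolding d_def has_real_derivative_iff_has_vector_derivative[symmetric]
    by (auto intro!: derivative_eq_intros simp del: Ipi_simps)
  have sc: "continuous_on Ipi (sol t)" using Ck_on_continuous[OF Ck, of 0] by simp
  have dc: "continuous_on {-pi..pi} d" unfolding d_def using sc by (auto intro!: continuous_intros simp: Ipi_def)
  have "((\<lambda>y. m * cos y) has_integral m * sin pi - m * sin (-pi)) {-pi..pi}"
    by (intro fundamental_theorem_of_calculus)
      (auto intro!: derivative_eq_intros simp: has_real_derivative_iff_has_vector_derivative[symmetric])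
  then have "(d has_integral 0 - 0) {-pi..pi}"
    unfolding d_def using mean sc
    by (intro has_integral_diff) (auto simp: Ipi_def has_integral_iff intro: integrable_continuous_real)
  then have int0: "(d has_integral 0) {-pi..pi}" by simp
  have "\<exists>y0\<in>Ipi. d y0 = 0"
  proof (rule ccontr)
    assume *: "\<not> ?thesis"
    have "(\<forall>y\<in>Ipi. d y > 0) \<or> (\<forall>y\<in>Ipi. d y < 0)"
    proof (rule ccontr)
      assume "\<not> ?thesis"
      then obtain u v where uv: "u \<in> Ipi" "v \<in> Ipi" "d u \<le> 0" "d v \<ge> 0" by (meson not_less)
      have "connected (d ` Ipi)"
        using dc by (intro connected_continuous_image) (auto simp: Ipi_def)
      then have "0 \<in> d ` Ipi" using uv by (intro connectedD_interval[OF _ imageI[OF uv(1)] imageI[OF uv(2)]])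
      then show False using * by auto
    qed
    then show False
    proof
      assume p: "\<forall>y\<in>Ipi. d y > 0"
      have nn: "0 \<le> d y" if "y \<in> {-pi..pi}" for y
        by (rule less_imp_le[OF bspec[OF p]]) (use that in simp)
      have "d 0 = 0"
        using iffD1[OF integral_eq_0_iff[OF dc _ nn] integral_unique[OF int0]] pi_gt_zero by simp
      then show False using bspec[OF p, of 0] by simp
    next
      assume p: "\<forall>y\<in>Ipi. d y < 0"
      have nn: "0 \<le> - d y" if "y \<in> {-pi..pi}" for y
        using bspec[OF p, of y] that by force
      have "integral {-pi..pi} (\<lambda>y. - d y) = 0" using integral_unique[OF int0] by simp
      then have "- d 0 = 0"
        using iffD1[OF integral_eq_0_iff[OF continuous_on_minus[OF dc] _ nn]] pi_gt_zero by simp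
      then show False using bspec[OF p, of 0] by simp
    qed
  qed
  then obtain y0 where y0: "y0 \<in> Ipi" "d y0 = 0" by blast
  obtain z where z: "z \<in> Ipi" "d y - d y0 = (dI 1 (sol t) z + m * sin z) * (y - y0)"
    using DERIV_mvt[OF dd convex_Ipi y y0(1)] by blast
  have "\<bar>y - y0\<bar> \<le> 32/5" using y y0(1) pi_less by (auto simp: abs_if)
  moreover have "\<bar>d y\<bar> = \<bar>dI 1 (sol t) z + m * sin z\<bar> * \<bar>y - y0\<bar>"
    using z(2) y0(2) by (simp add: abs_mult del: dI.simps)
  moreover have "0 \<le> 6000000 * (\<epsilon> * exp (- t / 2))" using \<epsilon>_nonneg by simp
  \<comment> \<open>The factor 32/5 bounds the length \<open>2 * pi\<close>, and
    \<open>6000000 * (32/5) = 38400000\<close> is rounded up to the final constant.\<close>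
  ultimately have "\<bar>d y\<bar> \<le> (6000000 * (\<epsilon> * exp (- t / 2))) * (32/5)"
    using mult_mono[OF slope_decay[OF t z(1)], of "\<bar>y - y0\<bar>" "32/5"] by (simp del: dI.simps)
  also have "\<dots> \<le> 40000000 * (\<epsilon> * exp (- t / 2))"
    using mult_nonneg_nonneg[OF \<epsilon>_nonneg, of "exp (- t / 2)"] by simp
  finally show ?thesis by (simp add: d_def)
qed

end

section \<open>Return to general \<mu> and assembly of the statement\<close>

lemma near_cosI:
  assumes Ck: "Ck_on 3 a0" and mean: "integral Ipi a0 = 0" and \<mu>: "\<mu> > 0"
    and small: "Ck_norm 3 (\<lambda>x. a0 x - \<mu> * cos x) \<le> 1 / 10000 * \<mu>"
    and x0: "x0 \<in> Ipi" and max: "\<forall>x\<in>Ipi. a0 x \<le> a0 x0"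
  defines "f \<equiv> \<lambda>x. a0 x / \<mu>"
  shows "near_cos f (dI 1 f) (dI 2 f) (dI 3 f) (Ck_norm 3 (\<lambda>x. a0 x - \<mu> * cos x) / \<mu>) x0"
    and "dI 2 f x0 = dI 2 a0 x0 / \<mu>"
proof -
  have f: "f = (\<lambda>x. (1 / \<mu>) * a0 x + 0 * a0 x)" by (simp add: f_def)
  have Ckf: "Ck_on 3 f" unfolding f by (rule Ck_on_lincomb[OF Ck Ck])
  have dIf: "dI j f x = dI j a0 x / \<mu>" if "j \<le> 3" "x \<in> Ipi" for j x
    unfolding f using dI_lincomb[OF Ck Ck that, of "1 / \<mu>" 0] by simp
  then show "dI 2 f x0 = dI 2 a0 x0 / \<mu>" using x0 by simp
  have diff: "(\<lambda>x. a0 x - \<mu> * cos x) = (\<lambda>x. 1 * a0 x + (- \<mu>) * cos x)" by simp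
  have close: "\<bar>dI j f x - dI j cos x\<bar> \<le> Ck_norm 3 (\<lambda>x. a0 x - \<mu> * cos x) / \<mu>" if "j \<le> 3" "x \<in> Ipi" for j x
  proof -
    have "\<bar>dI j a0 x - \<mu> * dI j cos x\<bar> \<le> Ck_norm 3 (\<lambda>x. a0 x - \<mu> * cos x)"
      using Ck_norm_ge[OF Ck_on_lincomb[OF Ck Ck_on_cos] that, of 1 "- \<mu>"]
        dI_lincomb[OF Ck Ck_on_cos that, of 1 "- \<mu>"] unfolding diff by simp
    moreover have "dI j f x - dI j cos x = (dI j a0 x - \<mu> * dI j cos x) / \<mu>"
      using dIf[OF that] \<mu> by (simp add: field_simps)
    ultimately show ?thesis using \<mu> by (simp add: abs_divide divide_right_mono)
  qed
  have deriv: "(dI j f has_real_derivative dI (Suc j) f x) (at x within Ipi)" if "j < 3" "x \<in> Ipi" for j x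
    using Ck_on_deriv[OF Ckf that] by (simp only: has_real_derivative_iff_has_vector_derivative)
  have Suc_simps: "Suc 0 = 1" "Suc 1 = 2" "Suc 2 = 3" by simp_all
  have cosj: "dI 1 cos x = - sin x" "dI 2 cos x = - cos x" "dI 3 cos x = sin x" if "x \<in> Ipi" for x
  proof -
    show "dI 1 cos x = - sin x" "dI 2 cos x = - cos x"
      using dI_cos[OF that, of 1] dI_cos[OF that, of 2] by (simp_all add: cos_add)
    have "x + real 3 * (pi / 2) = (x + pi / 2) + pi" by simp
    then show "dI 3 cos x = sin x"
      using dI_cos[OF that, of 3] by (simp only: cos_periodic_pi) (simp add: cos_add)
  qed
  show "near_cos f (dI 1 f) (dI 2 f) (dI 3 f) (Ck_norm 3 (\<lambda>x. a0 x - \<mu> * cos x) / \<mu>) x0"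
  proof
    fix x assume x: "x \<in> Ipi"
    show "(f has_real_derivative dI 1 f x) (at x within Ipi)"
      "(dI 1 f has_real_derivative dI 2 f x) (at x within Ipi)"
      "(dI 2 f has_real_derivative dI 3 f x) (at x within Ipi)"
      using deriv[of 0 x] deriv[of 1 x] deriv[of 2 x] x unfolding Suc_simps dI.simps(1) by simp_all
    show "\<bar>f x - cos x\<bar> \<le> Ck_norm 3 (\<lambda>x. a0 x - \<mu> * cos x) / \<mu>"
      using close[of 0 x] x by simp
    show "\<bar>dI 1 f x + sin x\<bar> \<le> Ck_norm 3 (\<lambda>x. a0 x - \<mu> * cos x) / \<mu>"
      "\<bar>dI 2 f x + cos x\<bar> \<le> Ck_norm 3 (\<lambda>x. a0 x - \<mu> * cos x) / \<mu>"
      "\<bar>dI 3 f x - sin x\<bar> \<le> Ck_norm 3 (\<lambda>x. a0 x - \<mu> * cos x) / \<mu>"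
      using close[of 1 x] close[of 2 x] close[of 3 x] x unfolding cosj[OF x] by (simp_all del: dI.simps)
    show "f x \<le> f x0" using max x \<mu> by (simp add: f_def divide_right_mono del: Ipi_simps)
  next
    show "continuous_on Ipi (dI 3 f)" by (rule Ck_on_continuous[OF Ckf]) simp
    show "Ck_norm 3 (\<lambda>x. a0 x - \<mu> * cos x) / \<mu> \<le> 1 / 10000"
      using small \<mu> by (simp add: divide_le_eq)
    show "integral Ipi f = 0" using mean by (simp add: f_def)
  qed (rule x0)
qed

theorem theorem1p3:
  shows "\<exists>\<delta>>0. \<forall>\<mu>>0. \<exists>C. \<forall>(a0 :: real \<Rightarrow> real) \<sigma>.
    Ck_on 3 a0 \<and> integral Ipi a0 = 0
    \<and> \<sigma> = Ck_norm 3 (\<lambda>x. a0 x - \<mu> * cos x) \<and> \<sigma> \<le> \<delta> * \<mu>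
    \<longrightarrow> (\<exists>a. PJ_sol a0 a
          \<and> (\<forall>b. PJ_sol a0 b \<longrightarrow> (\<forall>t\<ge>0. \<forall>x\<in>Ipi. b t x = a t x))
          \<and> (\<forall>x0\<in>Ipi. (\<forall>x\<in>Ipi. a0 x \<le> a0 x0) \<longrightarrow>
               (let \<mu>s = - dI 2 a0 x0 in
                  \<bar>\<mu>s - \<mu>\<bar> \<le> C * \<sigma>
                  \<and> (\<forall>t\<ge>0. Ck_norm 1 (\<lambda>x. a t x - \<mu>s * cos x)
                             \<le> C * \<sigma> * exp (- \<mu> * t / 2)))))"
proof (rule exI[of _ "1 / 10000"], rule conjI, simp, intro allI impI, rule exI[of _ 40000000], intro allI impI)
  \<comment> \<open>The witness 40000000 is the constant of \<open>sol_decay\<close>. The same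
    number serves every \<mu>, because scaling back multiplies \<open>\<sigma> / \<mu>\<close> by
    \<mu>.\<close>
  fix \<mu> :: real and a0 :: "real \<Rightarrow> real" and \<sigma> :: real
  assume \<mu>: "\<mu> > 0" and H: "Ck_on 3 a0 \<and> integral Ipi a0 = 0
    \<and> \<sigma> = Ck_norm 3 (\<lambda>x. a0 x - \<mu> * cos x) \<and> \<sigma> \<le> 1 / 10000 * \<mu>"
  define f where "f = (\<lambda>x. a0 x / \<mu>)"
  have near: "near_cos f (dI 1 f) (dI 2 f) (dI 3 f) (\<sigma> / \<mu>) x0" "dI 2 f x0 = dI 2 a0 x0 / \<mu>"
    if "x0 \<in> Ipi" "\<forall>x\<in>Ipi. a0 x \<le> a0 x0" for x0
    using near_cosI[of a0 \<mu> x0] H \<mu> that unfolding f_def by blast+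
  have "continuous_on Ipi a0" using H Ck_on_continuous[of 3 a0 0] by simp
  then obtain x1 where x1: "x1 \<in> Ipi" "\<forall>x\<in>Ipi. a0 x \<le> a0 x1"
    using continuous_attains_sup[OF compact_Ipi Ipi_nonempty] by blast
  define u where "u = profile.sol f (f x1)"
  interpret N1: near_cos f "dI 1 f" "dI 2 f" "dI 3 f" "\<sigma> / \<mu>" x1
    by (rule near(1)[OF x1])
  have u: "PJ_sol f u" using N1.PJ_sol by (simp only: u_def N1.M_def)
  have Cu: "Ck_on 3 (u t)" if "t \<ge> 0" for t using u that by (simp add: PJ_sol_def)
  define a where "a = (\<lambda>t x. \<mu> * u (\<mu> * t) x)"
  have "(\<lambda>x. \<mu> * f x) = a0" using \<mu> by (simp add: f_def)
  then have a: "PJ_sol a0 a" using PJ_sol_scale[OF u \<mu>] by (simp add: a_def)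
  show "\<exists>a. PJ_sol a0 a
          \<and> (\<forall>b. PJ_sol a0 b \<longrightarrow> (\<forall>t\<ge>0. \<forall>x\<in>Ipi. b t x = a t x))
          \<and> (\<forall>x0\<in>Ipi. (\<forall>x\<in>Ipi. a0 x \<le> a0 x0) \<longrightarrow>
               (let \<mu>s = - dI 2 a0 x0 in
                  \<bar>\<mu>s - \<mu>\<bar> \<le> 40000000 * \<sigma>
                  \<and> (\<forall>t\<ge>0. Ck_norm 1 (\<lambda>x. a t x - \<mu>s * cos x)
                             \<le> 40000000 * \<sigma> * exp (- \<mu> * t / 2))))"
  proof (intro exI[of _ a] conjI a allI impI ballI)
    fix b :: "real \<Rightarrow> real \<Rightarrow> real" and t x :: real assume "PJ_sol a0 b" "t \<ge> 0" "x \<in> Ipi"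
    then show "b t x = a t x" using PJ_sol_unique[OF a] by blast
  next
    fix x0 assume x0: "x0 \<in> Ipi" "\<forall>x\<in>Ipi. a0 x \<le> a0 x0"
    interpret N0: near_cos f "dI 1 f" "dI 2 f" "dI 3 f" "\<sigma> / \<mu>" x0
      by (rule near(1)[OF x0])
    \<comment> \<open>The explicit solution depends on the point of maximum only through the value
      \<open>M\<close>. Every maximizer thus yields the same \<open>u\<close>, and the decay
      estimate centred at \<open>x0\<close> applies to the solution built from
      \<open>x1\<close>.\<close>
    have "f x0 = f x1" using x0 x1 by (intro antisym N0.max N1.max)
    then have sol: "profile.sol f (near_cos.M f x0) = u" by (simp only: u_def N0.M_def)
    define \<mu>s where "\<mu>s = - dI 2 a0 x0"
    have \<mu>s: "\<mu>s = \<mu> * N0.m" using near(2)[OF x0] \<mu> by (simp add: \<mu>s_def N0.m_def)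
    have \<sigma>: "\<sigma> \<ge> 0" using N0.\<epsilon>_nonneg \<mu> by (simp add: zero_le_divide_iff)
    have "\<mu>s - \<mu> = \<mu> * (N0.m - 1)" by (simp add: \<mu>s right_diff_distrib)
    then have "\<bar>\<mu>s - \<mu>\<bar> = \<mu> * \<bar>N0.m - 1\<bar>" using \<mu> by (simp only: abs_mult abs_of_pos)
    also have "\<dots> \<le> \<mu> * (3 * (\<sigma> / \<mu>))" using N0.m_bounds \<mu> by (intro mult_left_mono) auto
    also have "\<dots> \<le> 40000000 * \<sigma>" using \<mu> \<sigma> by simp
    finally have 1: "\<bar>\<mu>s - \<mu>\<bar> \<le> 40000000 * \<sigma>" .
    have 2: "Ck_norm 1 (\<lambda>x. a t x - \<mu>s * cos x) \<le> 40000000 * \<sigma> * exp (- \<mu> * t / 2)" if t: "t \<ge> 0" for t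
    proof (rule Ck_norm_le)
      fix j :: nat and x assume j: "j \<le> 1" and x: "x \<in> Ipi"
      have mt: "\<mu> * t \<ge> 0" using \<mu> t by simp
      define E where "E = \<sigma> / \<mu> * exp (- (\<mu> * t) / 2)"
      have E: "E \<ge> 0" using \<sigma> \<mu> by (simp add: E_def)
      have sum: "(\<lambda>x. a t x - \<mu>s * cos x) = (\<lambda>x. \<mu> * u (\<mu> * t) x + (- \<mu>s) * cos x)"
        by (simp add: a_def)
      have dI: "dI j (\<lambda>x. a t x - \<mu>s * cos x) x = \<mu> * (dI j (u (\<mu> * t)) x - N0.m * dI j cos x)"
        unfolding sum using dI_lincomb[OF Cu[OF mt] Ck_on_cos, of j x \<mu> "- \<mu>s"] j x
        by (simp add: \<mu>s algebra_simps)
      have "\<bar>dI j (u (\<mu> * t)) x - N0.m * dI j cos x\<bar> \<le> 40000000 * E"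
      proof (cases "j = 0")
        case True
        then show ?thesis using N0.sol_decay[OF mt x] unfolding sol by (simp add: E_def)
      next
        case False
        then have j1: "j = 1" using j by simp
        have "dI 1 cos x = - sin x" using dI_cos[OF x, of 1] by (simp add: cos_add)
        then have "\<bar>dI j (u (\<mu> * t)) x - N0.m * dI j cos x\<bar> \<le> 6000000 * E"
          using N0.slope_decay[OF mt x] unfolding sol j1 E_def by (simp del: dI.simps)
        then show ?thesis using E by linarith
      qed
      then have "\<bar>dI j (\<lambda>x. a t x - \<mu>s * cos x) x\<bar> \<le> \<mu> * (40000000 * E)"
        unfolding dI abs_mult using \<mu> by simp
      also have "\<dots> = 40000000 * \<sigma> * exp (- \<mu> * t / 2)" using \<mu> by (simp add: E_def)
      finally show "\<bar>dI j (\<lambda>x. a t x - \<mu>s * cos x) x\<bar> \<le> 40000000 * \<sigma> * exp (- \<mu> * t / 2)" .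
    qed
    show "let \<mu>s = - dI 2 a0 x0 in
                  \<bar>\<mu>s - \<mu>\<bar> \<le> 40000000 * \<sigma>
                  \<and> (\<forall>t\<ge>0. Ck_norm 1 (\<lambda>x. a t x - \<mu>s * cos x)
                             \<le> 40000000 * \<sigma> * exp (- \<mu> * t / 2))"
      unfolding Let_def \<mu>s_def[symmetric] using 1 2 by blast
  qed
qed

end
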